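(* Let $0<\lambda<W(e^{-\pi-1})$ (so that $\frac{3\pi}4<\omega<\pi$), let $N$ be a positive integer, let $z=\lambda a$ and $\theta=\arg a$. Then \[ |R_N(a,\lambda)|\le\left|\frac{a^N}{(z+a)^{2N+1}}\right|\frac{2(\lambda+1)^{2N+1}}{\sqrt{2\pi}}\int_0^{+\infty}t^{N-\frac12}e^{-t|\lambda+\log\lambda+1+\pi i|}\left|\Gamma^\ast(te^{i\omega})\right|dt\;\times\;\frac{|\csc(\theta-\omega)|+|\csc(\theta+\omega)|}{2}, \] as long as $|\arg a|<-\omega+\pi$.
   Context: For $\lambda>0$, $\omega=\omega(\lambda)=\arg(\lambda+\log\lambda+1+\pi i)\in(0,\pi)$; $a$ is a nonzero complex number. $W$ is the principal branch of the Lambert $W$-function. With $z=\lambda a$, the remainder $R_N(a,\lambda)$ is defined by \[ \Gamma(-a,z)=z^{-a}e^{-z}\left(\sum_{n=0}^{N-1}\frac{a^n b_n(-\lambda)}{(z+a)^{2n+1}}+R_N(a,\lambda)\right) \] (principal values; $\Gamma(\cdot,\cdot)$ is the upper incomplete gamma function), where \[ b_n(-\lambda)=(\lambda+1)^n\left[\frac{d^n}{dt^n}\left(\frac{(\lambda+1)t}{\lambda e^t+t-\lambda}\right)^{n+1}\right]_{t=0} \] and the function in the bracket takes the value $1$ at its removable singularity $t=0$. The scaled gamma function is $\Gamma^\ast(z)=\Gamma(z)/(\sqrt{2\pi}\,z^{z-\frac12}e^{-z})$ for $|\arg z|<\pi$. *)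

theory Defs
  imports "HOL-Analysis.Analysis"
begin

text \<open>
  The principal branch of the Lambert function on the real interval from \<open>-1/e\<close> to infinity:
  there the principal value is the solution of \<open>w e\<^sup>w = x\<close> with \<open>w \<ge> -1\<close>.
\<close>

definition Lambert_W :: "real \<Rightarrow> real" where
  "Lambert_W x = (THE w. w \<ge> -1 \<and> w * exp w = x)"

definition csc :: "real \<Rightarrow> real" where
  "csc x = 1 / sin x"

text \<open>
  The principal value of the upper incomplete gamma function on the plane cut along the
  non-positive reals.  The path of integration from \<open>z\<close> to infinity is the horizontal ray,
  which does not meet the cut, so that the principal power is holomorphic along it.
  No meaning is intended for \<open>z\<close> on the cut.
\<close>

definition upper_Gamma :: "complex \<Rightarrow> complex \<Rightarrow> complex" where
  "upper_Gamma s z =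
     (LBINT t:{0<..}. (z + of_real t) powr (s - 1) * exp (- (z + of_real t)))"

text \<open>The scaled gamma function; it is meant for \<open>z\<close> off the non-positive reals.\<close>

definition Gamma_star :: "complex \<Rightarrow> complex" where
  "Gamma_star z =
     Gamma z / (of_real (sqrt (2 * pi)) * z powr (z - 1 / 2) * exp (- z))"

text \<open>\<open>b_neg n lam\<close> is \<open>b\<^sub>n(-lam)\<close>.\<close>

definition b_neg_base :: "real \<Rightarrow> complex \<Rightarrow> complex" where
  "b_neg_base lam t =
     (if t = 0 then 1
      else (of_real lam + 1) * t / (of_real lam * exp t + t - of_real lam))"

definition b_neg :: "nat \<Rightarrow> real \<Rightarrow> complex" where
  "b_neg n lam = (of_real lam + 1) ^ n * (deriv ^^ n) (\<lambda>t. b_neg_base lam t ^ (n + 1)) 0"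

text \<open>The defining relation of \<open>R\<^sub>N(a,lam)\<close>, with \<open>z = lam * a\<close>, solved for the remainder.\<close>

definition remainder_R :: "nat \<Rightarrow> complex \<Rightarrow> real \<Rightarrow> complex" where
  "remainder_R N a lam =
     (let z = of_real lam * a in
        upper_Gamma (- a) z / (z powr (- a) * exp (- z))
        - (\<Sum>n<N. a ^ n * b_neg n lam / (z + a) ^ (2 * n + 1)))"

definition omega :: "real \<Rightarrow> real" where
  "omega lam = Arg (of_real lam + of_real (ln lam) + 1 + of_real pi * \<i>)"

end

(*
  With f(t) = lam (e^t - 1) + t one has Gamma(-a, lam a) (lam a)^a e^(lam a) = F(a), the integral of
  e^(-a f(t)) over t > 0, for Re a > 0.  The integral over t < 0, for Re a < 0, has the same asymptotic
  expansion, because both sides are expanded by the same integration by parts at t = 0, and it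
  continues to a meromorphic function E(a) with poles only on the positive axis.  On Re a > 0 the two
  differ by the jump J(a) = Gamma(-a) (lam a)^a e^(lam a).  For small lam this jump is exponentially
  small in the sectors pi - omega <= |arg a| <= pi/2, so there the expansion of F transfers to E.
  Cauchy's formula for a^N R_N(a) in the sector |arg a| < pi - omega and Cauchy's theorem for the
  remainder of E in the complementary sector (large triangles; the outer sides vanish in the limit)
  express a^N R_N(a) by integrals of b^N J(b) / (b - a) along the rays arg b = +-(pi - omega).  There
  |J| is explicit in terms of Gamma*, and the distance from a to a ray yields the cosecants.
  No Stirling formula is needed: a product bound for Gamma(-b) suffices for the decay of J.
*)

theory Submission
  imports Defs "HOL-Complex_Analysis.Complex_Analysis" "HOL-Real_Asymp.Real_Asymp"
begin

text \<open>The number \<open>c = lam + ln lam + 1 + pi * \<i>\<close> of the bound is minus the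
  value of the phase at its critical point \<open>- ln lam - pi * \<i>\<close>, and the rays arg b =
  +-(pi - omega) are the directions in which the exponential factor of the jump decays fastest, with
  rate \<open>norm c\<close>. Two obstacles shape the argument. The first is a bound for the jump in
  a whole sector. The product estimate for Gamma(-b) gives away the factor exp(-(pi - |Arg b|) |Im
  b|) of its true size. Since \<open>lam * exp lam\<close> is at most exp(-pi - 1), what is left of
  the jump is still of order exp(-pi Re b - Arg b Im b) up to powers, and the second term of the
  exponent alone suffices where |Arg b| is bounded below. The second is the vertex b = 0, which lies
  on all contours and at which both half-line integrals lose convergence. Multiplication by b^N with
  N >= 1 amounts to N integrations by parts, whose amplitudes decay by themselves; the right
  remainder thus stays continuous up to the imaginary axis, and the pole of the left one at 0
  cancels.\<close>

subsection \<open>Integrals depending on a parameter\<close>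

text \<open>Differentiation under the integral sign by dominated convergence, where only the
  integrand and not its derivative has to be dominated locally. The measure is arbitrary because
  Lebesgue measure serves the integrals and counting measure serves the pole series.\<close>

lemma holomorphic_on_lebesgue_integral:
  fixes K :: "complex \<Rightarrow> 'a \<Rightarrow> complex"
  assumes S: "open S"
    and meas: "\<And>b. b \<in> S \<Longrightarrow> K b \<in> borel_measurable M"
    and hol: "\<And>t. t \<in> space M \<Longrightarrow> (\<lambda>b. K b t) holomorphic_on S"
    and dom: "\<And>b. b \<in> S \<Longrightarrow> \<exists>d>0. \<exists>g. integrable M g \<and> cball b d \<subseteq> S \<and>
                (\<forall>w\<in>cball b d. \<forall>t\<in>space M. norm (K w t) \<le> g t)"
  shows "(\<lambda>b. integral\<^sup>L M (K b)) holomorphic_on S"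
proof (rule holomorphic_onI)
  fix b assume b: "b \<in> S"
  obtain d g where d: "d > 0" and g: "integrable M g" and sub: "cball b d \<subseteq> S"
    and le: "\<And>w t. w \<in> cball b d \<Longrightarrow> t \<in> space M \<Longrightarrow> norm (K w t) \<le> g t"
    using dom[OF b] by metis
  define D where "D = (\<lambda>t. deriv (\<lambda>b. K b t) b)"
  have int: "integrable M (K w)" if "w \<in> cball b d" for w
    by (rule Bochner_Integration.integrable_bound[OF g])
       (use that sub meas le in \<open>fastforce intro!: AE_I2\<close>)+
  have D: "((\<lambda>w. (K w t - K b t) / (w - b)) \<longlongrightarrow> D t) (at b)" if "t \<in> space M" for t
    unfolding D_def
    using holomorphic_derivI[OF hol[OF that] S b, of UNIV] by (simp add: has_field_derivative_iff)
  \<comment> \<open>Cauchy's inequality on discs of radius \<open>d/2\<close> inside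
    \<open>cball b d\<close> bounds the derivative by \<open>2 * g t / d\<close>; the mean value
    inequality turns this into a dominating function for the difference quotients.\<close>
  have lip: "norm ((K w t - K b t) / (w - b)) \<le> 2 * g t / d"
    if w: "w \<in> cball b (d/2)" "w \<noteq> b" and t: "t \<in> space M" for w t
  proof -
    have der: "norm (deriv (\<lambda>b. K b t) x) \<le> 2 * g t / d" if x: "x \<in> cball b (d/2)" for x
    proof -
      have xb: "cball x (d/2) \<subseteq> cball b d"
      proof
        fix y assume "y \<in> cball x (d/2)"
        then show "y \<in> cball b d" using x dist_triangle[of b y x] by (simp add: mem_cball)
      qed
      have hx: "(\<lambda>b. K b t) holomorphic_on cball x (d/2)"
        using hol[OF t] xb sub by (meson holomorphic_on_subset order_trans)
      have "norm ((deriv ^^ 1) (\<lambda>b. K b t) x) \<le> fact 1 * g t / (d/2) ^ 1"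
      proof (rule Cauchy_inequality)
        show "(\<lambda>b. K b t) holomorphic_on ball x (d/2)"
          using hx by (rule holomorphic_on_subset) auto
        show "continuous_on (cball x (d/2)) (\<lambda>b. K b t)"
          using hx holomorphic_on_imp_continuous_on by blast
        fix y assume "norm (x - y) = d/2"
        then have "y \<in> cball x (d/2)" by (simp add: dist_norm)
        then show "norm (K y t) \<le> g t" using le t xb by blast
      qed (use d in auto)
      then show ?thesis by (simp add: field_simps)
    qed
    have "norm (K w t - K b t) \<le> (2 * g t / d) * norm (w - b)"
    proof (rule field_differentiable_bound[of "cball b (d/2)"])
      fix z assume z: "z \<in> cball b (d/2)"
      then have "z \<in> S" using sub d by (auto simp: subset_iff)
      then show "((\<lambda>b. K b t) has_field_derivative deriv (\<lambda>b. K b t) z) (at z within cball b (d/2))"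
        using holomorphic_derivI[OF hol[OF t] S] has_field_derivative_at_within by blast
      show "norm (deriv (\<lambda>b. K b t) z) \<le> 2 * g t / d" using der z by simp
    qed (use w d in auto)
    then show ?thesis using w by (simp add: norm_divide field_simps)
  qed
  have lim: "((\<lambda>w. (integral\<^sup>L M (K w) - integral\<^sup>L M (K b)) / (w - b)) \<longlongrightarrow> integral\<^sup>L M D) (at b)"
    unfolding tendsto_at_iff_sequentially comp_def
  proof (intro allI impI)
    fix X :: "nat \<Rightarrow> complex"
    assume X: "\<forall>i. X i \<in> UNIV - {b}" "X \<longlonglongrightarrow> b"
    have ev: "eventually (\<lambda>n. X n \<in> ball b (d/2)) sequentially"
      using X(2) d by (intro topological_tendstoD) auto
    obtain n0 where n0: "\<And>n. n \<ge> n0 \<Longrightarrow> X n \<in> ball b (d/2)"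
      using ev unfolding eventually_sequentially by blast
    \<comment> \<open>Dominated convergence asks for the bound at every index, so the initial
      segment outside the small disc is dropped.\<close>
    define Y where "Y n = X (n + n0)" for n
    have Yb: "Y n \<in> cball b (d/2)" "Y n \<noteq> b" "Y n \<in> cball b d" for n
      using n0[of "n + n0"] X(1) d unfolding Y_def by auto
    have Y: "Y \<longlonglongrightarrow> b" unfolding Y_def using X(2) by (rule LIMSEQ_ignore_initial_segment)
    have Yat: "filterlim Y (at b) sequentially"
      using Y Yb(2) by (auto simp: filterlim_at)
    have "(\<lambda>n. integral\<^sup>L M (\<lambda>t. (K (Y n) t - K b t) / (Y n - b))) \<longlonglongrightarrow> integral\<^sup>L M D"
    proof (rule integral_dominated_convergence[where w="\<lambda>t. 2 * g t / d"])
      have m: "(\<lambda>t. (K (Y n) t - K b t) / (Y n - b)) \<in> borel_measurable M" for n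
        using meas[of "Y n"] meas[OF b] Yb(3)[of n] sub by (auto intro!: borel_measurable_divide borel_measurable_diff)
      show "(\<lambda>t. (K (Y n) t - K b t) / (Y n - b)) \<in> borel_measurable M" for n by (rule m)
      have pt: "(\<lambda>n. (K (Y n) t - K b t) / (Y n - b)) \<longlonglongrightarrow> D t" if "t \<in> space M" for t
        using filterlim_compose[OF D[OF that] Yat] .
      show "D \<in> borel_measurable M"
        by (rule borel_measurable_LIMSEQ_metric[OF m pt])
      show "integrable M (\<lambda>t. 2 * g t / d)" using g by auto
      show "AE t in M. (\<lambda>n. (K (Y n) t - K b t) / (Y n - b)) \<longlonglongrightarrow> D t"
        using pt by (intro AE_I2) auto
      show "AE t in M. norm ((K (Y n) t - K b t) / (Y n - b)) \<le> 2 * g t / d" for n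
        using lip Yb by (intro AE_I2) auto
    qed
    also have "(\<lambda>n. integral\<^sup>L M (\<lambda>t. (K (Y n) t - K b t) / (Y n - b)))
        = (\<lambda>n. (integral\<^sup>L M (K (Y n)) - integral\<^sup>L M (K b)) / (Y n - b))"
      using int Yb(3) d by (intro ext) (simp add: Bochner_Integration.integral_diff)
    finally have "(\<lambda>n. (integral\<^sup>L M (K (X (n+n0))) - integral\<^sup>L M (K b)) / (X (n+n0) - b)) \<longlonglongrightarrow> integral\<^sup>L M D"
      unfolding Y_def .
    then show "(\<lambda>n. (integral\<^sup>L M (K (X n)) - integral\<^sup>L M (K b)) / (X n - b)) \<longlonglongrightarrow> integral\<^sup>L M D"
      by (rule LIMSEQ_offset)
  qed
  then have "((\<lambda>b. integral\<^sup>L M (K b)) has_field_derivative integral\<^sup>L M D) (at b)"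
    by (simp add: has_field_derivative_iff)
  then show "(\<lambda>b. integral\<^sup>L M (K b)) field_differentiable at b within S"
    using field_differentiable_at_within field_differentiable_def by blast
qed

lemma continuous_on_lebesgue_integral:
  fixes K :: "'b::metric_space \<Rightarrow> 'a \<Rightarrow> 'c::{banach, second_countable_topology}"
  assumes meas: "\<And>b. b \<in> S \<Longrightarrow> K b \<in> borel_measurable M"
    and cont: "\<And>t. t \<in> space M \<Longrightarrow> continuous_on S (\<lambda>b. K b t)"
    and g: "integrable M g"
    and dom: "\<And>b t. b \<in> S \<Longrightarrow> t \<in> space M \<Longrightarrow> norm (K b t) \<le> g t"
  shows "continuous_on S (\<lambda>b. integral\<^sup>L M (K b))"
  unfolding continuous_on_sequentially comp_def
proof (intro allI ballI impI)
  fix X b assume X: "b \<in> S" "(\<forall>n. X n \<in> S) \<and> X \<longlonglongrightarrow> b"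
  show "(\<lambda>n. integral\<^sup>L M (K (X n))) \<longlonglongrightarrow> integral\<^sup>L M (K b)"
  proof (rule integral_dominated_convergence[where w=g])
    show "AE t in M. (\<lambda>n. K (X n) t) \<longlonglongrightarrow> K b t"
      using X cont unfolding continuous_on_sequentially comp_def by (intro AE_I2) auto
  qed (use X meas g dom in auto)
qed

section \<open>Half-line integrals with exponential decay\<close>

lemma set_integrable_exp_neg:
  assumes "(a::real) > 0"
  shows "set_integrable lborel {0<..} (\<lambda>x. exp (- (a * x)))"
proof -
  have "(\<lambda>x. exp (-a * x)) absolutely_integrable_on {0..}"
    by (intro nonnegative_absolutely_integrable_1 integrable_on_exp_minus_to_infinity assms) auto
  then have "(\<lambda>x. exp (-a * x)) absolutely_integrable_on {0<..}"
    by (rule set_integrable_subset) auto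
  then show ?thesis
    unfolding set_integrable_def
    by (subst (asm) integrable_completion) (auto simp: intro!: borel_measurable_continuous_on_indicator continuous_intros)
qed

lemma set_integrable_exp_bound:
  fixes f :: "real \<Rightarrow> 'a::{banach, second_countable_topology}"
  assumes a: "a > 0" and cont: "continuous_on {0<..} f"
    and le: "\<And>x. x > 0 \<Longrightarrow> norm (f x) \<le> C * exp (- (a * x))"
  shows "set_integrable lborel {0<..} f"
proof (rule set_integrable_bound)
  show "set_integrable lborel {0<..} (\<lambda>x. C * exp (- (a * x)))"
    using set_integrable_exp_neg[OF a] by auto
  show "set_borel_measurable lborel {0<..} f"
    unfolding set_borel_measurable_def using cont
    by (simp add: borel_measurable_continuous_on_indicator)
  have "C * exp (- (a * x)) \<le> norm (C * exp (- (a * x)))" for x by (simp only: real_norm_def abs_ge_self)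
  then show "AE x in lborel. x \<in> {0<..} \<longrightarrow> norm (f x) \<le> norm (C * exp (- (a * x)))"
    using le order_trans by (intro AE_I2) blast
qed

text \<open>Stated as a limit of \<open>F T - F 0\<close>, because for the incomplete gamma function
  \<open>F\<close> is an unspecified primitive whose behaviour at infinity is not known
  beforehand.\<close>

lemma set_integral_FTC_limit:
  fixes f F :: "real \<Rightarrow> 'a::euclidean_space"
  assumes F: "\<And>x. x \<ge> 0 \<Longrightarrow> (F has_vector_derivative f x) (at x)"
    and f: "\<And>x. x \<ge> 0 \<Longrightarrow> isCont f x"
    and int: "set_integrable lborel {0<..} f"
  shows "((\<lambda>T. F T - F 0) \<longlongrightarrow> (LBINT x:{0<..}. f x)) at_top"
proof -
  let ?g = "\<lambda>x. indicator {0<..} x *\<^sub>R f x"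
  have "((\<lambda>T. LBINT x. indicator {..T} x *\<^sub>R ?g x) \<longlongrightarrow> (LBINT x. ?g x)) at_top"
    using int by (intro tendsto_integral_at_top) (simp_all add: set_integrable_def)
  moreover have "eventually (\<lambda>T. (LBINT x. indicator {..T} x *\<^sub>R ?g x) = F T - F 0) at_top"
    using eventually_gt_at_top[of 0]
  proof eventually_elim
    case (elim T)
    have "(LBINT x. indicator {..T} x *\<^sub>R ?g x) = (LBINT x:{0<..T}. f x)"
      unfolding set_lebesgue_integral_def by (intro Bochner_Integration.integral_cong) (auto simp: indicator_def)
    also have "\<dots> = (LBINT x=0..T. f x)"
      unfolding zero_ereal_def using elim by (simp only: interval_integral_Ioc less_imp_le)
    also have "\<dots> = F T - F 0"
      unfolding zero_ereal_def
    proof (rule interval_integral_FTC_finite)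
      have m: "min 0 T = 0" "max 0 T = T" using elim by auto
      show "continuous_on {min 0 T..max 0 T} f"
        unfolding m by (rule continuous_at_imp_continuous_on) (simp add: f)
      show "(F has_vector_derivative f x) (at x within {min 0 T..max 0 T})" if "min 0 T \<le> x" for x
        using that unfolding m by (rule has_vector_derivative_at_within[OF F])
    qed
    finally show ?case .
  qed
  ultimately show ?thesis
    unfolding set_lebesgue_integral_def by (rule Lim_transform_eventually)
qed

lemma set_integral_FTC_halfline:
  fixes f F :: "real \<Rightarrow> 'a::euclidean_space"
  assumes F: "\<And>x. x \<ge> 0 \<Longrightarrow> (F has_vector_derivative f x) (at x)"
    and f: "\<And>x. x \<ge> 0 \<Longrightarrow> isCont f x"
    and int: "set_integrable lborel {0<..} f"
    and lim: "(F \<longlongrightarrow> L) at_top"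
  shows "(LBINT x:{0<..}. f x) = L - F 0"
proof (rule tendsto_unique[OF _ set_integral_FTC_limit[OF F f int]])
  show "((\<lambda>T. F T - F 0) \<longlongrightarrow> L - F 0) at_top" by (rule tendsto_diff[OF lim tendsto_const])
qed simp

lemma set_integral_exp_neg:
  assumes "Re a > 0"
  shows "(LBINT x:{0<..}. exp (- (a * of_real x))) = 1 / a"
proof -
  have a0: "a \<noteq> 0" using assms by auto
  have "(LBINT x:{0<..}. exp (- (a * of_real x))) = 0 - (- (1/a) * exp (- (a * of_real 0)))"
  proof (rule set_integral_FTC_halfline[where F="\<lambda>x. - (1/a) * exp (- (a * of_real x))"])
    fix x :: real
    have "((\<lambda>z. - (1/a) * exp (- (a * z))) has_field_derivative - (1/a) * (exp (- (a * of_real x)) * - a)) (at (of_real x))"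
      by (rule derivative_eq_intros refl)+ simp
    then have "((\<lambda>z. - (1/a) * exp (- (a * z))) has_field_derivative exp (- (a * of_real x))) (at (of_real x))"
      using a0 by simp
    from has_vector_derivative_real_field[OF this]
    show "((\<lambda>x. - (1/a) * exp (- (a * of_real x))) has_vector_derivative exp (- (a * of_real x))) (at x)" .
    show "isCont (\<lambda>x. exp (- (a * of_real x))) x" by (intro continuous_intros)
  next
    show "set_integrable lborel {0<..} (\<lambda>x. exp (- (a * of_real x)))"
    proof (rule set_integrable_exp_bound[where a="Re a" and C=1])
      show "continuous_on {0<..} (\<lambda>x. exp (- (a * of_real x)))" by (intro continuous_intros)
    qed (use assms in simp_all)
    have "((\<lambda>x. k * exp (- (c * x))) \<longlongrightarrow> 0) at_top" if "c > 0" for c k :: real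
      using that by real_asymp
    from this[OF assms] 
    have "((\<lambda>x. norm (- (1/a)) * exp (- (Re a * x))) \<longlongrightarrow> 0) at_top" .
    then have "((\<lambda>x. norm (- (1/a) * exp (- (a * of_real x)))) \<longlongrightarrow> 0) at_top"
      by (simp only: norm_mult norm_exp_eq_Re) simp
    then show "((\<lambda>x. - (1/a) * exp (- (a * of_real x))) \<longlongrightarrow> 0) at_top"
      by (rule tendsto_norm_zero_cancel)
  qed
  then show ?thesis by simp
qed

subsection \<open>Integration by parts on the two half-lines\<close>

definition phase :: "real \<Rightarrow> complex \<Rightarrow> complex" where
  "phase lam t = of_real lam * (exp t - 1) + t"

text \<open>The amplitudes obey \<open>d\<^sub>0 = 1\<close>, \<open>d\<^sub>n\<^sub>+\<^sub>1 = (d\<^sub>n / f')'\<close> with \<open>f\<close> the phase; in the variable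
  \<open>X = 1 / f' = 1 / (1 + lam e\<^sup>t)\<close> they are polynomials because \<open>X' = X\<^sup>2 - X\<close>, and the factor \<open>X\<^sup>2 - X\<close>
  makes \<open>d\<^sub>n\<close>, \<open>n > 0\<close>, decay exponentially at both ends of the real line.\<close>

primrec amp_poly :: "nat \<Rightarrow> complex poly" where
  "amp_poly 0 = 1"
| "amp_poly (Suc n) = [:0, -1, 1:] * pderiv ([:0, 1:] * amp_poly n)"

definition amp :: "real \<Rightarrow> nat \<Rightarrow> complex \<Rightarrow> complex" where
  "amp lam n t = poly (amp_poly n) (1 / (1 + of_real lam * exp t))"

lemma amp_0 [simp]: "amp lam 0 t = 1"
  by (simp add: amp_def)

lemma phase_has_field_derivative:
  "(phase lam has_field_derivative (1 + of_real lam * exp t)) (at t within S)"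
  unfolding phase_def by (rule derivative_eq_intros refl)+ simp

lemmas phase_derivative_eq [derivative_intros] = DERIV_chain2[OF phase_has_field_derivative]

lemma amp_recurrence:
  assumes nz: "1 + of_real lam * exp t \<noteq> 0"
  shows "((\<lambda>t. amp lam n t / (1 + of_real lam * exp t)) has_field_derivative amp lam (Suc n) t) (at t within S)"
proof -
  define D where "D = (\<lambda>t::complex. 1 + of_real lam * exp t)"
  define X where "X = (\<lambda>t. inverse (D t))"
  have D: "(D has_field_derivative (D t - 1)) (at t within S)"
    unfolding D_def by (rule derivative_eq_intros refl)+ simp
  have "X t * D t = 1" using nz by (simp add: X_def D_def)
  then have "- (X t * (D t - 1) * X t) = (X t)\<^sup>2 - X t"
    by (simp add: algebra_simps power2_eq_square)
  then have X: "(X has_field_derivative (X t)\<^sup>2 - X t) (at t within S)"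
    using DERIV_inverse'[OF D] nz unfolding X_def D_def by simp
  have "((\<lambda>t. poly ([:0, 1:] * amp_poly n) (X t)) has_field_derivative
      poly (pderiv ([:0, 1:] * amp_poly n)) (X t) * ((X t)\<^sup>2 - X t)) (at t within S)"
    by (rule DERIV_chain2[OF poly_DERIV X])
  also have "(\<lambda>t. poly ([:0, 1:] * amp_poly n) (X t)) = (\<lambda>t. amp lam n t / (1 + of_real lam * exp t))"
    by (auto simp: X_def D_def amp_def divide_inverse)
  also have "poly (pderiv ([:0, 1:] * amp_poly n)) (X t) * ((X t)\<^sup>2 - X t) = amp lam (Suc n) t"
    by (simp add: amp_def X_def D_def algebra_simps power2_eq_square divide_inverse)
  finally show ?thesis .
qed

lemma poly_bounded_unit_disc:
  fixes p :: "complex poly"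
  obtains B where "B \<ge> 0" "\<And>z. norm z \<le> 1 \<Longrightarrow> norm (poly p z) \<le> B"
proof -
  have "compact (poly p ` cball 0 1)"
    by (intro compact_continuous_image continuous_intros) auto
  then obtain B where "\<And>y. y \<in> poly p ` cball 0 1 \<Longrightarrow> norm y \<le> B"
    using compact_imp_bounded bounded_iff by metis
  then have "norm (poly p z) \<le> max B 0" if "norm z \<le> 1" for z using that by fastforce
  then show ?thesis using that[of "max B 0"] by auto
qed

context
  fixes lam :: real
  assumes lam: "lam > 0"
begin

lemma one_plus_exp_nz: "1 + of_real lam * exp (of_real x :: complex) \<noteq> 0"
proof -
  have "1 + of_real lam * exp (of_real x :: complex) = of_real (1 + lam * exp x)"
    by (simp add: exp_of_real)
  moreover have "1 + lam * exp x > 0" using lam by (simp add: add_pos_pos)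
  ultimately show ?thesis by (metis less_irrefl of_real_eq_0_iff)
qed

lemma amp_bounded:
  obtains B where "B \<ge> 0" "\<And>x::real. norm (amp lam n (of_real x)) \<le> B"
proof -
  obtain B where B: "B \<ge> 0" "\<And>z. norm z \<le> 1 \<Longrightarrow> norm (poly (amp_poly n) z) \<le> B"
    using poly_bounded_unit_disc by metis
  have "norm (amp lam n (of_real x)) \<le> B" for x
  proof -
    have e: "1 / (1 + of_real lam * exp (of_real x :: complex)) = of_real (1 / (1 + lam * exp x))"
      by (simp add: exp_of_real)
    have "\<bar>1 / (1 + lam * exp x)\<bar> \<le> 1" using lam by (simp add: add_pos_pos)
    then show ?thesis unfolding amp_def e by (intro B) (simp only: norm_of_real)
  qed
  then show ?thesis using that B by blast
qed

text \<open>The factor X - X^2 equals y / (1 + y)^2 with y = \<open>lam * exp x\<close>, which is at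
  most 1/y and at most y; these two bounds decay at the two ends of the line. The remaining factor
  is a polynomial in X, and X lies between 0 and 1.\<close>

lemma amp_exp_bounded:
  obtains B where "B \<ge> 0" "\<And>x::real. norm (amp lam (Suc n) (of_real x)) \<le> B * exp (- \<bar>x\<bar>)"
proof -
  obtain B where B: "B \<ge> 0" "\<And>z. norm z \<le> 1 \<Longrightarrow> norm (poly (pderiv ([:0, 1:] * amp_poly n)) z) \<le> B"
    using poly_bounded_unit_disc by metis
  \<comment> \<open>The bound y = \<open>lam * exp x\<close> is used for negative \<open>x\<close>
    and 1/y for the others, so the constant has to exceed both \<open>lam\<close> and
    \<open>1 / lam\<close>.\<close>
  define C where "C = max lam (1 / lam)"
  have C: "C \<ge> lam" "C \<ge> 1/lam" "C > 0" using lam by (auto simp: C_def less_max_iff_disj)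
  have "norm (amp lam (Suc n) (of_real x)) \<le> (C * B) * exp (- \<bar>x\<bar>)" for x
  proof -
    define y where "y = lam * exp x"
    have y: "y > 0" using lam by (simp add: y_def)
    define X where "X = 1 / (1 + y)"
    have e: "1 / (1 + of_real lam * exp (of_real x :: complex)) = of_real X"
      by (simp add: X_def y_def exp_of_real)
    have X1: "\<bar>X\<bar> \<le> 1" using y by (simp add: X_def)
    have "X * (1 + y) = 1" using y by (simp add: X_def)
    then have "X - X^2 = y * X^2" by algebra
    then have XX: "X - X^2 = y / (1+y)^2" by (simp add: X_def power_divide)
    have "y / (1+y)^2 \<le> C * exp (- \<bar>x\<bar>)"
    proof (cases "x \<ge> 0")
      case True
      have "y * y \<le> (1+y)^2" using y by (simp add: power2_eq_square algebra_simps)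
      then have "y / (1+y)^2 \<le> 1 / y" using y by (simp add: divide_simps)
      also have "\<dots> = (1/lam) * exp (-x)" using lam by (simp add: y_def exp_minus field_simps)
      also have "\<dots> \<le> C * exp (-x)" using C by (intro mult_right_mono) auto
      finally show ?thesis using True by simp
    next
      case False
      have "1 \<le> (1+y)^2" using y by (simp add: power2_eq_square algebra_simps)
      then have "y / (1+y)^2 \<le> y / 1" using y by (intro divide_left_mono) auto
      also have "\<dots> \<le> C * exp x" unfolding y_def using C by simp
      finally show ?thesis using False by simp
    qed
    moreover have "y / (1+y)^2 \<ge> 0" using y by simp
    ultimately have "\<bar>X^2 - X\<bar> \<le> C * exp (- \<bar>x\<bar>)" using XX by linarith
    moreover have "poly [:0, -1, 1:] (of_real X :: complex) = of_real (X^2 - X)"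
      by (simp add: power2_eq_square algebra_simps)
    ultimately have 1: "norm (poly [:0, -1, 1:] (of_real X :: complex)) \<le> C * exp (- \<bar>x\<bar>)"
      by (simp only: norm_of_real)
    have 2: "norm (poly (pderiv ([:0, 1:] * amp_poly n)) (of_real X)) \<le> B"
      using X1 by (intro B) (simp only: norm_of_real)
    have "norm (amp lam (Suc n) (of_real x)) \<le> (C * exp (- \<bar>x\<bar>)) * B"
      unfolding amp_def e amp_poly.simps poly_mult norm_mult[of "poly [:0, -1, 1:] _"]
      using 1 2 C by (intro mult_mono) auto
    then show ?thesis by (simp add: mult_ac)
  qed
  then show ?thesis using that[of "C*B"] B C by auto
qed

text \<open>The sign \<open>sg\<close> selects the half-line \<open>t > 0\<close> or \<open>t < 0\<close>.\<close>

definition half_integrand :: "real \<Rightarrow> nat \<Rightarrow> complex \<Rightarrow> real \<Rightarrow> complex" where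
  "half_integrand sg n b x = exp (- (b * phase lam (of_real (sg * x)))) * amp lam n (of_real (sg * x))"

definition half_integral :: "real \<Rightarrow> nat \<Rightarrow> complex \<Rightarrow> complex" where
  "half_integral sg n b = of_real sg * (LBINT x:{0<..}. half_integrand sg n b x)"

text \<open>At a real point the two summands of the phase have the same sign, so the phase is real
  and at least as large in modulus as the point itself.\<close>

lemma norm_exp_phase_le:
  assumes sg: "sg = 1 \<or> sg = -1" and b: "sg * Re b \<ge> 0" and x: "x \<ge> 0"
  shows "norm (exp (- (b * phase lam (of_real (sg * x))))) \<le> exp (- (sg * Re b * x))"
proof -
  define r where "r = lam * (exp (sg * x) - 1) + sg * x"
  have ph: "phase lam (of_real (sg * x)) = of_real r"
    by (simp add: phase_def r_def exp_of_real[symmetric])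
  have "x \<le> sg * r" using sg lam x unfolding r_def by (auto simp: mult_le_0_iff)
  then have "(sg * Re b) * x \<le> (sg * Re b) * (sg * r)" using b by (intro mult_left_mono)
  also have "\<dots> = Re b * r" using sg by auto
  finally show ?thesis unfolding ph by simp
qed

lemma half_integrand_continuous:
  "continuous_on S (half_integrand sg n b)" "isCont (half_integrand sg n b) x"
proof -
  have "continuous_on UNIV (half_integrand sg n b)"
    unfolding half_integrand_def phase_def amp_def
    by (intro continuous_intros one_plus_exp_nz ballI)
  then show "continuous_on S (half_integrand sg n b)" "isCont (half_integrand sg n b) x"
    using continuous_on_subset continuous_on_eq_continuous_at by blast+
qed

lemma half_integrand_measurable:
  "(\<lambda>x. indicator {0<..} x *\<^sub>R half_integrand sg n b x) \<in> borel_measurable borel"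
  by (rule borel_measurable_continuous_on_indicator[OF _ half_integrand_continuous(1)]) simp

lemma half_integrand_bound:
  assumes sg: "sg = 1 \<or> sg = -1" and b: "sg * Re b \<ge> 0"
    and B: "\<And>x::real. norm (amp lam n (of_real x)) \<le> B" and x: "x > 0"
  shows "norm (half_integrand sg n b x) \<le> B * exp (- (sg * Re b * x))"
proof -
  have B0: "0 \<le> B" using B[of 0] norm_ge_zero order_trans by blast
  have "norm (half_integrand sg n b x) \<le> exp (- (sg * Re b * x)) * B"
    unfolding half_integrand_def norm_mult
    by (rule mult_mono) (use norm_exp_phase_le[OF sg b, of x] B[of "sg * x"] x in \<open>simp_all del: norm_exp_eq_Re of_real_mult\<close>)
  then show ?thesis by (simp add: mult_ac)
qed

text \<open>On the line \<open>Re b = 0\<close> the exponential contributes no decay; here the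
  amplitude supplies all of it, uniformly in \<open>b\<close> up to the imaginary axis.\<close>

lemma half_integrand_Suc_bound:
  assumes sg: "sg = 1 \<or> sg = -1" and b: "sg * Re b \<ge> 0"
    and B: "\<And>x::real. norm (amp lam (Suc n) (of_real x)) \<le> B * exp (- \<bar>x\<bar>)" and x: "x > 0"
  shows "norm (half_integrand sg (Suc n) b x) \<le> B * exp (- x)"
proof -
  have B0: "0 \<le> B" using order_trans[OF norm_ge_zero B[of 0]] by simp
  have e1: "exp (- (sg * Re b * x)) \<le> 1" using b x by simp
  have "norm (half_integrand sg (Suc n) b x) \<le> 1 * (B * exp (- \<bar>sg * x\<bar>))"
    unfolding half_integrand_def norm_mult
    by (rule mult_mono) (use order_trans[OF norm_exp_phase_le[OF sg b, of x] e1] B[of "sg*x"] x B0 in \<open>simp_all del: norm_exp_eq_Re of_real_mult\<close>)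
  also have "\<bar>sg * x\<bar> = x" using sg x by auto
  finally show ?thesis by simp
qed

lemma half_integrand_integrable:
  assumes "sg = 1 \<or> sg = -1" and "sg * Re b > 0"
  shows "set_integrable lborel {0<..} (half_integrand sg n b)"
proof -
  obtain B where B: "\<And>x::real. norm (amp lam n (of_real x)) \<le> B" using amp_bounded by metis
  show ?thesis
    by (rule set_integrable_exp_bound[where a="sg * Re b" and C=B, OF _ half_integrand_continuous(1)])
      (use half_integrand_bound[OF assms(1) _ B, of b] assms(2) in auto)
qed

lemma half_integral_Suc_bounded:
  obtains C where "C \<ge> 0" 
    "\<And>sg b. sg = 1 \<or> sg = -1 \<Longrightarrow> sg * Re b \<ge> 0 \<Longrightarrow> norm (half_integral sg (Suc n) b) \<le> C"
proof -
  obtain B where B0: "B \<ge> 0" and B: "\<And>x::real. norm (amp lam (Suc n) (of_real x)) \<le> B * exp (- \<bar>x\<bar>)"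
    using amp_exp_bounded by metis
  have i: "set_integrable lborel {0<..} (\<lambda>x::real. B * exp (- x))"
    using set_integrable_exp_neg[of 1] by simp
  define C where "C = (LBINT x:{0<..}. B * exp (- x))"
  have C: "norm (half_integral sg (Suc n) b) \<le> C" if sg: "sg = 1 \<or> sg = -1" and b: "sg * Re b \<ge> 0" for sg b
  proof -
    have le: "norm (half_integrand sg (Suc n) b x) \<le> B * exp (- x)" if "x > 0" for x
      by (rule half_integrand_Suc_bound[OF sg b B that])
    have int: "set_integrable lborel {0<..} (half_integrand sg (Suc n) b)"
      using le by (intro set_integrable_exp_bound[where a=1] half_integrand_continuous) auto
    have "norm (half_integral sg (Suc n) b) = norm (LBINT x:{0<..}. half_integrand sg (Suc n) b x)"
      using sg by (auto simp: half_integral_def)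
    also have "\<dots> \<le> (LBINT x:{0<..}. norm (half_integrand sg (Suc n) b x))"
      by (rule set_integral_norm_bound[OF int])
    also have "\<dots> \<le> C" unfolding C_def
      using le by (intro set_integral_mono set_integrable_norm int i) auto
    finally show ?thesis .
  qed
  moreover have "C \<ge> 0" using order_trans[OF norm_ge_zero C[of 1 0]] by simp
  ultimately show ?thesis using that by blast
qed

text \<open>The antiderivative is exp(-b f) d_n / f' up to sign, with f the phase. The boundary term
  at 0 does not depend on \<open>sg\<close>, and this is the reason why the two half-line integrals
  share their asymptotic expansion.\<close>

lemma half_integral_by_parts:
  assumes sg: "sg = 1 \<or> sg = -1" and b: "sg * Re b > 0"
  shows "b * half_integral sg n b = amp lam n 0 / (1 + of_real lam) + half_integral sg (Suc n) b"
proof -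
  \<comment> \<open>The factor \<open>- of_real sg\<close> cancels the inner derivative
    \<open>sg\<close> of the reflected variable; the outer \<open>sg\<close> in
    \<open>half_integral\<close> then removes it from the boundary value.\<close>
  define F where "F x = - of_real sg * (exp (- (b * phase lam (of_real (sg * x)))) * (amp lam n (of_real (sg * x)) / (1 + of_real lam * exp (of_real (sg * x)))))" for x
  define f where "f x = b * half_integrand sg n b x - half_integrand sg (Suc n) b x" for x
  have int: "set_integrable lborel {0<..} (half_integrand sg m b)" for m
    using half_integrand_integrable[OF sg b] .
  obtain B where B: "B \<ge> 0" "\<And>x::real. norm (amp lam n (of_real x)) \<le> B" using amp_bounded by metis
  have "(LBINT x:{0<..}. f x) = 0 - F 0"
  proof (rule set_integral_FTC_halfline[where F=F])
    fix x
    let ?t = "of_real (sg * x) :: complex"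
    have s2: "of_real sg * of_real sg = (1::complex)" using sg by auto
    have "((\<lambda>z. exp (- (b * phase lam (of_real sg * z)))) has_field_derivative
        exp (- (b * phase lam ?t)) * - (b * ((1 + of_real lam * exp ?t) * of_real sg))) (at (of_real x))"
      by (rule derivative_eq_intros refl)+ simp
    moreover have "((\<lambda>z. amp lam n (of_real sg * z) / (1 + of_real lam * exp (of_real sg * z))) has_field_derivative
        amp lam (Suc n) ?t * of_real sg) (at (of_real x))"
    proof (rule DERIV_chain2[where g="\<lambda>z. of_real sg * z" and f="\<lambda>t. amp lam n t / (1 + of_real lam * exp t)"])
      show "((*) (complex_of_real sg) has_field_derivative of_real sg) (at (of_real x))"
        by (rule derivative_eq_intros refl)+ simp
      show "((\<lambda>t. amp lam n t / (1 + of_real lam * exp t)) has_field_derivative amp lam (Suc n) ?t) (at (of_real sg * of_real x))"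
        using amp_recurrence[OF one_plus_exp_nz[of "sg*x"], where n=n and S=UNIV] by simp
    qed
    ultimately have "((\<lambda>z. exp (- (b * phase lam (of_real sg * z))) * (amp lam n (of_real sg * z) / (1 + of_real lam * exp (of_real sg * z))))
       has_field_derivative
       exp (- (b * phase lam ?t)) * - (b * ((1 + of_real lam * exp ?t) * of_real sg)) * (amp lam n ?t / (1 + of_real lam * exp ?t))
          + amp lam (Suc n) ?t * of_real sg * exp (- (b * phase lam ?t))) (at (of_real x))"
      by (drule_tac DERIV_mult) (simp_all only: of_real_mult)
    from DERIV_cmult[OF this, of "- of_real sg"]
    have D: "((\<lambda>z. - of_real sg * (exp (- (b * phase lam (of_real sg * z))) * (amp lam n (of_real sg * z) / (1 + of_real lam * exp (of_real sg * z)))))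
       has_field_derivative
       - of_real sg * (exp (- (b * phase lam ?t)) * - (b * ((1 + of_real lam * exp ?t) * of_real sg)) * (amp lam n ?t / (1 + of_real lam * exp ?t))
          + amp lam (Suc n) ?t * of_real sg * exp (- (b * phase lam ?t)))) (at (of_real x))" .
    have alg: "- s * (E * - (b * (Y * s)) * (A / Y) + A' * s * E) = b * (E * A) - E * A'"
      if "Y \<noteq> 0" "s * s = 1" for s E Y A A' :: complex
    proof -
      have "- s * (E * - (b * (Y * s)) * (A / Y) + A' * s * E) = (s * s) * (b * (E * (Y * (A / Y))) - E * A')"
        by algebra
      then show ?thesis using that by simp
    qed
    have "((\<lambda>z. - of_real sg * (exp (- (b * phase lam (of_real sg * z))) * (amp lam n (of_real sg * z) / (1 + of_real lam * exp (of_real sg * z)))))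
       has_field_derivative f x) (at (of_real x))"
      using D unfolding f_def half_integrand_def alg[OF one_plus_exp_nz s2] .
    then show "(F has_vector_derivative f x) (at x)"
      unfolding F_def[abs_def] of_real_mult by (rule has_vector_derivative_real_field)
    show "isCont f x" unfolding f_def by (intro continuous_intros half_integrand_continuous)
  next
    show "set_integrable lborel {0<..} f" unfolding f_def using int by auto
    have lim: "((\<lambda>x. k * exp (- (c * x))) \<longlongrightarrow> 0) at_top" if "c > 0" for c k :: real
      using that by real_asymp
    show "(F \<longlongrightarrow> 0) at_top"
    proof (rule Lim_null_comparison[OF _ lim[OF b]])
      show "eventually (\<lambda>x. norm (F x) \<le> B * exp (- (sg * Re b * x))) at_top"
        using eventually_gt_at_top[of 0]
      proof eventually_elim
        case (elim x)
        have "1 + of_real lam * exp (of_real (sg*x) :: complex) = of_real (1 + lam * exp (sg*x))"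
          by (simp add: exp_of_real flip: of_real_mult)
        then have "norm (1 + of_real lam * exp (of_real (sg*x) :: complex)) = \<bar>1 + lam * exp (sg*x)\<bar>"
          by (simp only: norm_of_real)
        then have ge: "norm (1 + of_real lam * exp (of_real (sg*x) :: complex)) \<ge> 1"
          using lam by (simp add: add_pos_pos)
        have "norm (F x) = norm (half_integrand sg n b x) / norm (1 + of_real lam * exp (of_real (sg*x) :: complex))"
          using sg unfolding F_def half_integrand_def by (elim disjE) (simp_all only: norm_mult norm_divide norm_minus_cancel norm_of_real abs_one abs_minus_cancel mult_1 times_divide_eq_right)
        also have "\<dots> \<le> norm (half_integrand sg n b x) / 1" using ge by (intro divide_left_mono) auto
        also have "\<dots> \<le> B * exp (- (sg * Re b * x))"
          using half_integrand_bound[OF sg _ B(2) elim, of b] b by simp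
        finally show ?case .
      qed
    qed
  qed
  moreover have "(LBINT x:{0<..}. f x) = b * (LBINT x:{0<..}. half_integrand sg n b x) - (LBINT x:{0<..}. half_integrand sg (Suc n) b x)"
    unfolding f_def using int by (subst set_integral_diff) auto
  moreover have "F 0 = - of_real sg * (amp lam n 0 / (1 + of_real lam))"
    by (simp add: F_def phase_def)
  ultimately have "b * (LBINT x:{0<..}. half_integrand sg n b x) - (LBINT x:{0<..}. half_integrand sg (Suc n) b x) = of_real sg * (amp lam n 0 / (1 + of_real lam))"
    by simp
  moreover have "of_real sg * of_real sg = (1::complex)" using sg by auto
  ultimately show ?thesis unfolding half_integral_def by algebra
qed

text \<open>Iterated integration by parts makes the remainder after N terms, times b^N, the
  half-line integral of the N-th amplitude, with the same coefficients for both signs.\<close>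

lemma half_integral_expansion:
  assumes sg: "sg = 1 \<or> sg = -1" and b: "sg * Re b > 0"
  shows "b ^ N * (half_integral sg 0 b - (\<Sum>n<N. amp lam n 0 / (1 + of_real lam) / b ^ (n + 1))) = half_integral sg N b"
proof -
  define c where "c n = amp lam n 0 / (1 + of_real lam)" for n
  have b0: "b \<noteq> 0" using b by auto
  have "b ^ N * (half_integral sg 0 b - (\<Sum>n<N. c n / b ^ (n + 1))) = half_integral sg N b"
  proof (induction N)
    case (Suc N)
    have "b ^ Suc N * (half_integral sg 0 b - (\<Sum>n<Suc N. c n / b ^ (n + 1)))
       = b * (b ^ N * (half_integral sg 0 b - (\<Sum>n<N. c n / b ^ (n + 1)))) - c N"
      using b0 by (simp add: algebra_simps)
    also have "\<dots> = half_integral sg (Suc N) b"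
      by (simp only: Suc.IH half_integral_by_parts[OF sg b, of N, folded c_def]) simp
    finally show ?case .
  qed simp
  then show ?thesis by (simp add: c_def)
qed

text \<open>One further integration by parts leaves a constant boundary term and a bounded integral,
  both divided by \<open>b\<close>. This is what makes the outer sides of the triangles
  negligible.\<close>

lemma half_integral_decay:
  obtains C where "C \<ge> 0" 
    "\<And>sg b. sg = 1 \<or> sg = -1 \<Longrightarrow> sg * Re b > 0 \<Longrightarrow> norm (half_integral sg n b) \<le> C / norm b"
proof -
  obtain C where C: "C \<ge> 0" "\<And>sg b. sg = 1 \<or> sg = -1 \<Longrightarrow> sg * Re b \<ge> 0 \<Longrightarrow> norm (half_integral sg (Suc n) b) \<le> C"
    using half_integral_Suc_bounded by metis
  define D where "D = norm (amp lam n 0 / (1 + of_real lam)) + C"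
  have "norm (half_integral sg n b) \<le> D / norm b" if sg: "sg = 1 \<or> sg = -1" and b: "sg * Re b > 0" for sg b
  proof -
    have b0: "b \<noteq> 0" using b by auto
    have "norm (b * half_integral sg n b) \<le> D"
      unfolding half_integral_by_parts[OF sg b] D_def using C(2)[OF sg, of b] b
      by (intro order_trans[OF norm_triangle_ineq]) auto
    then show ?thesis using b0 by (simp add: norm_mult field_simps)
  qed
  then show ?thesis using that[of D] C(1) by (simp add: D_def)
qed

lemma half_integral_holomorphic: "half_integral 1 n holomorphic_on {b. Re b > 0}"
proof -
  obtain B where B: "B \<ge> 0" "\<And>x::real. norm (amp lam n (of_real x)) \<le> B" using amp_bounded by metis
  have "(\<lambda>b. integral\<^sup>L lborel (\<lambda>x. indicator {0<..} x *\<^sub>R half_integrand 1 n b x)) holomorphic_on {b. Re b > 0}"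
  proof (rule holomorphic_on_lebesgue_integral)
    show "open {b. Re b > 0}" by (rule open_halfspace_Re_gt)
    show "(\<lambda>x. indicator {0<..} x *\<^sub>R half_integrand 1 n b x) \<in> borel_measurable lborel" for b
      using half_integrand_measurable by simp
    show "(\<lambda>b. indicator {0<..} t *\<^sub>R half_integrand 1 n b t) holomorphic_on {b. Re b > 0}" for t
      unfolding half_integrand_def by (intro holomorphic_intros) 
    fix b assume "b \<in> {b. Re b > 0}"
    then have b: "Re b > 0" by simp
    show "\<exists>d>0. \<exists>g. integrable lborel g \<and> cball b d \<subseteq> {b. Re b > 0} \<and>
       (\<forall>w\<in>cball b d. \<forall>t\<in>space lborel. norm (indicator {0<..} t *\<^sub>R half_integrand 1 n w t) \<le> g t)"
    proof (intro exI conjI ballI)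
      show "Re b / 2 > 0" using b by simp
      have re: "Re w \<ge> Re b / 2" if "w \<in> cball b (Re b / 2)" for w
        using that abs_Re_le_cmod[of "b - w"] by (simp add: dist_norm)
      then show "cball b (Re b / 2) \<subseteq> {b. Re b > 0}" using b by fastforce
      have "set_integrable lborel {0<..} (\<lambda>t. B * exp (- (Re b / 2 * t)))"
        using set_integrable_exp_neg[of "Re b / 2"] b by simp
      then show "integrable lborel (\<lambda>t. indicator {0<..} t *\<^sub>R (B * exp (- (Re b / 2 * t))))"
        by (simp add: set_integrable_def)
      fix w t assume w: "w \<in> cball b (Re b / 2)"
      show "norm (indicator {0<..} t *\<^sub>R half_integrand 1 n w t) \<le> indicator {0<..} t *\<^sub>R (B * exp (- (Re b / 2 * t)))"
      proof (cases "t > 0")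
        case True
        have "norm (half_integrand 1 n w t) \<le> B * exp (- (1 * Re w * t))"
          using re[OF w] b True by (intro half_integrand_bound B) auto
        also have "\<dots> \<le> B * exp (- (Re b / 2 * t))"
          using re[OF w] True B by (intro mult_left_mono) (auto intro!: mult_right_mono)
        finally show ?thesis using True by simp
      qed simp
    qed
  qed
  then show ?thesis
    unfolding half_integral_def set_lebesgue_integral_def by simp
qed

text \<open>Needed at the single point 0, the vertex of the triangle in Cauchy's formula.\<close>

lemma half_integral_Suc_continuous: "continuous_on {b. Re b \<ge> 0} (half_integral 1 (Suc n))"
proof -
  obtain B where B0: "B \<ge> 0" and B: "\<And>x::real. norm (amp lam (Suc n) (of_real x)) \<le> B * exp (- \<bar>x\<bar>)"
    using amp_exp_bounded by metis
  have "continuous_on {b. Re b \<ge> 0} (\<lambda>b. integral\<^sup>L lborel (\<lambda>x. indicator {0<..} x *\<^sub>R half_integrand 1 (Suc n) b x))"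
  proof (rule continuous_on_lebesgue_integral)
    show "(\<lambda>x. indicator {0<..} x *\<^sub>R half_integrand 1 (Suc n) b x) \<in> borel_measurable lborel" for b
      using half_integrand_measurable by simp
    show "continuous_on {b. Re b \<ge> 0} (\<lambda>b. indicator {0<..} t *\<^sub>R half_integrand 1 (Suc n) b t)" for t
      unfolding half_integrand_def by (intro continuous_intros) 
    have "set_integrable lborel {0<..} (\<lambda>t::real. B * exp (- t))"
      using set_integrable_exp_neg[of 1] by simp
    then show "integrable lborel (\<lambda>t. indicator {0<..} t *\<^sub>R (B * exp (- t)))"
      by (simp add: set_integrable_def)
    show "norm (indicator {0<..} t *\<^sub>R half_integrand 1 (Suc n) b t) \<le> indicator {0<..} t *\<^sub>R (B * exp (- t))"
      if "b \<in> {b. Re b \<ge> 0}" for b t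
      using half_integrand_Suc_bound[of 1 b n B t] B that by (cases "t > 0") auto
  qed
  then show ?thesis
    unfolding half_integral_def set_lebesgue_integral_def by simp
qed

end

subsection \<open>Continuation of the left half-line integral\<close>

lemma integral_real_line_halves:
  fixes f :: "real \<Rightarrow> 'a::{banach, second_countable_topology}"
  assumes pos: "set_integrable lborel {0<..} f"
    and neg: "set_integrable lborel {0<..} (\<lambda>x. f (- x))"
  shows "integrable lborel f" (is ?int)
    and "integral\<^sup>L lborel f = (LBINT x:{0<..}. f x) + (LBINT x:{0<..}. f (- x))" (is ?eq)
proof -
  define p q r where "p x = indicator {0<..} x *\<^sub>R f x" and "q x = indicator {0<..} (- x) *\<^sub>R f x"
    and "r x = indicator {0} x *\<^sub>R f 0" for x
  have f: "f = (\<lambda>x. (p x + q x) + r x)"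
    by (auto simp: p_def q_def r_def fun_eq_iff indicator_def)
  have p: "integrable lborel p" using pos by (simp add: p_def[abs_def] set_integrable_def)
  have q': "integrable lborel (\<lambda>x. q (0 + (-1) * x))"
    using neg by (simp add: q_def[abs_def] set_integrable_def)
  have q: "integrable lborel q"
    using q' lborel_integrable_real_affine_iff[of "-1" q 0] by simp
  have r: "integrable lborel r" unfolding r_def[abs_def]
    by (intro integrable_scaleR_left) simp
  have "integral\<^sup>L lborel r = 0" unfolding r_def[abs_def] by simp
  moreover have "integral\<^sup>L lborel q = (LBINT x:{0<..}. f (- x))"
    using lborel_integral_real_affine[of "-1" q 0] by (simp add: q_def[abs_def] set_lebesgue_integral_def)
  moreover have "integral\<^sup>L lborel p = (LBINT x:{0<..}. f x)"
    by (simp add: p_def[abs_def] set_lebesgue_integral_def)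
  moreover have "integral\<^sup>L lborel f = (integral\<^sup>L lborel p + integral\<^sup>L lborel q) + integral\<^sup>L lborel r"
    by (subst f) (use p q r in simp)
  ultimately show ?eq by simp
  show ?int by (subst f) (use p q r in simp)
qed

text \<open>After the substitution v = z e^t these are z^b Gamma(-b, z) and z^b gamma(-b, z), the
  upper and lower incomplete gamma functions. The variables \<open>b\<close> and \<open>z\<close>
  are kept apart, although z = \<open>lam * b\<close> in the end, so that analytic continuation can
  proceed in one variable at a time.\<close>

definition upper_Laplace :: "complex \<Rightarrow> complex \<Rightarrow> complex" where
  "upper_Laplace b z = (LBINT t:{0<..}. exp (- (b * of_real t) - z * exp (of_real t)))"

definition lower_Laplace :: "complex \<Rightarrow> complex \<Rightarrow> complex" where
  "lower_Laplace b z = (LBINT x:{0<..}. exp (b * of_real x - z * exp (- of_real x)))"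

text \<open>From e^t >= t^2/2 the exponent is at most B t - \<delta> t^2/2. Completing the square in
  (B + 1) t - \<delta> t^2/2 yields the constant, and the extra 1 in B + 1 yields the factor
  exp(-t).\<close>

lemma upper_Laplace_bound:
  fixes b z :: complex
  assumes d: "0 < \<delta>" "\<delta> \<le> Re z" and B: "norm b \<le> B" and t: "t > 0"
  shows "norm (exp (- (b * of_real t) - z * exp (of_real t))) \<le> exp ((B + 1)\<^sup>2 / (2 * \<delta>)) * exp (- (1 * t))"
proof -
  have e: "exp (of_real t :: complex) = of_real (exp t)" by (simp add: exp_of_real)
  have Re: "- Re b \<le> B" using B abs_Re_le_cmod[of b] by linarith
  have "t\<^sup>2 / 2 \<le> exp t" using exp_lower_Taylor_quadratic[of t] t by simp
  then have "\<delta> * (t\<^sup>2/2) \<le> Re z * exp t" using d t by (intro mult_mono) auto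
  moreover have "- Re b * t \<le> B * t" using Re t by (intro mult_right_mono) auto
  moreover have "0 \<le> ((B + 1) - \<delta> * t)\<^sup>2 / (2 * \<delta>)" using d by simp
  then have "0 \<le> (B + 1)\<^sup>2 / (2 * \<delta>) - (B + 1) * t + \<delta> * (t\<^sup>2/2)"
    using d by (simp add: field_simps power2_eq_square)
  ultimately have "- Re b * t - Re z * exp t \<le> (B + 1)\<^sup>2 / (2 * \<delta>) + - (1 * t)"
    by (simp add: algebra_simps)
  then show ?thesis unfolding e norm_exp_eq_Re exp_add[symmetric] by simp
qed

lemma upper_Laplace_integrable:
  fixes b z :: complex
  assumes "Re z > 0"
  shows "set_integrable lborel {0<..} (\<lambda>t. exp (- (b * of_real t) - z * exp (of_real t)))"
  by (rule set_integrable_exp_bound[of 1, OF _ _ upper_Laplace_bound[of "Re z" z b "norm b"]])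
    (use assms in \<open>auto intro!: continuous_intros\<close>)

lemma lower_Laplace_bound:
  fixes b z :: complex and t :: real
  assumes z: "Re z \<ge> 0"
  shows "norm (exp (b * of_real t - z * exp (- of_real t))) \<le> exp (- (- Re b * t))"
proof -
  have e: "exp (- of_real t :: complex) = of_real (exp (- t))" by (simp flip: of_real_minus exp_of_real)
  have "0 \<le> Re z * exp (- t)" using z by simp
  then show ?thesis unfolding e norm_exp_eq_Re by simp
qed

lemma lower_Laplace_integrable:
  fixes b z :: complex
  assumes "Re b < 0" and "Re z \<ge> 0"
  shows "set_integrable lborel {0<..} (\<lambda>x. exp (b * of_real x - z * exp (- of_real x)))"
  by (rule set_integrable_exp_bound[of "- Re b" _ 1])
    (use assms lower_Laplace_bound[OF assms(2), of b] in \<open>auto intro!: continuous_intros\<close>)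

lemma upper_Laplace_measurable:
  fixes b z :: complex
  shows "(\<lambda>t. indicator {0<..} t *\<^sub>R exp (- (b * of_real t) - z * exp (of_real t))) \<in> borel_measurable borel"
  by (rule borel_measurable_continuous_on_indicator) (auto intro!: continuous_intros)

lemma lower_Laplace_measurable:
  fixes b z :: complex
  shows "(\<lambda>t. indicator {0<..} t *\<^sub>R exp (b * of_real t - z * exp (- of_real t))) \<in> borel_measurable borel"
  by (rule borel_measurable_continuous_on_indicator) (auto intro!: continuous_intros)

lemma Re_ge_half:
  assumes "w \<in> cball z (Re z / 2)"
  shows "Re w \<ge> Re z / 2"
  using assms abs_Re_le_cmod[of "z - w"] by (simp add: dist_norm)

lemma upper_Laplace_holomorphic_left:
  assumes z: "Re z > 0"
  shows "(\<lambda>b. upper_Laplace b z) holomorphic_on UNIV"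
  unfolding upper_Laplace_def set_lebesgue_integral_def
proof (rule holomorphic_on_lebesgue_integral)
  show "(\<lambda>t. indicator {0<..} t *\<^sub>R exp (- (b * of_real t) - z * exp (of_real t))) \<in> borel_measurable lborel" for b
    using upper_Laplace_measurable by simp
  show "(\<lambda>b. indicator {0<..} t *\<^sub>R exp (- (b * of_real t) - z * exp (of_real t))) holomorphic_on UNIV" for t
    by (intro holomorphic_intros)
  fix b :: complex
  let ?C = "exp ((norm b + 1 + 1)\<^sup>2 / (2 * Re z))"
  show "\<exists>d>0. \<exists>g. integrable lborel g \<and> cball b d \<subseteq> UNIV \<and> (\<forall>w\<in>cball b d. \<forall>t\<in>space lborel.
          norm (indicator {0<..} t *\<^sub>R exp (- (w * of_real t) - z * exp (of_real t))) \<le> g t)"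
  proof (intro exI conjI ballI)
    show "integrable lborel (\<lambda>t. indicator {0<..} t *\<^sub>R (?C * exp (- (1 * t))))"
      using set_integrable_mult_right[OF set_integrable_exp_neg[of 1], of ?C] by (simp add: set_integrable_def)
    fix w t assume "w \<in> cball b 1"
    then have "norm w \<le> norm b + 1" using norm_triangle_ineq2[of w b] by (simp add: dist_norm norm_minus_commute)
    then show "norm (indicator {0<..} t *\<^sub>R exp (- (w * of_real t) - z * exp (of_real t))) \<le> indicator {0<..} t *\<^sub>R (?C * exp (- (1 * t)))"
      using upper_Laplace_bound[OF z order_refl, of w "norm b + 1" t] by (cases "t > 0") (simp_all del: norm_exp_eq_Re)
  qed auto
qed simp

lemma upper_Laplace_holomorphic_right:
  "upper_Laplace b holomorphic_on {z. Re z > 0}"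
  unfolding upper_Laplace_def[abs_def] set_lebesgue_integral_def
proof (rule holomorphic_on_lebesgue_integral)
  show "open {z. Re z > 0}" by (rule open_halfspace_Re_gt)
  show "(\<lambda>t. indicator {0<..} t *\<^sub>R exp (- (b * of_real t) - z * exp (of_real t))) \<in> borel_measurable lborel" for z
    using upper_Laplace_measurable by simp
  show "(\<lambda>z. indicator {0<..} t *\<^sub>R exp (- (b * of_real t) - z * exp (of_real t))) holomorphic_on {z. Re z > 0}" for t
    by (intro holomorphic_intros)
  fix z assume "z \<in> {z. Re z > 0}"
  then have z: "Re z > 0" by simp
  let ?C = "exp ((norm b + 1)\<^sup>2 / (2 * (Re z / 2)))"
  show "\<exists>d>0. \<exists>g. integrable lborel g \<and> cball z d \<subseteq> {z. Re z > 0} \<and> (\<forall>w\<in>cball z d. \<forall>t\<in>space lborel.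
          norm (indicator {0<..} t *\<^sub>R exp (- (b * of_real t) - w * exp (of_real t))) \<le> g t)"
  proof (intro exI conjI ballI)
    show "Re z / 2 > 0" using z by simp
    show "cball z (Re z / 2) \<subseteq> {z. Re z > 0}" using z Re_ge_half by fastforce
    show "integrable lborel (\<lambda>t. indicator {0<..} t *\<^sub>R (?C * exp (- (1 * t))))"
      using set_integrable_mult_right[OF set_integrable_exp_neg[of 1], of ?C] by (simp add: set_integrable_def)
    fix w t assume w: "w \<in> cball z (Re z / 2)"
    show "norm (indicator {0<..} t *\<^sub>R exp (- (b * of_real t) - w * exp (of_real t))) \<le> indicator {0<..} t *\<^sub>R (?C * exp (- (1 * t)))"
      using upper_Laplace_bound[OF _ Re_ge_half[OF w] order_refl, where b=b and t=t] z by (cases "t > 0") (simp_all del: norm_exp_eq_Re)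
  qed
qed

lemma lower_Laplace_holomorphic:
  assumes b: "Re b < 0"
  shows "lower_Laplace b holomorphic_on {z. Re z > 0}"
  unfolding lower_Laplace_def[abs_def] set_lebesgue_integral_def
proof (rule holomorphic_on_lebesgue_integral)
  show "open {z. Re z > 0}" by (rule open_halfspace_Re_gt)
  show "(\<lambda>t. indicator {0<..} t *\<^sub>R exp (b * of_real t - z * exp (- of_real t))) \<in> borel_measurable lborel" for z
    using lower_Laplace_measurable by simp
  show "(\<lambda>z. indicator {0<..} t *\<^sub>R exp (b * of_real t - z * exp (- of_real t))) holomorphic_on {z. Re z > 0}" for t
    by (intro holomorphic_intros)
  fix z assume "z \<in> {z. Re z > 0}"
  then have z: "Re z > 0" by simp
  show "\<exists>d>0. \<exists>g. integrable lborel g \<and> cball z d \<subseteq> {z. Re z > 0} \<and> (\<forall>w\<in>cball z d. \<forall>t\<in>space lborel.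
          norm (indicator {0<..} t *\<^sub>R exp (b * of_real t - w * exp (- of_real t))) \<le> g t)"
  proof (intro exI conjI ballI)
    show "Re z / 2 > 0" using z by simp
    show "cball z (Re z / 2) \<subseteq> {z. Re z > 0}" using z Re_ge_half by fastforce
    show "integrable lborel (\<lambda>t. indicator {0<..} t *\<^sub>R exp (- (- Re b * t)))"
      using set_integrable_exp_neg[of "- Re b"] b by (simp add: set_integrable_def)
    fix w t assume w: "w \<in> cball z (Re z / 2)"
    show "norm (indicator {0<..} t *\<^sub>R exp (b * of_real t - w * exp (- of_real t))) \<le> indicator {0<..} t *\<^sub>R exp (- (- Re b * t))"
      using lower_Laplace_bound[of w b t] Re_ge_half[OF w] z by (cases "t > 0") (simp_all del: norm_exp_eq_Re)
  qed
qed

text \<open>Euler's integral for Gamma(-b) under the substitution v = z e^t, split at t = 0. Real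
  positive \<open>z\<close> is what makes t |-> z e^t map the real line onto the half-line of
  integration.\<close>

lemma Gamma_Laplace_real:
  assumes b: "Re b < 0" and z: "z > 0"
  shows "upper_Laplace b (of_real z) + lower_Laplace b (of_real z) = of_real z powr b * Gamma (- b)"
proof -
  define f where "f v = complex_of_real v powr (- b - 1) / of_real (exp v)" for v
  define h where "h t = exp (- (b * of_real t) - of_real z * exp (of_real t))" for t :: real
  have u: "set_integrable lborel {0<..} h" unfolding h_def
    by (rule upper_Laplace_integrable) (use z in simp)
  have "h (- x) = exp (b * of_real x - of_real z * exp (- of_real x))" for x
    by (simp add: h_def)
  then have l: "set_integrable lborel {0<..} (\<lambda>x. h (- x))"
    "(LBINT x:{0<..}. h (- x)) = lower_Laplace b (of_real z)"
    using lower_Laplace_integrable[OF b, of "of_real z"] z by (simp_all add: lower_Laplace_def)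
  have hint: "integrable lborel h" 
    and h: "integral\<^sup>L lborel h = upper_Laplace b (of_real z) + lower_Laplace b (of_real z)"
    using integral_real_line_halves[OF u l(1)] l(2) unfolding upper_Laplace_def h_def[symmetric] by simp_all
  have subst: "(z * exp t) *\<^sub>R f (z * exp t) = of_real z powr (- b) * h t" for t
  proof -
    have "(z * exp t) *\<^sub>R f (z * exp t) = of_real (z * exp t) powr (- b) / of_real (exp (z * exp t))"
      using z by (simp add: f_def powr_diff scaleR_conv_of_real)
    also have "of_real (z * exp t) powr (- b) = of_real z powr (- b) * exp (- (b * of_real t))"
    proof -
      have "Ln (of_real (z * exp t)) = of_real (ln z) + of_real t"
        using z by (subst Ln_of_real) (auto simp: ln_mult)
      moreover have "Ln (of_real z) = of_real (ln z)" using z by (rule Ln_of_real)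
      ultimately show ?thesis using z by (simp add: powr_def algebra_simps exp_add exp_diff exp_minus divide_inverse del: of_real_mult)
    qed
    also have "\<dots> / of_real (exp (z * exp t)) = of_real z powr (- b) * h t"
      by (simp add: h_def exp_diff exp_of_real[symmetric])
    finally show ?thesis .
  qed
  have "(LBINT v=0..\<infinity>. f v) = (LBINT t=-\<infinity>..\<infinity>. (z * exp t) *\<^sub>R f (z * exp t))"
  proof (rule interval_integral_substitution_integrable)
    show "((\<lambda>t. z * exp t) has_real_derivative z * exp t) (at t)" for t
      by (auto intro!: derivative_eq_intros)
    show "isCont f (z * exp t)" for t
      unfolding f_def using z by (intro continuous_intros) (auto simp: complex_nonpos_Reals_iff)
    show "isCont (\<lambda>t. z * exp t) t" for t by (intro continuous_intros)
    have "((\<lambda>t. z * exp t) \<longlongrightarrow> z * 0) at_bot"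
      by (intro tendsto_intros exp_at_bot)
    then show "((ereal \<circ> (\<lambda>t. z * exp t) \<circ> real_of_ereal) \<longlongrightarrow> 0) (at_right (-\<infinity>))"
      by (subst ereal_tendsto_simps1(4), subst zero_ereal_def, subst ereal_tendsto_simps2(1)) simp
    have "filterlim (\<lambda>t. z * exp t) at_top at_top"
      by (rule filterlim_tendsto_pos_mult_at_top[OF tendsto_const z exp_at_top])
    then show "((ereal \<circ> (\<lambda>t. z * exp t) \<circ> real_of_ereal) \<longlongrightarrow> \<infinity>) (at_left \<infinity>)"
      by (subst ereal_tendsto_simps1(3), subst ereal_tendsto_simps2(2))
    show "set_integrable lborel (einterval (-\<infinity>) \<infinity>) (\<lambda>t. (z * exp t) *\<^sub>R f (z * exp t))"
      unfolding subst using hint by (simp add: set_integrable_def)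
    have "set_integrable lborel {0<..} f"
    proof -
      have "(\<lambda>x. indicator {0<..} x *\<^sub>R f x) \<in> borel_measurable borel"
        unfolding f_def by (auto intro!: borel_measurable_continuous_on_indicator continuous_intros)
      moreover have "set_integrable lebesgue {0<..} f"
        using absolutely_integrable_Gamma_integral'[of "- b"] b unfolding f_def[abs_def] by simp
      ultimately show ?thesis unfolding set_integrable_def by (subst (asm) integrable_completion) auto
    qed
    then show "set_integrable lborel (einterval 0 \<infinity>) f"
      unfolding zero_ereal_def einterval_eq .
  qed (use z in auto)
  moreover have "(LBINT v=0..\<infinity>. f v) = Gamma (- b)"
  proof -
    have s: "set_integrable lebesgue {0<..} f"
      using absolutely_integrable_Gamma_integral'[of "- b"] b unfolding f_def[abs_def] by simp
    have "(LBINT v=0..\<infinity>. f v) = (LBINT v:{0<..}. f v)"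
      using interval_integral_to_infinity_eq[where a=0 and M=lborel] by (simp add: zero_ereal_def)
    also have "\<dots> = (LINT v:{0<..}|lebesgue. f v)"
      unfolding set_lebesgue_integral_def f_def
      by (subst integral_completion) (auto intro!: borel_measurable_continuous_on_indicator continuous_intros)
    also have "\<dots> = integral {0<..} f" by (rule set_lebesgue_integral_eq_integral(2)[OF s])
    also have "\<dots> = Gamma (- b)"
      using Gamma_integral_complex'[of "- b"] b unfolding f_def[abs_def] by (intro integral_unique) simp
    finally show ?thesis .
  qed
  moreover have "(LBINT t=-\<infinity>..\<infinity>. (z * exp t) *\<^sub>R f (z * exp t)) = of_real z powr (- b) * integral\<^sup>L lborel h"
    unfolding subst interval_lebesgue_integral_def by (simp add: set_lebesgue_integral_def)
  ultimately have "of_real z powr (- b) * (upper_Laplace b (of_real z) + lower_Laplace b (of_real z)) = Gamma (- b)"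
    using h by simp
  then show ?thesis using z by (auto simp: powr_minus field_simps)
qed

text \<open>For fixed \<open>b\<close> both sides are holomorphic in \<open>z\<close> on the right
  half-plane, so the identity theorem carries the equation over from the positive reals.\<close>

lemma Gamma_Laplace:
  assumes b: "Re b < 0" and z: "Re z > 0"
  shows "upper_Laplace b z + lower_Laplace b z = z powr b * Gamma (- b)"
proof -
  define f where "f z = upper_Laplace b z + lower_Laplace b z - z powr b * Gamma (- b)" for z
  have "f z = 0"
  proof (rule analytic_continuation[where f=f and S="{z. Re z > 0}" and U="of_real ` {0<..}" and \<xi>=1])
    show "f holomorphic_on {z. Re z > 0}"
      unfolding f_def[abs_def]
      using upper_Laplace_holomorphic_right lower_Laplace_holomorphic[OF b]
      by (intro holomorphic_intros) (auto simp: complex_nonpos_Reals_iff)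
    show "open {z. Re z > 0}" by (rule open_halfspace_Re_gt)
    show "connected {z. Re z > 0}" by (intro convex_connected convex_halfspace_Re_gt)
    show "(1::complex) islimpt of_real ` {0<..}"
    proof (rule islimptI)
      fix T :: "complex set" assume "1 \<in> T" "open T"
      then obtain e where e: "e > 0" "ball 1 e \<subseteq> T" by (meson openE)
      have "of_real (1 + e/2) \<in> ball (1::complex) e" using e by (simp add: dist_norm)
      then show "\<exists>y\<in>of_real ` {0<..}. y \<in> T \<and> y \<noteq> (1::complex)"
        using e by (intro bexI[of _ "of_real (1 + e/2)"] imageI) auto
    qed
    show "f w = 0" if "w \<in> of_real ` {0<..}" for w
      using that Gamma_Laplace_real[OF b] by (auto simp: f_def)
  qed (use z in auto)
  then show ?thesis by (simp add: f_def)
qed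

text \<open>The term of index \<open>0\<close>, with its pole at \<open>w = 0\<close>, is left out.\<close>

definition pole_series :: "complex \<Rightarrow> complex \<Rightarrow> complex" where
  "pole_series w z = (\<Sum>k. (- z) ^ Suc k / (fact (Suc k) * (of_nat (Suc k) + w)))"

lemma summable_pole_series_aux:
  fixes c :: real
  shows "summable (\<lambda>k. c ^ Suc k / fact (Suc k) * B)"
proof -
  have "summable (\<lambda>k. inverse (fact k) * c ^ k)" by (rule summable_exp)
  then have "summable (\<lambda>k. inverse (fact (Suc k)) * c ^ Suc k)" by (subst summable_Suc_iff)
  then show ?thesis by (intro summable_mult2) (simp add: divide_inverse mult.commute)
qed

lemma pole_series_bound:
  fixes w z :: complex
  assumes d: "d > 0" "\<And>k. norm (of_nat (Suc k) + w) \<ge> d" and M: "norm z \<le> M"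
  shows "norm ((- z) ^ Suc k / (fact (Suc k) * (of_nat (Suc k) + w))) \<le> M ^ Suc k / fact (Suc k) * (1 / d)"
proof -
  have "norm ((- z) ^ Suc k / (fact (Suc k) * (of_nat (Suc k) + w))) = (norm z ^ Suc k / fact (Suc k)) * (1 / norm (of_nat (Suc k) + w))"
    by (simp only: norm_divide norm_mult norm_power norm_minus_cancel norm_fact) simp
  also have "\<dots> \<le> (M ^ Suc k / fact (Suc k)) * (1 / d)"
  proof (rule mult_mono)
    have "0 < norm (of_nat (Suc k) + w)" using d(1) d(2)[of k] by linarith
    then show "1 / norm (of_nat (Suc k) + w) \<le> 1 / d"
      using d(1) d(2)[of k] by (intro divide_left_mono mult_pos_pos) auto
    show "0 \<le> M ^ Suc k / fact (Suc k)"
      using M order_trans[OF norm_ge_zero M] by (intro divide_nonneg_pos zero_le_power) auto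
  qed (use M in \<open>auto intro!: divide_right_mono power_mono simp del: power_Suc\<close>)
  finally show ?thesis .
qed

text \<open>The series is read as an integral over counting measure, so the theorem on parameter
  integrals applies. The second argument is a function \<open>h\<close> of \<open>w\<close> because
  it is constant in one use and proportional to \<open>w\<close> in the other.\<close>

lemma pole_series_holomorphic:
  assumes h: "h holomorphic_on UNIV"
  shows "(\<lambda>w. pole_series w (h w)) holomorphic_on - (range (\<lambda>k. - of_nat (Suc k)))"
proof -
  define A where "A = - range (\<lambda>k. - complex_of_nat (Suc k))"
  have "closed (range (\<lambda>k. - complex_of_nat (Suc k)))"
    by (intro closed_subset_Ints) auto
  then have A: "open A" by (simp add: A_def open_Compl)
  define K where "K w k = (- h w) ^ Suc k / (fact (Suc k) * (of_nat (Suc k) + w))" for w k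
  have loc: "\<exists>d>0. \<exists>g. integrable (count_space UNIV) g \<and> cball w d \<subseteq> A \<and>
       (\<forall>v\<in>cball w d. \<forall>k\<in>space (count_space UNIV). norm (K v k) \<le> g k)" if w: "w \<in> A" for w
  proof -
    obtain e where e: "e > 0" "ball w e \<subseteq> A" using A w openE by blast
    have "continuous_on (cball w (e/2)) h"
      using h holomorphic_on_imp_continuous_on holomorphic_on_subset by blast
    then have "bounded (h ` cball w (e/2))"
      by (intro compact_imp_bounded compact_continuous_image) auto
    then obtain M where M: "\<And>v. v \<in> cball w (e/2) \<Longrightarrow> norm (h v) \<le> M"
      unfolding bounded_iff by blast
    have M0: "M \<ge> 0" using order_trans[OF norm_ge_zero M[of w]] e by simp
    show ?thesis
    proof (intro exI conjI ballI)
      show "e / 2 > 0" using e by simp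
      show "cball w (e/2) \<subseteq> A" using e by (auto simp: subset_iff)
      show "integrable (count_space UNIV) (\<lambda>k. M ^ Suc k / fact (Suc k) * (1 / (e/2)))"
        unfolding integrable_count_space_nat_iff using summable_pole_series_aux[of M "1 / (e/2)"] M0 e by simp
      fix v k assume v: "v \<in> cball w (e/2)"
      have "norm (of_nat (Suc k) + v) \<ge> e / 2" for k
      proof (rule ccontr)
        assume "\<not> ?thesis"
        then have "dist v (- of_nat (Suc k)) < e / 2"
          by (simp only: dist_norm diff_minus_eq_add add.commute not_le)
        then have "dist w (- of_nat (Suc k)) < e" using v dist_triangle[of w "- of_nat (Suc k)" v] by simp
        then show False using e(2) by (force simp: A_def)
      qed
      then show "norm (K v k) \<le> M ^ Suc k / fact (Suc k) * (1 / (e/2))"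
        unfolding K_def using e M[OF v] by (intro pole_series_bound) auto
    qed
  qed
  have "(\<lambda>w. integral\<^sup>L (count_space UNIV) (K w)) holomorphic_on A"
  proof (rule holomorphic_on_lebesgue_integral[OF A _ _ loc])
    fix k
    have "of_nat (Suc k) + w \<noteq> 0" if "w \<in> A" for w
    proof
      assume "of_nat (Suc k) + w = 0"
      then have "w = - of_nat (Suc k)" by (simp only: eq_neg_iff_add_eq_0 add.commute)
      then show False using that by (simp add: A_def del: of_nat_Suc)
    qed
    then show "(\<lambda>w. K w k) holomorphic_on A"
      unfolding K_def using h by (intro holomorphic_intros) (auto intro: holomorphic_on_subset simp del: of_nat_Suc)
  qed auto
  moreover have "integral\<^sup>L (count_space UNIV) (K w) = pole_series w (h w)" if w: "w \<in> A" for w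
  proof -
    obtain d g where d: "d > 0" and g: "integrable (count_space UNIV) g"
      and le: "\<forall>v\<in>cball w d. \<forall>k\<in>space (count_space UNIV). norm (K v k) \<le> g k"
      using loc[OF w] by (elim exE conjE) 
    have le': "norm (K w k) \<le> norm (g k)" for k
      using le d order_trans[OF _ abs_ge_self[of "g k"], of "norm (K w k)"] by simp
    have "integrable (count_space UNIV) (K w)"
      by (rule Bochner_Integration.integrable_bound[OF g _ AE_I2[OF le']]) simp
    from sums_unique[OF sums_integral_count_space_nat[OF this]] show ?thesis
      by (simp only: pole_series_def K_def[abs_def])
  qed
  ultimately show ?thesis unfolding A_def[symmetric] by (rule holomorphic_transform)
qed

text \<open>The power series of exp(-z e^(-x)) is integrated term by term; term k contributes 1/(k -
  b). The factors 1/(k - Re b) are at most 1/(- Re b), so the exponential series justifies the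
  interchange. The right-hand side keeps its meaning off the poles and is the continuation in
  \<open>b\<close>.\<close>

lemma lower_Laplace_series:
  assumes b: "Re b < 0"
  shows "lower_Laplace b z = pole_series (- b) z - 1 / b"
proof -
  define f where "f k x = indicator {0<..} x *\<^sub>R ((- z) ^ k / fact k * exp (- ((of_nat k - b) * of_real x)))" for k :: nat and x :: real
  have int: "set_integrable lborel {0<..} (\<lambda>x. exp (- ((of_nat k - b) * of_real x)))" for k
    by (rule set_integrable_exp_bound[of "real k - Re b" _ 1]) (use b in \<open>auto intro!: continuous_intros\<close>)
  have f: "integrable lborel (f k)" for k
    using set_integrable_mult_right[OF int, of "(- z) ^ k / fact k" k] by (simp add: f_def[abs_def] set_integrable_def)
  have If: "integral\<^sup>L lborel (f k) = (- z) ^ k / fact k * (1 / (of_nat k - b))" for k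
  proof -
    have "integral\<^sup>L lborel (f k) = (LBINT x:{0<..}. (- z) ^ k / fact k * exp (- ((of_nat k - b) * of_real x)))"
      by (simp only: f_def[abs_def] set_lebesgue_integral_def)
    also have "\<dots> = (- z) ^ k / fact k * (1 / (of_nat k - b))"
      using b by (subst set_integral_mult_right, subst set_integral_exp_neg) auto
    finally show ?thesis .
  qed
  have nf: "norm (f k x) = norm z ^ k / fact k * (indicator {0<..} x * exp (- ((real k - Re b) * x)))" for k x
    by (simp add: f_def norm_mult norm_divide norm_power)
  have Inf: "integral\<^sup>L lborel (\<lambda>x. norm (f k x)) \<le> norm z ^ k / fact k * (1 / (- Re b))" for k
  proof -
    have "(LBINT x:{0<..}. exp (- (of_real (real k - Re b) * complex_of_real x))) = 1 / of_real (real k - Re b)"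
      using b by (intro set_integral_exp_neg) auto
    moreover have "exp (- (of_real (real k - Re b) * complex_of_real x)) = of_real (exp (- ((real k - Re b) * x)))" for x
      by (simp flip: exp_of_real)
    ultimately have "(LBINT x:{0<..}. complex_of_real (exp (- ((real k - Re b) * x)))) = of_real (1 / (real k - Re b))"
      by simp
    then have "(LBINT x:{0<..}. exp (- ((real k - Re b) * x))) = 1 / (real k - Re b)"
      by (simp only: set_integral_complex_of_real of_real_eq_iff)
    then have "integral\<^sup>L lborel (\<lambda>x. norm (f k x)) = norm z ^ k / fact k * (1 / (real k - Re b))"
      unfolding nf by (simp add: set_lebesgue_integral_def)
    also have "\<dots> \<le> norm z ^ k / fact k * (1 / (- Re b))"
      using b by (intro mult_left_mono frac_le) auto
    finally show ?thesis .
  qed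
  have ex: "exp (b * of_real x - z * exp (- of_real x)) = (\<Sum>k. (- z) ^ k / fact k * exp (- ((of_nat k - b) * of_real x)))"
     "summable (\<lambda>k. (- z) ^ k / fact k * exp (- ((of_nat k - b) * of_real x)))" for x :: real
  proof -
    have "(\<lambda>k. (- z * exp (- of_real x)) ^ k /\<^sub>R fact k) sums exp (- z * exp (- of_real x))" by (rule exp_converges)
    from sums_mult[OF this, of "exp (b * of_real x)"]
    have "(\<lambda>k. exp (b * of_real x) * ((- z * exp (- of_real x)) ^ k /\<^sub>R fact k)) sums exp (b * of_real x - z * exp (- of_real x))"
      by (simp only: exp_add[symmetric] diff_conv_add_uminus mult_minus_left)
    moreover have "exp (b * of_real x) * ((- z * exp (- of_real x)) ^ k /\<^sub>R fact k) = (- z) ^ k / fact k * exp (- ((of_nat k - b) * of_real x))" for k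
    proof -
      have "exp (- complex_of_real x) ^ k = exp (- (of_nat k * of_real x))"
        by (simp add: exp_of_nat_mult[symmetric])
      then have "exp (b * of_real x) * exp (- complex_of_real x) ^ k = exp (- ((of_nat k - b) * of_real x))"
        by (simp add: exp_add[symmetric] algebra_simps)
      moreover have "(- z * exp (- complex_of_real x)) ^ k = (- z) ^ k * exp (- complex_of_real x) ^ k"
        by (rule power_mult_distrib)
      ultimately show ?thesis
        by (simp only: scaleR_conv_of_real of_real_inverse of_real_fact divide_inverse mult_ac)
    qed
    ultimately show "exp (b * of_real x - z * exp (- of_real x)) = (\<Sum>k. (- z) ^ k / fact k * exp (- ((of_nat k - b) * of_real x)))"
     "summable (\<lambda>k. (- z) ^ k / fact k * exp (- ((of_nat k - b) * of_real x)))"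
      by (simp_all add: sums_iff)
  qed
  have sm: "summable (\<lambda>k. norm z ^ k / fact k * B)" for B :: real
    using summable_exp[of "norm z"] by (intro summable_mult2) (simp add: divide_inverse mult.commute)
  have "lower_Laplace b z = integral\<^sup>L lborel (\<lambda>x. \<Sum>k. f k x)"
    unfolding lower_Laplace_def set_lebesgue_integral_def
    by (intro Bochner_Integration.integral_cong refl) (auto simp: f_def ex(1) indicator_def)
  also have "\<dots> = (\<Sum>k. integral\<^sup>L lborel (f k))"
  proof (rule integral_suminf[OF f])
    show "AE x in lborel. summable (\<lambda>k. norm (f k x))"
    proof (rule AE_I2)
      fix x :: real
      have "indicator {0<..} x * exp (- ((real k - Re b) * x)) \<le> 1" for k
        using b by (cases "x > 0") auto
      then have "norm (norm (f k x)) \<le> norm z ^ k / fact k * 1" for k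
        unfolding nf by (subst real_norm_def, subst abs_of_nonneg) (auto simp del: mult_1_right times_divide_eq_left times_divide_eq_right intro!: mult_left_mono mult_nonneg_nonneg)
      then show "summable (\<lambda>k. norm (f k x))"
        by (intro summable_comparison_test[OF _ sm]) blast
    qed
    show "summable (\<lambda>k. integral\<^sup>L lborel (\<lambda>x. norm (f k x)))"
    proof (rule summable_comparison_test[OF _ sm[of "1 / (- Re b)"]])
      have "0 \<le> integral\<^sup>L lborel (\<lambda>x. norm (f k x))" for k by (rule Bochner_Integration.integral_nonneg) simp
      then show "\<exists>N. \<forall>n\<ge>N. norm (integral\<^sup>L lborel (\<lambda>x. norm (f n x))) \<le> norm z ^ n / fact n * (1 / (- Re b))"
        using Inf by (simp only: real_norm_def abs_of_nonneg) blast
    qed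
  qed
  also have "\<dots> = (\<Sum>k. (- z) ^ k / (fact k * (of_nat k - b)))" unfolding If by simp
  also have "\<dots> = (- z) ^ 0 / (fact 0 * (of_nat 0 - b)) + (\<Sum>k. (- z) ^ Suc k / (fact (Suc k) * (of_nat (Suc k) - b)))"
  proof (subst suminf_split_head)
    show "summable (\<lambda>k. (- z) ^ k / (fact k * (of_nat k - b)))"
    proof (rule summable_comparison_test[OF _ sm])
      have "norm ((- z) ^ k / (fact k * (of_nat k - b))) \<le> norm z ^ k / fact k * (1 / (- Re b))" for k
      proof -
        have "norm ((- z) ^ k / (fact k * (of_nat k - b))) = norm (integral\<^sup>L lborel (f k))" unfolding If by simp
        also have "\<dots> \<le> integral\<^sup>L lborel (\<lambda>x. norm (f k x))" by (rule integral_norm_bound)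
        finally show ?thesis using Inf[of k] by linarith
      qed
      then show "\<exists>N. \<forall>n\<ge>N. norm ((- z) ^ n / (fact n * (of_nat n - b))) \<le> norm z ^ n / fact n * (1 / (- Re b))" by blast
    qed
  qed simp
  also have "\<dots> = pole_series (- b) z - 1 / b" by (simp add: pole_series_def)
  finally show ?thesis .
qed

text \<open>Now \<open>z\<close> is fixed and the equation is continued in w = -b from the right
  half-plane to the plane cut along the non-positive reals. The cut domain is starlike, hence
  connected, and avoids all poles of both sides.\<close>

lemma Gamma_Laplace_continued:
  assumes b: "- b \<notin> \<real>\<^sub>\<le>\<^sub>0" and z: "Re z > 0"
  shows "upper_Laplace b z + (pole_series (- b) z - 1 / b) = z powr b * Gamma (- b)"
proof -
  define S where "S = - (complex_of_real ` {..0})"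
  have R: "w \<in> S \<longleftrightarrow> w \<notin> \<real>\<^sub>\<le>\<^sub>0" for w
    by (auto simp: S_def complex_nonpos_Reals_iff image_iff complex_eq_iff)
  define U where "U = {w. Re w > 0}"
  have US: "U \<subseteq> S" by (auto simp: U_def R complex_nonpos_Reals_iff)
  have oS: "open S" 
  proof -
    have "S = - \<real>\<^sub>\<le>\<^sub>0" using R by blast
    then show ?thesis by (simp add: open_Compl)
  qed
  have "upper_Laplace (- w) z + (pole_series w z + 1 / w) = z powr (- w) * Gamma w" if "w \<in> S" for w
  proof (rule analytic_continuation_open[of U S "\<lambda>w. upper_Laplace (- w) z + (pole_series w z + 1 / w)" "\<lambda>w. z powr (- w) * Gamma w"])
    show "open U" unfolding U_def by (rule open_halfspace_Re_gt)
    show "U \<noteq> {}" using one_complex.simps(1) zero_less_one unfolding U_def by (metis (mono_tags) empty_iff mem_Collect_eq)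
    show "connected S" unfolding S_def by (intro starlike_imp_connected starlike_slotted_complex_plane_left)
    have ints: "w \<notin> \<int>\<^sub>\<le>\<^sub>0" if "w \<in> S" for w using that R nonpos_Ints_subset_nonpos_Reals by blast
    have S1: "S \<subseteq> - range (\<lambda>k. - of_nat (Suc k))" using R by (auto simp: complex_nonpos_Reals_iff)
    have "(\<lambda>w. upper_Laplace (- w) z) holomorphic_on S"
      using holomorphic_on_compose_gen[OF _ upper_Laplace_holomorphic_left[OF z], of uminus S]
      by (simp add: o_def holomorphic_on_minus holomorphic_on_ident)
    moreover have "(\<lambda>w. pole_series w z) holomorphic_on S"
      by (rule holomorphic_on_subset[OF pole_series_holomorphic[of "\<lambda>_. z"] S1]) auto
    ultimately show "(\<lambda>w. upper_Laplace (- w) z + (pole_series w z + 1 / w)) holomorphic_on S"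
      using R by (intro holomorphic_intros) auto
    show "(\<lambda>w. z powr (- w) * Gamma w) holomorphic_on S"
      using ints z by (intro holomorphic_intros) auto
    show "upper_Laplace (- w) z + (pole_series w z + 1 / w) = z powr (- w) * Gamma w" if "w \<in> U" for w
      using Gamma_Laplace[of "- w" z] lower_Laplace_series[of "- w" z] that z by (simp add: U_def)
  qed (use US oS that in auto)
  from this[of "- b"] show ?thesis using b R by simp
qed

subsection \<open>The jump between the two half-line integrals\<close>

lemma power_le_fact_mult_exp:
  assumes "(x::real) \<ge> 0"
  shows "x ^ n \<le> fact n * exp x"
proof -
  have "(\<Sum>k\<in>{n}. x ^ k /\<^sub>R fact k) \<le> (\<Sum>k. x ^ k /\<^sub>R fact k)"
    by (intro sum_le_suminf sums_summable[OF exp_converges]) (use assms in auto)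
  then show ?thesis using sums_unique[OF exp_converges[of x]] by (simp add: field_simps)
qed

lemma norm_Gamma_le_Gamma_Re:
  assumes "Re z > 0"
  shows "norm (Gamma z) \<le> Gamma (Re z)"
proof -
  have 1: "((\<lambda>t. of_real t powr (z - 1) / of_real (exp t)) has_integral Gamma z) {0..}"
    by (rule Gamma_integral_complex[OF assms])
  have 2: "((\<lambda>t. t powr (Re z - 1) / exp t) has_integral Gamma (Re z)) {0..}"
    by (rule Gamma_integral_real[OF assms])
  have "norm (integral {0..} (\<lambda>t. of_real t powr (z - 1) / of_real (exp t))) \<le> integral {0..} (\<lambda>t. t powr (Re z - 1) / exp t)"
    by (rule integral_norm_bound_integral)
      (use 1 2 in \<open>auto simp: has_integral_integrable norm_divide norm_powr_real_powr\<close>)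
  then show ?thesis using 1 2 by (simp add: integral_unique)
qed

lemma norm_Gamma_bounded_strip:
  obtains C where "C > 0" "\<And>z. Re z \<in> {1..2} \<Longrightarrow> norm (Gamma z) \<le> C"
proof -
  have "continuous_on {1..2::real} Gamma"
    by (intro continuous_intros) (auto elim!: nonpos_Ints_cases)
  then have "bounded (Gamma ` {1..2::real})"
    by (intro compact_imp_bounded compact_continuous_image) auto
  then obtain C where C: "\<And>x. x \<in> {1..2::real} \<Longrightarrow> norm (Gamma x) \<le> C"
    unfolding bounded_iff by blast
  have "norm (Gamma z) \<le> max C 1" if "Re z \<in> {1..2}" for z
    using norm_Gamma_le_Gamma_Re[of z] C[OF that] that by simp
  then show ?thesis using that[of "max C 1"] by simp
qed

text \<open>With m the integer part of p = Re b, the functional equation divides the bounded value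
  Gamma(m + 2 - b) by the m + 2 factors k - b. The last two factors are at least |Im b| each. The
  others are compared with |b|: their quotients are at most p/(m - k), whose product p^m/m! is at
  most e^p.\<close>

lemma norm_Gamma_uminus_le:
  obtains C where "C > 0"
    "\<And>b. Re b \<ge> 0 \<Longrightarrow> Im b \<noteq> 0 \<Longrightarrow> norm b \<ge> 1 \<Longrightarrow>
      norm (Gamma (- b)) * norm b powr Re b \<le> C * norm b / (Im b)\<^sup>2 * exp (Re b)"
proof -
  obtain C where C: "C > 0" "\<And>z. Re z \<in> {1..2} \<Longrightarrow> norm (Gamma z) \<le> C"
    using norm_Gamma_bounded_strip by blast
  have "norm (Gamma (- b)) * norm b powr Re b \<le> C * norm b / (Im b)\<^sup>2 * exp (Re b)"
    if b: "Re b \<ge> 0" "Im b \<noteq> 0" "norm b \<ge> 1" for b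
  proof -
    define p q where "p = Re b" and "q = Im b"
    \<comment> \<open>This choice puts the real part of m + 2 - b into the interval from 1 to 2,
      where Gamma is bounded.\<close>
    define m where "m = nat \<lfloor>p\<rfloor>"
    have m: "real m \<le> p" "p < real m + 1" using b(1) by (auto simp: m_def p_def)
    have q: "q \<noteq> 0" using b by (simp add: q_def)
    have nI: "- b \<notin> \<int>\<^sub>\<le>\<^sub>0" using b(2) by (auto elim!: nonpos_Ints_cases simp: complex_eq_iff)
    have ne: "of_nat k - b \<noteq> 0" for k using b(2) by (auto simp: complex_eq_iff)
    define P where "P = (\<Prod>k<m. norm (of_nat k - b))"
    have P: "P > 0" unfolding P_def using ne by (intro prod_pos) auto
    have poch: "pochhammer (- b) (m + 2) = Gamma (- b + of_nat (m + 2)) / Gamma (- b)"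
      by (rule pochhammer_Gamma[OF nI])
    have "norm (pochhammer (- b) (m + 2)) = (\<Prod>k<m+2. norm (of_nat k - b))"
      by (simp add: pochhammer_prod prod_norm lessThan_atLeast0 add.commute[of "- b"] del: prod.op_ivl_Suc)
    also have "\<dots> = P * (norm (of_nat m - b) * norm (of_nat (Suc m) - b))"
      by (simp add: P_def)
    finally have np: "norm (pochhammer (- b) (m + 2)) = P * (norm (of_nat m - b) * norm (of_nat (Suc m) - b))" .
    have nq: "\<bar>q\<bar> \<le> norm (of_nat k - b)" for k
      using abs_Im_le_cmod[of "of_nat k - b"] by (simp add: q_def)
    have "q\<^sup>2 = \<bar>q\<bar> * \<bar>q\<bar>" by (simp add: power2_eq_square)
    also have "\<dots> \<le> norm (of_nat m - b) * norm (of_nat (Suc m) - b)" by (intro mult_mono nq) auto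
    finally have np2: "P * q\<^sup>2 \<le> norm (pochhammer (- b) (m + 2))" unfolding np using P by (intro mult_left_mono) auto
    have G0: "Gamma (- b) \<noteq> 0" using nI by (simp add: Gamma_eq_zero_iff)
    have "norm (pochhammer (- b) (m + 2)) * norm (Gamma (- b)) = norm (Gamma (- b + of_nat (m + 2)))"
      unfolding poch using G0 by (simp add: norm_divide)
    also have "\<dots> \<le> C" using m by (intro C) (auto simp: p_def)
    finally have "(P * q\<^sup>2) * norm (Gamma (- b)) \<le> C"
      using mult_right_mono[OF np2, of "norm (Gamma (- b))"] by simp
    then have G: "norm (Gamma (- b)) \<le> C / (P * q\<^sup>2)" using P q by (simp add: field_simps)
    have "norm b ^ m / P = (\<Prod>k<m. norm b / norm (of_nat k - b))"
      by (simp add: P_def prod_dividef)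
    also have "\<dots> \<le> (\<Prod>k<m. p / (real m - real k))"
    proof (rule prod_mono, intro conjI)
      fix k assume "k \<in> {..<m}"
      then have k: "k < m" by simp
      have pk: "0 < p - real k" "0 < real m - real k" "0 < p" using k m by auto
      \<comment> \<open>Both squared moduli contain q^2; after expansion only q^2 (p - k)^2 <= q^2
        p^2 remains to be seen.\<close>
      have "(norm b * (p - real k))\<^sup>2 \<le> (p * norm (of_nat k - b))\<^sup>2"
      proof -
        have nb: "(norm b)\<^sup>2 = p\<^sup>2 + q\<^sup>2" by (simp add: cmod_power2 p_def q_def)
        have nk: "(norm (of_nat k - b))\<^sup>2 = (p - real k)\<^sup>2 + q\<^sup>2" 
          by (simp add: cmod_power2 p_def q_def power2_commute)
        have "(p - real k)\<^sup>2 \<le> p\<^sup>2" using pk by (intro power_mono) auto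
        then have "q\<^sup>2 * (p - real k)\<^sup>2 \<le> q\<^sup>2 * p\<^sup>2" by (intro mult_left_mono) auto
        then show ?thesis unfolding power_mult_distrib nb nk by (simp add: algebra_simps)
      qed
      then have "norm b * (p - real k) \<le> p * norm (of_nat k - b)"
        by (rule power2_le_imp_le) (use pk in simp)
      then have "norm b / norm (of_nat k - b) \<le> p / (p - real k)"
        using ne[of k] pk by (simp add: field_simps)
      also have "\<dots> \<le> p / (real m - real k)" using pk m by (intro divide_left_mono) auto
      finally show "norm b / norm (of_nat k - b) \<le> p / (real m - real k)" .
    qed auto
    also have "\<dots> = p ^ m / fact m"
    proof -
      have "(\<Prod>k<m. real m - real k) = fact m"
        unfolding fact_prod_rev by (auto simp: lessThan_atLeast0 of_nat_diff intro!: prod.cong)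
      then show ?thesis by (simp add: prod_dividef)
    qed
    also have "\<dots> \<le> exp p" using power_le_fact_mult_exp[of p m] b(1) by (simp add: p_def field_simps)
    finally have bm: "norm b ^ m / P \<le> exp p" .
    \<comment> \<open>The fractional part of p costs at most one more factor \<open>norm b\<close>,
      since \<open>norm b\<close> is at least 1.\<close>
    have "norm b powr p = norm b ^ m * norm b powr (p - real m)"
      using b(3) powr_add[of "norm b" "real m" "p - real m"] powr_realpow[of "norm b" m] by (cases "b = 0") auto
    also have "\<dots> \<le> norm b ^ m * norm b"
      using b(3) m powr_mono[of "p - real m" 1 "norm b"] by (intro mult_left_mono) auto
    finally have bp: "norm b powr p \<le> norm b ^ m * norm b" .
    have "norm (Gamma (- b)) * norm b powr p \<le> (C / (P * q\<^sup>2)) * (norm b ^ m * norm b)"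
      using G bp C P by (intro mult_mono) auto
    also have "\<dots> = C * norm b / q\<^sup>2 * (norm b ^ m / P)" by (simp add: field_simps)
    also have "\<dots> \<le> C * norm b / q\<^sup>2 * exp p" using bm C by (intro mult_left_mono) auto
    finally show ?thesis by (simp add: p_def q_def)
  qed
  then show ?thesis using that C(1) by blast
qed

section \<open>The jump and its exponential decay\<close>

definition stokes_jump :: "real \<Rightarrow> complex \<Rightarrow> complex" where
  "stokes_jump lam b = (of_real lam * b) powr b * Gamma (- b) * exp (of_real lam * b)"

lemma norm_stokes_jump:
  assumes lam: "lam > 0" and b: "b \<noteq> 0"
  shows "norm (stokes_jump lam b) = norm (Gamma (- b)) * norm b powr Re b * (lam * exp lam) powr Re b * exp (- (Arg b * Im b))"
proof -
  have Ln: "Ln (of_real lam * b) = of_real (ln lam) + Ln b"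
    using lam b by (simp add: Ln_times_of_real Ln_of_real)
  have "norm ((of_real lam * b) powr b) = exp (Re (b * (of_real (ln lam) + Ln b)))"
    using lam b by (simp add: powr_def Ln)
  also have "Re (b * (of_real (ln lam) + Ln b)) = Re b * ln lam + Re b * ln (norm b) - Arg b * Im b"
    using b by (simp add: Arg_eq_Im_Ln algebra_simps)
  finally have 1: "norm ((of_real lam * b) powr b) = exp (Re b * ln lam) * exp (Re b * ln (norm b)) * exp (- (Arg b * Im b))"
    by (simp add: exp_add exp_diff exp_minus divide_inverse)
  have 2: "exp (Re b * ln lam) * exp (lam * Re b) = (lam * exp lam) powr Re b"
    using lam by (simp add: powr_def ln_mult exp_add[symmetric] algebra_simps)
  have 3: "exp (Re b * ln (norm b)) = norm b powr Re b" using b by (simp add: powr_def)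
  show ?thesis
    unfolding stokes_jump_def norm_mult 1 norm_exp_eq_Re 2[symmetric] 3[symmetric] by simp
qed

text \<open>The smallness of \<open>lam\<close> enters here: (lam e^lam)^(Re b) is at most exp(-(pi
  + 1) Re b), which absorbs the factor exp(Re b) of the gamma bound and leaves exp(-pi Re b). The
  other exponent comes from the modulus of the complex power.\<close>

lemma stokes_jump_bound:
  assumes lam: "lam > 0" and small: "lam * exp lam \<le> exp (- pi - 1)"
  obtains C where "C > 0"
    "\<And>b. Re b \<ge> 0 \<Longrightarrow> Im b \<noteq> 0 \<Longrightarrow> norm b \<ge> 1 \<Longrightarrow>
       norm (stokes_jump lam b) \<le> C * norm b / (Im b)\<^sup>2 * exp (- (pi * Re b) - Arg b * Im b)"
proof -
  obtain C where C: "C > 0" "\<And>b. Re b \<ge> 0 \<Longrightarrow> Im b \<noteq> 0 \<Longrightarrow> norm b \<ge> 1 \<Longrightarrow>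
      norm (Gamma (- b)) * norm b powr Re b \<le> C * norm b / (Im b)\<^sup>2 * exp (Re b)"
    using norm_Gamma_uminus_le by blast
  have "norm (stokes_jump lam b) \<le> C * norm b / (Im b)\<^sup>2 * exp (- (pi * Re b) - Arg b * Im b)"
    if b: "Re b \<ge> 0" "Im b \<noteq> 0" "norm b \<ge> 1" for b
  proof -
    have b0: "b \<noteq> 0" using b(3) by auto
    have "(lam * exp lam) powr Re b \<le> exp (- pi - 1) powr Re b"
      using small lam b(1) by (intro powr_mono2) auto
    also have "\<dots> = exp (Re b * (- pi - 1))" by (simp add: powr_def)
    finally have 1: "(lam * exp lam) powr Re b \<le> exp (Re b * (- pi - 1))" .
    have "norm (stokes_jump lam b) \<le> (C * norm b / (Im b)\<^sup>2 * exp (Re b)) * exp (Re b * (- pi - 1)) * exp (- (Arg b * Im b))"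
      unfolding norm_stokes_jump[OF lam b0]
      using mult_mono[OF C(2)[OF b] 1] C(1) by (intro mult_right_mono) auto
    also have "\<dots> = C * norm b / (Im b)\<^sup>2 * (exp (Re b) * exp (Re b * (- pi - 1)) * exp (- (Arg b * Im b)))"
      by (simp add: mult_ac)
    also have "exp (Re b) * exp (Re b * (- pi - 1)) * exp (- (Arg b * Im b)) = exp (- (pi * Re b) - Arg b * Im b)"
      by (simp add: exp_add[symmetric] algebra_simps)
    finally show ?thesis .
  qed
  then show ?thesis using that C(1) by blast
qed

text \<open>Since Arg b and Im b have the same sign, their product is at least \<phi> s |b|, and
  this term alone forces the decay. The lower bound on |Im b| also turns the prefactor |b| / (Im
  b)^2 into a multiple of 1/|b|.\<close>

lemma stokes_jump_sector_decay:
  assumes lam: "lam > 0" and small: "lam * exp lam \<le> exp (- pi - 1)" and \<phi>: "\<phi> > 0" and s: "s > 0"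
  obtains C where "C > 0"
    "\<And>b. Re b \<ge> 0 \<Longrightarrow> \<phi> \<le> \<bar>Arg b\<bar> \<Longrightarrow> s * norm b \<le> \<bar>Im b\<bar> \<Longrightarrow> norm b \<ge> 1 \<Longrightarrow>
       norm (b ^ N * stokes_jump lam b) \<le> C / norm b * exp (- (\<phi> * s / 2 * norm b))"
proof -
  obtain C where C: "C > 0" "\<And>b. Re b \<ge> 0 \<Longrightarrow> Im b \<noteq> 0 \<Longrightarrow> norm b \<ge> 1 \<Longrightarrow>
       norm (stokes_jump lam b) \<le> C * norm b / (Im b)\<^sup>2 * exp (- (pi * Re b) - Arg b * Im b)"
    using stokes_jump_bound[OF lam small] by blast
  \<comment> \<open>Half of the available rate: the other half absorbs the power b^N through x^N <=
    N! e^x.\<close>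
  define e where "e = \<phi> * s / 2"
  have e: "e > 0" using \<phi> s by (simp add: e_def)
  define D where "D = fact N / e ^ N * (C / s\<^sup>2)"
  have "norm (b ^ N * stokes_jump lam b) \<le> D / norm b * exp (- (e * norm b))"
    if b: "Re b \<ge> 0" "\<phi> \<le> \<bar>Arg b\<bar>" "s * norm b \<le> \<bar>Im b\<bar>" "norm b \<ge> 1" for b
  proof -
    have sb: "0 < s * norm b" using s b(4) by (intro mult_pos_pos) auto
    then have q: "Im b \<noteq> 0" using b(3) by auto
    have b0: "b \<noteq> 0" using b(4) by auto
    have "0 \<le> Arg b * Im b" using Arg_less_0[of b] Arg_le_pi mult_nonneg_nonneg mult_nonpos_nonpos
      by (metis less_le_not_le linorder_le_cases not_le)
    then have "Arg b * Im b = \<bar>Arg b\<bar> * \<bar>Im b\<bar>" by (simp add: abs_mult[symmetric])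
    also have "\<dots> \<ge> \<phi> * (s * norm b)" using b \<phi> sb by (intro mult_mono) auto
    finally have a: "Arg b * Im b \<ge> 2 * (e * norm b)" by (simp add: e_def mult_ac)
    have "(s * norm b)\<^sup>2 \<le> \<bar>Im b\<bar>\<^sup>2" using b(3) sb by (intro power_mono) auto
    then have im: "s\<^sup>2 * (norm b)\<^sup>2 \<le> (Im b)\<^sup>2" by (simp add: power_mult_distrib)
    have 1: "C * norm b / (Im b)\<^sup>2 \<le> C * norm b / (s\<^sup>2 * (norm b)\<^sup>2)"
      using im C b0 q s by (intro divide_left_mono) auto
    also have "\<dots> = (C / s\<^sup>2) / norm b" using b0 by (simp add: power2_eq_square)
    finally have 1: "C * norm b / (Im b)\<^sup>2 \<le> (C / s\<^sup>2) / norm b" .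
    have 2: "exp (- (pi * Re b) - Arg b * Im b) \<le> exp (- (2 * (e * norm b)))"
      using a mult_nonneg_nonneg[OF pi_ge_zero b(1)] by simp
    have "(e * norm b) ^ N \<le> fact N * exp (e * norm b)"
      using e by (intro power_le_fact_mult_exp) auto
    then have 3: "norm b ^ N \<le> fact N / e ^ N * exp (e * norm b)"
      using e by (simp add: power_mult_distrib field_simps)
    have "norm (b ^ N * stokes_jump lam b) = norm b ^ N * norm (stokes_jump lam b)"
      by (simp add: norm_mult norm_power)
    also have "\<dots> \<le> (fact N / e ^ N * exp (e * norm b)) * ((C / s\<^sup>2) / norm b * exp (- (2 * (e * norm b))))"
    proof (rule mult_mono[OF 3])
      show "norm (stokes_jump lam b) \<le> (C / s\<^sup>2) / norm b * exp (- (2 * (e * norm b)))"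
        by (rule order_trans[OF C(2)[OF b(1) q b(4)] mult_mono[OF 1 2]]) (use C s in auto)
    qed (use e in auto)
    also have "\<dots> = D / norm b * (exp (e * norm b) * exp (- (2 * (e * norm b))))"
      by (simp add: D_def field_simps)
    also have "exp (e * norm b) * exp (- (2 * (e * norm b))) = exp (- (e * norm b))"
      by (simp add: exp_add[symmetric])
    finally show ?thesis .
  qed
  moreover have "D > 0" using e C s by (simp add: D_def)
  ultimately show ?thesis using that[of D] by (simp add: e_def)
qed

text \<open>The index is shifted: \<open>left_remainder lam M\<close> is \<open>b\<^sup>N\<close> times the remainder after \<open>N = M + 1\<close> terms,
  written so that the simple pole of the left integral at \<open>b = 0\<close> is already cancelled.\<close>

definition left_remainder :: "real \<Rightarrow> nat \<Rightarrow> complex \<Rightarrow> complex" where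
  "left_remainder lam M b = b ^ M * (exp (of_real lam * b) * (1 - b * pole_series (- b) (of_real lam * b)))
     - (\<Sum>n\<le>M. amp lam n 0 / (1 + of_real lam) * b ^ (M - n))"

lemma left_remainder_eq:
  assumes "b \<noteq> 0"
  shows "left_remainder lam M b = b ^ Suc M * (exp (of_real lam * b) * (1 / b - pole_series (- b) (of_real lam * b))
     - (\<Sum>n<Suc M. amp lam n 0 / (1 + of_real lam) / b ^ (n + 1)))"
proof -
  have "b ^ Suc M * (\<Sum>n<Suc M. amp lam n 0 / (1 + of_real lam) / b ^ (n + 1)) = (\<Sum>n\<le>M. amp lam n 0 / (1 + of_real lam) * b ^ (M - n))"
    unfolding sum_distrib_left lessThan_Suc_atMost
    by (rule sum.cong) (use assms in \<open>auto simp: power_diff\<close>)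
  moreover have "b ^ Suc M * (exp (of_real lam * b) * (1 / b - pole_series (- b) (of_real lam * b))) = b ^ M * (exp (of_real lam * b) * (b * (1 / b) - b * pole_series (- b) (of_real lam * b)))"
    by (simp add: algebra_simps)
  ultimately show ?thesis using assms by (simp add: left_remainder_def right_diff_distrib del: power_Suc sum.lessThan_Suc)
qed

text \<open>The only exceptional points are the positive integers. In particular 0 belongs to the
  domain, so the triangles in the complementary sector may have a vertex there.\<close>

lemma left_remainder_holomorphic:
  "left_remainder lam M holomorphic_on - range (\<lambda>k. complex_of_nat (Suc k))"
proof -
  let ?A = "- range (\<lambda>k. complex_of_nat (Suc k))"
  have "(\<lambda>w. pole_series w (- (of_real lam * w))) \<circ> uminus holomorphic_on ?A"
  proof (rule holomorphic_on_compose_gen)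
    show "(\<lambda>w. pole_series w (- (of_real lam * w))) holomorphic_on - range (\<lambda>k. - complex_of_nat (Suc k))"
      by (rule pole_series_holomorphic) (intro holomorphic_intros)
    show "uminus ` ?A \<subseteq> - range (\<lambda>k. - complex_of_nat (Suc k))"
      by (auto simp: image_iff) (metis add_uminus_conv_diff minus_add_distrib minus_minus)
  qed (intro holomorphic_intros)
  then have "(\<lambda>b. pole_series (- b) (of_real lam * b)) holomorphic_on ?A"
    by (simp add: o_def)
  then show ?thesis unfolding left_remainder_def by (intro holomorphic_intros)
qed

context
  fixes lam :: real
  assumes lam: "lam > 0"
begin

text \<open>Identifies the continued function with the integral over the negative half-line where
  that integral converges; the common expansion coefficients make the subtracted sums agree.\<close>

lemma left_remainder_left_half_plane:
  assumes b: "Re b < 0"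
  shows "left_remainder lam M b = half_integral lam (-1) (Suc M) b"
proof -
  have b0: "b \<noteq> 0" using b by auto
  have "half_integrand lam (-1) 0 b x = exp (of_real lam * b) * exp (b * of_real x - of_real lam * b * exp (- of_real x))" for x
    by (simp add: half_integrand_def[OF lam] phase_def exp_add[symmetric] algebra_simps)
  then have "half_integral lam (-1) 0 b = - (exp (of_real lam * b) * lower_Laplace b (of_real lam * b))"
    by (simp add: half_integral_def[OF lam] lower_Laplace_def)
  also have "\<dots> = exp (of_real lam * b) * (1 / b - pole_series (- b) (of_real lam * b))"
    by (simp add: lower_Laplace_series[OF b] algebra_simps)
  finally have h: "half_integral lam (-1) 0 b = exp (of_real lam * b) * (1 / b - pole_series (- b) (of_real lam * b))" .
  show ?thesis unfolding left_remainder_eq[OF b0] h[symmetric]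
    by (rule half_integral_expansion[OF lam]) (use b in auto)
qed

lemma half_integral_upper_Laplace:
  "half_integral lam 1 0 b = exp (of_real lam * b) * upper_Laplace b (of_real lam * b)"
proof -
  have "half_integrand lam 1 0 b x = exp (of_real lam * b) * exp (- (b * of_real x) - of_real lam * b * exp (of_real x))" for x
    by (simp add: half_integrand_def[OF lam] phase_def exp_add[symmetric] algebra_simps)
  then show ?thesis
    by (simp add: half_integral_def[OF lam] upper_Laplace_def)
qed

text \<open>The partial sums of both expansions are identical and cancel, so the difference is the
  sum of the two Laplace integrals at z = \<open>lam * b\<close>, that is, the gamma term. The
  condition on \<open>Im b\<close> keeps -b off the cut.\<close>

lemma left_remainder_jump:
  assumes b: "Re b > 0" "Im b \<noteq> 0"
  shows "half_integral lam 1 (Suc M) b - left_remainder lam M b = b ^ Suc M * stokes_jump lam b"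
proof -
  have b0: "b \<noteq> 0" using b by auto
  have nb: "- b \<notin> \<real>\<^sub>\<le>\<^sub>0" using b by (auto simp: complex_nonpos_Reals_iff)
  have z: "Re (of_real lam * b) > 0" using b lam by simp
  have h: "half_integral lam 1 0 b - exp (of_real lam * b) * (1 / b - pole_series (- b) (of_real lam * b)) = stokes_jump lam b"
    unfolding stokes_jump_def Gamma_Laplace_continued[OF nb z, symmetric] half_integral_upper_Laplace
    by (simp add: algebra_simps)
  show ?thesis
    unfolding left_remainder_eq[OF b0] half_integral_expansion[OF lam, of 1 b "Suc M", symmetric, simplified, OF b(1)] h[symmetric]
    by (simp add: algebra_simps)
qed

end

subsection \<open>Cauchy's theorem in the two sectors\<close>

text \<open>The scaling s = R x turns the parametrised integral over a segment into part of a
  half-line integral, so the bound is independent of \<open>R\<close> and survives the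
  limit.\<close>

lemma norm_contour_integral_ray_le:
  fixes f :: "complex \<Rightarrow> complex" and h :: "real \<Rightarrow> real"
  assumes R: "R > 0" and u: "norm u = 1"
    and cont: "continuous_on (closed_segment 0 (of_real R * u)) f"
    and h: "set_integrable lborel {0<..} h" 
    and le: "\<And>s. 0 < s \<Longrightarrow> norm (f (of_real s * u)) \<le> h s"
  shows "norm (contour_integral (linepath 0 (of_real R * u)) f) \<le> (LBINT s:{0<..}. h s)"
proof -
  define g where "g x = f (linepath 0 (of_real R * u) x) * (of_real R * u)" for x
  have lp: "linepath 0 (of_real R * u) x = of_real (R * x) * u" for x
    by (simp add: linepath_def scaleR_conv_of_real algebra_simps)
  have g: "continuous_on {0..1} g"
    unfolding g_def
    by (intro continuous_intros continuous_on_compose2[OF cont])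
      (auto simp flip: linepath_image_01)
  have gint: "set_integrable lborel {0..1} g"
    by (rule borel_integrable_atLeastAtMost'[OF g])
  have "contour_integral (linepath 0 (of_real R * u)) f = integral {0..1} g"
    unfolding contour_integral_integral g_def by (rule integral_cong) simp
  also have "\<dots> = (LBINT x:{0..1}. g x)"
    by (rule set_borel_integral_eq_integral(2)[OF gint, symmetric])
  finally have "norm (contour_integral (linepath 0 (of_real R * u)) f) \<le> (LBINT x:{0..1}. norm (g x))"
    using set_integral_norm_bound[OF gint] by simp
  also have "\<dots> \<le> (LBINT x. R * (indicator {0<..} (0 + R * x) *\<^sub>R h (0 + R * x)))"
    unfolding set_lebesgue_integral_def
  proof (rule integral_mono_AE)
    show "integrable lborel (\<lambda>x. indicat_real {0..1} x *\<^sub>R norm (g x))"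
      using set_integrable_norm[OF gint] by (simp add: set_integrable_def)
    show "integrable lborel (\<lambda>x. R * (indicator {0<..} (0 + R * x) *\<^sub>R h (0 + R * x)))"
      by (intro integrable_mult_right lborel_integrable_real_affine) (use h R in \<open>auto simp: set_integrable_def\<close>)
    have "AE x in lborel. x \<noteq> (0::real)" by (rule AE_lborel_singleton)
    then show "AE x in lborel. indicat_real {0..1} x *\<^sub>R norm (g x) \<le> R * (indicator {0<..} (0 + R * x) *\<^sub>R h (0 + R * x))"
    proof eventually_elim
      case (elim x)
      show ?case
      proof (cases "x > 0")
        case True
        then have Rx: "R * x > 0" using R by simp
        have "norm (g x) = R * norm (f (of_real (R * x) * u))"
          unfolding g_def lp norm_mult using R u by simp
        also have "\<dots> \<le> R * h (R * x)" using le[OF Rx] R by (intro mult_left_mono) auto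
        finally have "norm (g x) \<le> R * h (R * x)" .
        moreover have "0 \<le> R * h (R * x)" using calculation norm_ge_zero order_trans by blast
        ultimately show ?thesis using Rx by (simp add: indicator_def)
      next
        case False
        then have "x < 0" using elim by simp
        then show ?thesis using R by (simp add: indicator_def mult_pos_neg not_less zero_less_mult_iff)
      qed
    qed
  qed
  also have "\<dots> = R * (LBINT x. indicator {0<..} (0 + R * x) *\<^sub>R h (0 + R * x))" by simp
  also have "\<dots> = (LBINT s:{0<..}. h s)"
    using lborel_integral_real_affine[of R "\<lambda>s. indicator {0<..} s *\<^sub>R h s" 0] R
    by (simp add: set_lebesgue_integral_def)
  finally show ?thesis .
qed

lemma Im_mult_cis: "Im (b * cis t) = norm b * sin (Arg b + t)"
proof -
  have "b = rcis (norm b) (Arg b)" by (simp add: rcis_cmod_Arg)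
  then have "b * cis t = rcis (norm b) (Arg b + t)"
    by (metis cis_rcis_eq mult.right_neutral rcis_mult)
  then show ?thesis by simp
qed

text \<open>Outside the sector |arg b| < \<phi> the plane is covered by two half-planes, each
  recognised by a rotated imaginary part. These linear conditions are easy to check on convex
  combinations.\<close>

lemma Arg_ge_of_Im:
  assumes \<phi>: "0 < \<phi>" "\<phi> < pi / 2" and b: "b \<noteq> 0"
    and ge: "Im (b * cis (- \<phi>)) \<ge> 0 \<or> Im (b * cis \<phi>) \<le> 0"
  shows "\<phi> \<le> \<bar>Arg b\<bar>"
proof (rule ccontr)
  assume "\<not> \<phi> \<le> \<bar>Arg b\<bar>"
  then have A: "- \<phi> < Arg b" "Arg b < \<phi>" by auto
  have "sin (\<phi> - Arg b) > 0" "sin (Arg b + \<phi>) > 0" using A \<phi> by (auto intro!: sin_gt_zero)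
  moreover have "Im (b * cis (- \<phi>)) = - (norm b * sin (\<phi> - Arg b))"
    unfolding Im_mult_cis by (metis minus_diff_eq mult_minus_right sin_minus uminus_add_conv_diff add.commute)
  moreover have "Im (b * cis \<phi>) = norm b * sin (Arg b + \<phi>)" by (rule Im_mult_cis)
  ultimately show False using ge b by (auto simp: mult_le_0_iff zero_le_mult_iff)
qed

lemma sector_Im_ge:
  assumes \<phi>: "0 < \<phi>" "\<phi> < pi / 2" and b: "\<phi> \<le> \<bar>Arg b\<bar>" "Re b \<ge> 0"
  shows "sin \<phi> * norm b \<le> \<bar>Im b\<bar>"
proof (cases "b = 0")
  case False
  have "\<bar>Arg b\<bar> \<le> pi / 2" using b False Re_Ln_pos_le[of b] by (simp add: Arg_eq_Im_Ln)
  then have "sin \<phi> \<le> sin \<bar>Arg b\<bar>" using \<phi> b by (subst sin_mono_le_eq) auto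
  also have "sin \<bar>Arg b\<bar> = \<bar>sin (Arg b)\<bar>" 
  proof -
    have "sin \<bar>Arg b\<bar> \<ge> 0" using \<open>\<bar>Arg b\<bar> \<le> pi / 2\<close> by (intro sin_ge_zero) auto
    then have "sin \<bar>Arg b\<bar> = \<bar>sin \<bar>Arg b\<bar>\<bar>" by simp
    also have "\<dots> = \<bar>sin (Arg b)\<bar>" by (cases "Arg b \<ge> 0") auto
    finally show ?thesis .
  qed
  finally have "norm b * sin \<phi> \<le> norm b * \<bar>sin (Arg b)\<bar>" by (intro mult_left_mono) auto
  also have "\<dots> = \<bar>Im b\<bar>" using Im_mult_cis[of b 0] by (simp add: abs_mult)
  finally show ?thesis by (simp add: mult.commute)
qed auto

text \<open>By this reflection one integral over the upper ray bounds the contributions of both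
  rays.\<close>

lemma norm_stokes_jump_cnj:
  assumes lam: "lam > 0" and b: "Im b \<noteq> 0"
  shows "norm (stokes_jump lam (cnj b)) = norm (stokes_jump lam b)"
proof -
  have b0: "b \<noteq> 0" "cnj b \<noteq> 0" "b \<notin> \<real>" using b by (auto simp: complex_is_Real_iff)
  have "norm (Gamma (- cnj b)) = norm (Gamma (- b))"
    by (metis cnj_Gamma complex_cnj_minus complex_mod_cnj)
  then show ?thesis
    unfolding norm_stokes_jump[OF lam b0(1)] norm_stokes_jump[OF lam b0(2)] using b0(3) by (simp add: Arg_cnj)
qed


section \<open>The sector and the decay of the left remainder\<close>

text \<open>The half-opening \<open>\<phi>\<close> stays a parameter throughout the contour
  argument; the value pi - omega is inserted only when the jump is evaluated on the rays.\<close>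

locale stokes_sector =
  fixes lam \<phi> :: real
  assumes lam: "lam > 0" and small: "lam * exp lam \<le> exp (- pi - 1)"
    and \<phi>: "0 < \<phi>" "\<phi> < pi / 2"
begin

lemma sin_\<phi>: "sin \<phi> > 0" and cos_\<phi>: "cos \<phi> > 0"
  using \<phi> by (auto intro!: sin_gt_zero cos_gt_zero)

text \<open>For \<open>Re b < 0\<close> the remainder is an integral with known decay. For
  \<open>Re b > 0\<close> it differs from the right integral by the exponentially small jump, so it
  inherits the same decay: this is the transfer across the Stokes sectors.\<close>

lemma left_remainder_decay:
  obtains C where "C > 0"
    "\<And>b. \<phi> \<le> \<bar>Arg b\<bar> \<Longrightarrow> norm b \<ge> 1 \<Longrightarrow> norm (left_remainder lam M b) \<le> C / norm b"
proof -
  obtain C1 where C1: "C1 \<ge> 0"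
    "\<And>sg b. sg = 1 \<or> sg = -1 \<Longrightarrow> sg * Re b > 0 \<Longrightarrow> norm (half_integral lam sg (Suc M) b) \<le> C1 / norm b"
    by (rule half_integral_decay[OF lam, of "Suc M"]) (rule that)
  obtain C2 where C2: "C2 > 0"
    "\<And>b. Re b \<ge> 0 \<Longrightarrow> \<phi> \<le> \<bar>Arg b\<bar> \<Longrightarrow> sin \<phi> * norm b \<le> \<bar>Im b\<bar> \<Longrightarrow> norm b \<ge> 1 \<Longrightarrow>
       norm (b ^ Suc M * stokes_jump lam b) \<le> C2 / norm b * exp (- (\<phi> * sin \<phi> / 2 * norm b))"
    by (rule stokes_jump_sector_decay[OF lam small \<phi>(1) sin_\<phi>, of "Suc M"]) (rule that)
  have neg: "norm (left_remainder lam M b) \<le> C1 / norm b" if "Re b < 0" for b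
    unfolding left_remainder_left_half_plane[OF lam that] using C1(2)[of "-1" b] that by simp
  have "norm (left_remainder lam M b) \<le> (C1 + C2) / norm b"
    if b: "\<phi> \<le> \<bar>Arg b\<bar>" "norm b \<ge> 1" for b
  proof -
    have b0: "norm b > 0" using b by auto
    have le: "C1 / norm b \<le> (C1 + C2) / norm b" using C2(1) b0 by (intro divide_right_mono) auto
    consider "Re b < 0" | "Re b > 0" | "Re b = 0" by linarith
    then show ?thesis
    proof cases
      case 1
      then show ?thesis using neg le order_trans by blast
    next
      case 2
      have s: "sin \<phi> * norm b \<le> \<bar>Im b\<bar>" using sector_Im_ge[OF \<phi> b(1)] 2 by simp
      then have "Im b \<noteq> 0" using sin_\<phi> b0 by (auto simp: mult_le_0_iff)
      from left_remainder_jump[OF lam 2 this, of M]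
      have "left_remainder lam M b = half_integral lam 1 (Suc M) b - b ^ Suc M * stokes_jump lam b"
        by (simp add: algebra_simps)
      also have "norm \<dots> \<le> norm (half_integral lam 1 (Suc M) b) + norm (b ^ Suc M * stokes_jump lam b)"
        by (rule norm_triangle_ineq4)
      also have "\<dots> \<le> C1 / norm b + C2 / norm b * exp (- (\<phi> * sin \<phi> / 2 * norm b))"
        using C1(2)[of 1 b] C2(2)[of b] 2 b s by (intro add_mono) auto
      also have "\<dots> \<le> C1 / norm b + C2 / norm b * 1"
        using C2(1) b0 \<phi> sin_\<phi> by (intro add_left_mono mult_left_mono) auto
      finally show ?thesis by (simp add: add_divide_distrib)
    next
      case 3
      \<comment> \<open>On the imaginary axis itself the bound is obtained by continuity, along a
        sequence approaching from the left half-plane, where the constant \<open>C1\<close> is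
        available.\<close>
      define X where "X n = b - of_real (1 / real (Suc n))" for n
      have X: "X \<longlonglongrightarrow> b"
      proof -
        have "(\<lambda>n. b - of_real (1 / real (Suc n))) \<longlonglongrightarrow> b - of_real 0"
          by (intro tendsto_intros) (use LIMSEQ_inverse_real_of_nat in \<open>simp only: divide_inverse mult_1\<close>)
        then show ?thesis by (simp add: X_def[abs_def])
      qed
      have b': "b \<in> - range (\<lambda>k. complex_of_nat (Suc k))"
      proof
        assume "b \<in> range (\<lambda>k. complex_of_nat (Suc k))"
        then obtain k where "b = of_nat (Suc k)" by blast
        then show False using 3 by simp
      qed
      have op: "open (- range (\<lambda>k. complex_of_nat (Suc k)))"
        by (intro open_Compl closed_subset_Ints) auto
      have "isCont (left_remainder lam M) b"
        using holomorphic_on_imp_continuous_on[OF left_remainder_holomorphic, of lam M] b'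
        unfolding continuous_on_eq_continuous_at[OF op] by (rule bspec)
      then have "(\<lambda>n. norm (left_remainder lam M (X n))) \<longlonglongrightarrow> norm (left_remainder lam M b)"
        using X by (intro tendsto_norm isCont_tendsto_compose[of b "left_remainder lam M" X])
      moreover have "(\<lambda>n. C1 / norm (X n)) \<longlonglongrightarrow> C1 / norm b"
        using X b0 by (intro tendsto_intros) auto
      moreover have "\<exists>n0. \<forall>n\<ge>n0. norm (left_remainder lam M (X n)) \<le> C1 / norm (X n)"
      proof (intro exI allI impI)
        show "norm (left_remainder lam M (X n)) \<le> C1 / norm (X n)" for n
          by (rule neg) (use 3 in \<open>simp add: X_def\<close>)
      qed
      ultimately have "norm (left_remainder lam M b) \<le> C1 / norm b"
        by (rule LIMSEQ_le)
      then show ?thesis using le order_trans by blast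
    qed
  qed
  then show ?thesis using that[of "C1 + C2"] C1 C2 by auto
qed

text \<open>Near the vertex, integrability is read off from the jump being a difference of two remainders
  that are both continuous there.\<close>

lemma ray_integrable:
  "set_integrable lborel {0<..} (\<lambda>s. norm ((of_real s * cis \<phi>) ^ Suc M * stokes_jump lam (of_real s * cis \<phi>)))"
proof -
  define D where "D s = half_integral lam 1 (Suc M) (of_real s * cis \<phi>) - left_remainder lam M (of_real s * cis \<phi>)" for s
  have re: "Re (of_real s * cis \<phi>) > 0" "Im (of_real s * cis \<phi>) > 0" if "s > 0" for s
    using that sin_\<phi> cos_\<phi> by auto
  have D: "(of_real s * cis \<phi>) ^ Suc M * stokes_jump lam (of_real s * cis \<phi>) = D s" if "s > 0" for s
    unfolding D_def by (rule left_remainder_jump[OF lam re(1)[OF that], symmetric]) (use that sin_\<phi> in simp)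
  have contD: "continuous_on {0..} D"
  proof -
    have "continuous_on {0..} (\<lambda>s. half_integral lam 1 (Suc M) (of_real s * cis \<phi>))"
      by (rule continuous_on_compose2[OF half_integral_Suc_continuous[OF lam]])
        (use cos_\<phi> in \<open>auto intro!: continuous_intros\<close>)
    moreover have "continuous_on {0..} (\<lambda>s. left_remainder lam M (of_real s * cis \<phi>))"
    proof (rule continuous_on_compose2[OF holomorphic_on_imp_continuous_on[OF left_remainder_holomorphic]])
      show "(\<lambda>s. complex_of_real s * cis \<phi>) ` {0..} \<subseteq> - range (\<lambda>k. complex_of_nat (Suc k))"
      proof clarsimp
        fix s :: real and k assume "0 \<le> s" and eq: "complex_of_real s * cis \<phi> = 1 + of_nat k"
        then have "Im (complex_of_real s * cis \<phi>) = 0" by simp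
        then have "s = 0" using sin_\<phi> by simp
        then show False using eq by (simp add: complex_eq_iff)
      qed
    qed (auto intro!: continuous_intros)
    ultimately show ?thesis unfolding D_def by (intro continuous_intros)
  qed
  obtain C2 where C2: "C2 > 0"
    "\<And>b. Re b \<ge> 0 \<Longrightarrow> \<phi> \<le> \<bar>Arg b\<bar> \<Longrightarrow> sin \<phi> * norm b \<le> \<bar>Im b\<bar> \<Longrightarrow> norm b \<ge> 1 \<Longrightarrow>
       norm (b ^ Suc M * stokes_jump lam b) \<le> C2 / norm b * exp (- (\<phi> * sin \<phi> / 2 * norm b))"
    by (rule stokes_jump_sector_decay[OF lam small \<phi>(1) sin_\<phi>, of "Suc M"]) (rule that)
  define c where "c = \<phi> * sin \<phi> / 2"
  have c: "c > 0" using \<phi> sin_\<phi> by (simp add: c_def)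
  have "bounded (D ` {0..1})"
    by (intro compact_imp_bounded compact_continuous_image continuous_on_subset[OF contD]) auto
  then obtain B where B: "\<And>s. s \<in> {0..1} \<Longrightarrow> norm (D s) \<le> B"
    unfolding bounded_iff by blast
  have B0: "B \<ge> 0" using order_trans[OF norm_ge_zero B[of 0]] by simp
  have bd: "norm (D s) \<le> (B * exp c + C2) * exp (- (c * s))" if s: "s > 0" for s
  proof (cases "s \<le> 1")
    case True
    have "c * s \<le> c * 1" using True c by (intro mult_left_mono) auto
    then have "1 \<le> exp c * exp (- (c * s))" by (simp add: exp_add[symmetric])
    then have "B * 1 \<le> B * (exp c * exp (- (c * s)))" using B0 by (intro mult_left_mono) auto
    also have "\<dots> \<le> (B * exp c + C2) * exp (- (c * s))" using C2(1) by (simp add: algebra_simps)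
    finally show ?thesis using B[of s] s True by simp
  next
    case False
    have n: "norm (of_real s * cis \<phi>) = s" using s by (simp add: norm_mult)
    have a: "Arg (of_real s * cis \<phi>) = \<phi>" using s \<phi> by (simp add: Arg_times_of_real Arg_cis)
    have "norm (D s) \<le> C2 / s * exp (- (c * s))"
      using C2(2)[of "of_real s * cis \<phi>"] re[OF s] n a \<phi> False s unfolding D[OF s, symmetric] c_def by simp
    also have "\<dots> \<le> (B * exp c + C2) * exp (- (c * s))"
    proof (intro mult_right_mono)
      have "C2 / s \<le> C2 / 1" using False C2 by (intro divide_left_mono) auto
      then show "C2 / s \<le> B * exp c + C2" using mult_nonneg_nonneg[OF B0, of "exp c"] by simp
    qed simp
    finally show ?thesis .
  qed
  have "set_integrable lborel {0<..} (\<lambda>s. norm (D s))"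
    by (rule set_integrable_exp_bound[OF c, of _ "B * exp c + C2"])
      (use bd in \<open>auto intro!: continuous_intros continuous_on_subset[OF contD]\<close>)
  then show ?thesis
    using set_integrable_cong[OF refl refl, of "{0<..}" "\<lambda>s. norm (D s)"] D by (metis (no_types, lifting) greaterThan_iff)
qed

end

context stokes_sector
begin

text \<open>The points \<alpha> w - \<beta> fill the wedge between the ray through \<open>w\<close>
  and the negative real axis. Rotating \<open>w\<close> onto the real axis leaves only +-\<beta> sin
  \<phi> as imaginary part.\<close>

lemma wedge_Arg:
  assumes e: "w = cis \<phi> \<or> w = cis (- \<phi>)" and ab: "\<alpha> \<ge> 0" "\<beta> \<ge> 0"
    and b: "b = of_real \<alpha> * w - of_real \<beta>"
  shows "b = 0 \<or> \<phi> \<le> \<bar>Arg b\<bar>"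
proof (cases "b = 0")
  case False
  have "Im (b * cis (- \<phi>)) \<ge> 0 \<or> Im (b * cis \<phi>) \<le> 0"
  proof (cases "w = cis \<phi>")
    case True
    have "Im (b * cis (- \<phi>)) = \<beta> * sin \<phi>" unfolding b True by (simp add: algebra_simps)
    then show ?thesis using sin_\<phi> ab by simp
  next
    case False
    then have w: "w = cis (- \<phi>)" using e by simp
    have "Im (b * cis \<phi>) = - (\<beta> * sin \<phi>)" unfolding b w by (simp add: algebra_simps)
    then show ?thesis using sin_\<phi> ab by simp
  qed
  then show ?thesis using Arg_ge_of_Im[OF \<phi> False] by simp
qed simp

text \<open>With c = cos \<phi> the squared norm is (1 - c)/2 (\<alpha> + \<beta>)^2 + (1 + c)/2
  (\<alpha> - \<beta>)^2. This keeps the chord from a ray to the negative axis at a distance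
  proportional to R from the origin.\<close>

lemma wedge_norm:
  assumes e: "w = cis \<phi> \<or> w = cis (- \<phi>)" and ab: "\<alpha> \<ge> 0" "\<beta> \<ge> 0"
  shows "norm (of_real \<alpha> * w - of_real \<beta>) \<ge> sqrt ((1 - cos \<phi>) / 2) * (\<alpha> + \<beta>)"
proof -
  define c where "c = cos \<phi>"
  have c: "c \<le> 1" "- 1 \<le> c" by (auto simp: c_def)
  have "(norm (of_real \<alpha> * w - of_real \<beta>))\<^sup>2 = (\<alpha> * c - \<beta>)\<^sup>2 + (\<alpha> * sin \<phi>)\<^sup>2"
    using e by (auto simp: cmod_power2 c_def)
  also have "\<dots> = \<alpha>\<^sup>2 * ((sin \<phi>)\<^sup>2 + (cos \<phi>)\<^sup>2) + \<beta>\<^sup>2 - 2 * \<alpha> * \<beta> * c"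
    unfolding c_def by algebra
  also have "\<dots> = (1 - c) / 2 * (\<alpha> + \<beta>)\<^sup>2 + (1 + c) / 2 * (\<alpha> - \<beta>)\<^sup>2"
    unfolding sin_cos_squared_add by (simp add: power2_eq_square field_simps)
  also have "\<dots> \<ge> (1 - c) / 2 * (\<alpha> + \<beta>)\<^sup>2"
    using c by simp
  finally have "(sqrt ((1 - c) / 2) * (\<alpha> + \<beta>))\<^sup>2 \<le> (norm (of_real \<alpha> * w - of_real \<beta>))\<^sup>2"
    using c by (simp add: power_mult_distrib)
  then show ?thesis unfolding c_def by (rule power2_le_imp_le) simp
qed

text \<open>One triangle in the sector encloses \<open>a\<close>. The complementary sector is not
  convex and is therefore covered by two triangles meeting along the negative real axis. Adding the
  three contour identities leaves the jump on the two rays, and three outer sides of length O(R)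
  with integrand O(R^(-2)).\<close>

lemma half_integral_Stokes_bound:
  fixes a :: complex and M :: nat
  assumes a: "a \<noteq> 0" "\<bar>Arg a\<bar> < \<phi>"
  defines "K \<equiv> (LBINT s:{0<..}. norm ((of_real s * cis \<phi>) ^ Suc M * stokes_jump lam (of_real s * cis \<phi>)))"
  shows "2 * pi * norm (half_integral lam 1 (Suc M) a)
     \<le> K / (norm a * sin (\<phi> - Arg a)) + K / (norm a * sin (\<phi> + Arg a))"
proof -
  define F where "F = half_integral lam 1 (Suc M)"
  define E where "E = left_remainder lam M"
  define Fa where "Fa b = F b / (b - a)" for b
  define Ea where "Ea b = E b / (b - a)" for b
  define \<Omega> where "\<Omega> = - insert a (range (\<lambda>k. complex_of_nat (Suc k)))"
  define u v where "u = cis \<phi>" and "v = cis (- \<phi>)"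
  have nu [simp]: "norm u = 1" "norm v = 1" by (auto simp: u_def v_def)
  have sa: "sin (\<phi> - Arg a) > 0" "sin (\<phi> + Arg a) > 0" using a \<phi> by (auto intro!: sin_gt_zero)
  define d1 where "d1 = norm a * sin (\<phi> - Arg a)"
  define d2 where "d2 = norm a * sin (\<phi> + Arg a)"
  have d: "d1 > 0" "d2 > 0" using sa a by (auto simp: d1_def d2_def)
  have Ima: "Im (a * v) = - d1" "Im (a * u) = d2"
    unfolding u_def v_def Im_mult_cis d1_def d2_def
    by (metis minus_diff_eq mult_minus_right sin_minus uminus_add_conv_diff add.commute) (simp add: add.commute)
  have Ima': "Im a * cos \<phi> - Re a * sin \<phi> = - d1" "Im a * cos \<phi> + Re a * sin \<phi> = d2"
    using Ima by (simp_all add: u_def v_def algebra_simps)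
  have Rea: "Re a > 0"
  proof -
    have "2 * (Re a * sin \<phi>) = d1 + d2" using Ima' by simp
    then have "Re a * sin \<phi> > 0" using d by simp
    then show ?thesis using sin_\<phi> by (simp add: zero_less_mult_iff)
  qed
  \<comment> \<open>Chosen so that every point of the outer sides has modulus at least \<kappa> R:
    the side inside the sector has constant real part R cos \<phi>, and for the two others the
    constant is that of \<open>wedge_norm\<close>.\<close>
  define \<kappa> where "\<kappa> = min (cos \<phi>) (sqrt ((1 - cos \<phi>) / 2))"
  have "cos \<phi> < 1" using cos_monotone_0_pi[of 0 \<phi>] \<phi> by simp
  then have \<kappa>: "\<kappa> > 0" "\<kappa> \<le> cos \<phi>" "\<kappa> \<le> sqrt ((1 - cos \<phi>) / 2)"
    using cos_\<phi> by (auto simp: \<kappa>_def)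
  obtain C1 where C1': "C1 \<ge> 0"
    "\<And>sg b. sg = 1 \<or> sg = -1 \<Longrightarrow> sg * Re b > 0 \<Longrightarrow> norm (half_integral lam sg (Suc M) b) \<le> C1 / norm b"
    by (rule half_integral_decay[OF lam, of "Suc M"]) (rule that)
  have C1: "C1 \<ge> 0" "\<And>b. Re b > 0 \<Longrightarrow> norm (F b) \<le> C1 / norm b"
    using C1'(1) C1'(2)[of 1] by (simp_all add: F_def)
  obtain C2 where C2': "C2 > 0"
    "\<And>b. \<phi> \<le> \<bar>Arg b\<bar> \<Longrightarrow> norm b \<ge> 1 \<Longrightarrow> norm (left_remainder lam M b) \<le> C2 / norm b"
    by (rule left_remainder_decay[of M]) (rule that)
  note C2 = C2'[folded E_def]
  define C where "C = C1 + C2"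
  have C: "C > 0" "C1 \<le> C" "C2 \<le> C" using C1(1) C2(1) by (auto simp: C_def)
  \<comment> \<open>Beyond this radius \<kappa> R exceeds 1, where the decay of the left remainder
    applies, and 2 |a|, so that |b - a| is at least \<kappa> R / 2 on the outer sides.\<close>
  define R0 where "R0 = max (1 / \<kappa>) (2 * norm a / \<kappa> + 1)"
  have contF: "continuous_on {b. Re b \<ge> 0} F" unfolding F_def by (rule half_integral_Suc_continuous[OF lam])
  have holF: "F holomorphic_on {b. Re b > 0}" unfolding F_def by (rule half_integral_holomorphic[OF lam])
  have holEa: "Ea holomorphic_on \<Omega>"
    unfolding Ea_def E_def by (intro holomorphic_intros holomorphic_on_subset[OF left_remainder_holomorphic]) (auto simp: \<Omega>_def)
  have Om: "b \<in> \<Omega>" if "b = 0 \<or> \<phi> \<le> \<bar>Arg b\<bar>" for b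
  proof -
    have "b \<noteq> a" using that a by auto
    moreover have "b \<noteq> of_nat (Suc k)" for k
    proof
      assume b: "b = of_nat (Suc k)"
      then have "Arg b = 0" using Arg_of_real[of "real (Suc k)"] by (simp del: of_nat_Suc)
      moreover have "b \<noteq> 0" using b by (simp del: of_nat_Suc)
      ultimately show False using that \<phi> by simp
    qed
    ultimately show ?thesis by (auto simp: \<Omega>_def)
  qed
  \<comment> \<open>After rotation of the ray onto the real axis, the imaginary part of the
    difference no longer depends on \<open>s\<close>; its modulus is the distance from
    \<open>a\<close> to the line.\<close>
  have ea_nz: "of_real s * w - a \<noteq> 0" "norm (of_real s * w - a) \<ge> dd"
    if w: "w = u \<and> dd = d1 \<or> w = v \<and> dd = d2" for s w dd
  proof -
    have "norm (of_real s * w - a) \<ge> dd"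
      using w
    proof
      assume w: "w = u \<and> dd = d1"
      have "norm ((of_real s * w - a) * v) \<ge> \<bar>Im ((of_real s * w - a) * v)\<bar>" by (rule abs_Im_le_cmod)
      also have "Im ((of_real s * w - a) * v) = d1"
        using Ima(1) w by (simp add: algebra_simps u_def v_def)
      finally show ?thesis using w d by (simp add: norm_mult)
    next
      assume w: "w = v \<and> dd = d2"
      have "norm ((of_real s * w - a) * u) \<ge> \<bar>Im ((of_real s * w - a) * u)\<bar>" by (rule abs_Im_le_cmod)
      also have "Im ((of_real s * w - a) * u) = - d2"
        using Ima(2) w by (simp add: algebra_simps u_def v_def)
      finally show ?thesis using w d by (simp add: norm_mult)
    qed
    then show "norm (of_real s * w - a) \<ge> dd" .
    then show "of_real s * w - a \<noteq> 0" using w d by auto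
  qed
  have main: "2 * pi * norm (F a) \<le> (K / d1 + K / d2) + (12 * C / \<kappa>\<^sup>2) / R" if R: "R > R0" for R
  proof -
    have "R > 1 / \<kappa>" "R > 2 * norm a / \<kappa>" using R by (auto simp: R0_def)
    then have R\<kappa>: "\<kappa> * R > 1" "\<kappa> * R > 2 * norm a" using \<kappa> by (auto simp: field_simps)
    have R0: "R > 0" using R\<kappa>(1) \<kappa>(1) zero_less_mult_pos[of \<kappa> R] by simp
    \<comment> \<open>The supremum C / (\<kappa> R) / (\<kappa> R / 2) times the length, at most 2
      R, gives the constant 4 C / \<kappa>^2.\<close>
    have outer: "norm (contour_integral (linepath p q) (\<lambda>b. G b / (b - a))) \<le> (4 * C / \<kappa>\<^sup>2) / R"
      if G: "continuous_on (closed_segment p q) (\<lambda>b. G b / (b - a))"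
        and big: "\<And>b. b \<in> closed_segment p q \<Longrightarrow> norm b \<ge> \<kappa> * R"
        and GC: "\<And>b. b \<in> closed_segment p q \<Longrightarrow> norm (G b) \<le> C / norm b"
        and pq: "norm p = R" "norm q = R" for G p q
    proof -
      have "norm (contour_integral (linepath p q) (\<lambda>b. G b / (b - a))) \<le> (C / (\<kappa> * R) / (\<kappa> * R / 2)) * norm (q - p)"
      proof (rule contour_integral_bound_linepath[OF contour_integrable_continuous_linepath[OF G]])
        show "0 \<le> C / (\<kappa> * R) / (\<kappa> * R / 2)" using C \<kappa> R0 by simp
        fix b assume b: "b \<in> closed_segment p q"
        have "norm (G b) \<le> C / (\<kappa> * R)"
          using GC[OF b] big[OF b] C \<kappa> R0 R\<kappa> 
          by (elim order_trans) (intro divide_left_mono mult_pos_pos, auto)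
        moreover have "norm (b - a) \<ge> \<kappa> * R / 2"
          using norm_triangle_ineq2[of b a] big[OF b] R\<kappa>(2) by simp
        ultimately show "norm (G b / (b - a)) \<le> C / (\<kappa> * R) / (\<kappa> * R / 2)"
          unfolding norm_divide using C \<kappa> R0 by (intro frac_le) auto
      qed
      also have "\<dots> \<le> (C / (\<kappa> * R) / (\<kappa> * R / 2)) * (2 * R)"
        using norm_triangle_ineq4[of q p] pq C \<kappa> R0 by (intro mult_left_mono) auto
      also have "\<dots> = (4 * C / \<kappa>\<^sup>2) / R" using R0 \<kappa> by (simp add: power2_eq_square field_simps)
      finally show ?thesis .
    qed
    define p q r where "p = of_real R * u" and "q = of_real R * v" and "r = - complex_of_real R"
    have npq: "norm p = R" "norm q = R" "norm r = R" using R0 by (auto simp: p_def q_def r_def norm_mult)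
    have tri: "convex hull {0, q, p} = {of_real (R * t1) * v + of_real (R * t2) * u | t1 t2. 0 \<le> t1 \<and> 0 \<le> t2 \<and> t1 + t2 \<le> 1}"
      unfolding convex_hull_3_alt p_def q_def by (simp add: scaleR_conv_of_real mult_ac)
    have Re_tri: "Re (of_real (R * t1) * v + of_real (R * t2) * u) = R * (t1 + t2) * cos \<phi>"
      and Im_tri: "Im (of_real (R * t1) * v + of_real (R * t2) * u) = R * (t2 - t1) * sin \<phi>" for t1 t2
      by (simp_all add: u_def v_def algebra_simps)
    have T1_sub: "convex hull {0, q, p} \<subseteq> {b. Re b \<ge> 0}"
      using R0 cos_\<phi> unfolding tri by (auto simp only: Re_tri mem_Collect_eq subset_iff intro!: mult_nonneg_nonneg)
    have T1_pos: "Re b > 0" if "b \<in> convex hull {0, q, p}" "b \<noteq> 0" for b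
    proof -
      obtain t1 t2 where t: "b = of_real (R * t1) * v + of_real (R * t2) * u" "0 \<le> t1" "0 \<le> t2"
        using \<open>b \<in> _\<close> unfolding tri by blast
      have "t1 + t2 \<noteq> 0"
      proof
        assume "t1 + t2 = 0"
        then have "t1 = 0" "t2 = 0" using t by linarith+
        then show False using t(1) that(2) by simp
      qed
      then have "t1 + t2 > 0" using t by simp
      then show ?thesis unfolding t(1) Re_tri using R0 cos_\<phi> by (intro mult_pos_pos) auto
    qed
    have aint: "a \<in> interior (convex hull {0, q, p})"
    proof -
      \<comment> \<open>An open set contained in the triangle and containing \<open>a\<close>: the
        open sector cut off at the outer side.\<close>
      define W where "W = {b. \<bar>Im b\<bar> * cos \<phi> < Re b * sin \<phi> \<and> Re b < R * cos \<phi>}"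
      have "open W" unfolding W_def by (intro open_Collect_conj open_Collect_less continuous_intros)
      moreover have "W \<subseteq> convex hull {0, q, p}"
      proof
        fix b assume b: "b \<in> W"
        \<comment> \<open>In these coordinates x is the sum and y the difference of the two
          barycentric weights, so the weights are (x - y)/2 and (x + y)/2.\<close>
        define x y where "x = Re b / (R * cos \<phi>)" and "y = Im b / (R * sin \<phi>)"
        have b': "\<bar>Im b\<bar> * cos \<phi> < Re b * sin \<phi>" "Re b < R * cos \<phi>" using b by (auto simp: W_def)
        have "\<bar>y\<bar> < x" 
        proof -
          have "\<bar>Im b\<bar> / sin \<phi> < Re b / cos \<phi>" using b'(1) sin_\<phi> cos_\<phi> by (simp add: field_simps)
          then have "\<bar>Im b\<bar> / sin \<phi> / R < Re b / cos \<phi> / R" using R0 by (rule divide_strict_right_mono)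
          then show ?thesis using R0 sin_\<phi> unfolding x_def y_def by (simp add: abs_mult mult.commute)
        qed
        moreover have "x \<le> 1" using b'(2) R0 cos_\<phi> by (simp add: x_def)
        moreover have "b = of_real (R * ((x - y) / 2)) * v + of_real (R * ((x + y) / 2)) * u"
        proof (rule complex_eqI)
          show "Re b = Re (of_real (R * ((x - y) / 2)) * v + of_real (R * ((x + y) / 2)) * u)"
            unfolding Re_tri using R0 cos_\<phi> by (simp add: x_def field_simps)
          show "Im b = Im (of_real (R * ((x - y) / 2)) * v + of_real (R * ((x + y) / 2)) * u)"
            unfolding Im_tri using R0 sin_\<phi> by (simp add: y_def field_simps)
        qed
        ultimately show "b \<in> convex hull {0, q, p}" unfolding tri mem_Collect_eq
          by (intro exI[of _ "(x - y) / 2"] exI[of _ "(x + y) / 2"] conjI) (assumption | simp add: field_simps abs_less_iff)+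
      qed
      moreover have "a \<in> W"
      proof -
        have "\<bar>Im a * cos \<phi>\<bar> < Re a * sin \<phi>" using Ima' d by linarith
        then have "\<bar>Im a\<bar> * cos \<phi> < Re a * sin \<phi>" using cos_\<phi> by (simp add: abs_mult)
        moreover have "Re a < R * cos \<phi>"
        proof -
          have "Re a \<le> norm a" by (rule complex_Re_le_cmod)
          also have "\<dots> \<le> 2 * norm a" by simp
          also have "\<dots> < \<kappa> * R" using R\<kappa> by simp
          also have "\<dots> \<le> cos \<phi> * R" using \<kappa>(2) R0 by (intro mult_right_mono) auto
          finally show ?thesis by (simp add: mult.commute)
        qed
        ultimately show ?thesis by (simp add: W_def)
      qed
      ultimately show ?thesis using interior_maximal by blast
    qed
    have segp: "\<exists>s. b = of_real s * u" if b: "b \<in> closed_segment 0 p" for b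
    proof -
      obtain t where "b = t *\<^sub>R p" using b by (auto simp: closed_segment_def)
      then have "b = of_real (t * R) * u" by (simp add: p_def scaleR_conv_of_real)
      then show ?thesis ..
    qed
    have segq: "\<exists>s. b = of_real s * v" if b: "b \<in> closed_segment 0 q" for b
    proof -
      obtain t where "b = t *\<^sub>R q" using b by (auto simp: closed_segment_def)
      then have "b = of_real (t * R) * v" by (simp add: q_def scaleR_conv_of_real)
      then show ?thesis ..
    qed
    have segqp: "Re b = R * cos \<phi>" if b: "b \<in> closed_segment q p" for b
    proof -
      obtain t where t: "b = (1 - t) *\<^sub>R q + t *\<^sub>R p" using b by (auto simp: closed_segment_def)
      show ?thesis unfolding t p_def q_def u_def v_def by (simp add: algebra_simps)
    qed
    have an: "a \<notin> closed_segment 0 p" "a \<notin> closed_segment 0 q" "a \<notin> closed_segment q p"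
    proof -
      show "a \<notin> closed_segment 0 p" 
      proof
        assume "a \<in> closed_segment 0 p"
        then obtain s where "a = of_real s * u" using segp by blast
        then show False using ea_nz(1)[of u d1 s] by simp
      qed
      show "a \<notin> closed_segment 0 q" 
      proof
        assume "a \<in> closed_segment 0 q"
        then obtain s where "a = of_real s * v" using segq by blast
        then show False using ea_nz(1)[of v d2 s] by simp
      qed
      have "\<kappa> * R \<le> cos \<phi> * R" using \<kappa>(2) R0 by (intro mult_right_mono) auto
      then have "Re a < cos \<phi> * R" using R\<kappa>(2) complex_Re_le_cmod[of a] norm_ge_zero[of a] by linarith
      then have "Re a \<noteq> R * cos \<phi>" by (simp add: mult.commute)
      then show "a \<notin> closed_segment q p" using segqp by blast
    qed
    let ?g = "linepath 0 q +++ linepath q p +++ linepath p 0"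
    have hull_seg: "closed_segment 0 q \<subseteq> convex hull {0, q, p}" "closed_segment q p \<subseteq> convex hull {0, q, p}"
      "closed_segment 0 p \<subseteq> convex hull {0, q, p}"
      by (simp_all add: closed_segment_subset_convex_hull hull_inc)
    \<comment> \<open>The weak form of Cauchy's formula is used because at the vertex 0 only
      continuity of \<open>F\<close> is known; 0 is put into the exceptional set.\<close>
    have "(Fa has_contour_integral (2 * pi * \<i> * winding_number ?g a * F a)) ?g"
      unfolding Fa_def
    proof (rule Cauchy_integral_formula_weak[where S="convex hull {0, q, p}" and k="{0}"])
      show "continuous_on (convex hull {0, q, p}) F" by (rule continuous_on_subset[OF contF T1_sub])
      show "F field_differentiable at x" if "x \<in> interior (convex hull {0, q, p}) - {0}" for x
        using T1_pos[of x] that interior_subset[of "convex hull {0, q, p}"]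
        by (intro holomorphic_on_imp_differentiable_at[OF holF open_halfspace_Re_gt]) auto
      show "a \<in> interior (convex hull {0, q, p}) - {0}" using aint a by simp
      show "path_image ?g \<subseteq> convex hull {0, q, p} - {a}"
        using an hull_seg by (auto simp: path_image_join closed_segment_commute)
    qed auto
    then have e1: "contour_integral (linepath 0 q) Fa + contour_integral (linepath q p) Fa + contour_integral (linepath p 0) Fa
        = 2 * pi * \<i> * winding_number ?g a * F a"
      by (rule has_chain_integral_chain_integral3)
    \<comment> \<open>The winding number is 1 or -1, so its modulus settles the matter for either
      orientation.\<close>
    have nW: "norm (2 * pi * \<i> * winding_number ?g a * F a) = 2 * pi * norm (F a)"
      unfolding winding_number_triangle[OF aint] by (simp add: norm_mult)
    have wedge_hull: "\<exists>\<alpha> \<beta>. \<alpha> \<ge> 0 \<and> \<beta> \<ge> 0 \<and> b = of_real \<alpha> * w - of_real \<beta>"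
      if b: "b \<in> convex hull {0, of_real R * w, r}" for b w
    proof -
      obtain t1 t2 where "0 \<le> t1" "0 \<le> t2" "b = t1 *\<^sub>R (of_real R * w) + t2 *\<^sub>R r"
        using b unfolding convex_hull_3_alt by auto
      then show ?thesis using R0
        by (intro exI[of _ "t1 * R"] exI[of _ "t2 * R"]) (auto simp: r_def scaleR_conv_of_real)
    qed
    have hullOm: "convex hull {0, of_real R * w, r} \<subseteq> \<Omega>" if w: "w = u \<or> w = v" for w
    proof
      fix b assume "b \<in> convex hull {0, of_real R * w, r}"
      then obtain \<alpha> \<beta> where "\<alpha> \<ge> 0" "\<beta> \<ge> 0" "b = of_real \<alpha> * w - of_real \<beta>" using wedge_hull by blast
      then show "b \<in> \<Omega>" using w by (intro Om wedge_Arg[of w]) (auto simp: u_def v_def)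
    qed
    have hp: "convex hull {0, p, r} \<subseteq> \<Omega>" using hullOm[of u] by (simp add: p_def)
    have hq: "convex hull {0, r, q} \<subseteq> \<Omega>" using hullOm[of v] by (simp add: q_def insert_commute)
    have e2: "contour_integral (linepath 0 p) Ea + contour_integral (linepath p r) Ea + contour_integral (linepath r 0) Ea = 0"
      by (intro has_chain_integral_chain_integral3 Cauchy_theorem_triangle holomorphic_on_subset[OF holEa hp])
    have e3: "contour_integral (linepath 0 r) Ea + contour_integral (linepath r q) Ea + contour_integral (linepath q 0) Ea = 0"
      by (intro has_chain_integral_chain_integral3 Cauchy_theorem_triangle holomorphic_on_subset[OF holEa hq])
    have contEa: "continuous_on \<Omega> Ea" using holEa by (rule holomorphic_on_imp_continuous_on)
    have hs: "closed_segment 0 p \<subseteq> \<Omega>" "closed_segment p r \<subseteq> \<Omega>" "closed_segment 0 r \<subseteq> \<Omega>" 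
       "closed_segment r q \<subseteq> \<Omega>" "closed_segment 0 q \<subseteq> \<Omega>"
    proof -
      have cs: "closed_segment x y \<subseteq> \<Omega>" if "x \<in> S" "y \<in> S" "convex hull S \<subseteq> \<Omega>" for x y S
        using closed_segment_subset_convex_hull[of x S y] hull_inc[of x S convex] hull_inc[of y S convex] that by blast
      show "closed_segment 0 p \<subseteq> \<Omega>" "closed_segment p r \<subseteq> \<Omega>" "closed_segment 0 r \<subseteq> \<Omega>" 
        by (rule cs[OF _ _ hp]; simp)+
      show "closed_segment r q \<subseteq> \<Omega>" "closed_segment 0 q \<subseteq> \<Omega>"
        by (rule cs[OF _ _ hq]; simp)+
    qed
    have contFa: "continuous_on (closed_segment 0 p) Fa" "continuous_on (closed_segment 0 q) Fa" "continuous_on (closed_segment q p) Fa"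
    proof -
      have "continuous_on X Fa" if X: "X \<subseteq> convex hull {0, q, p}" "a \<notin> X" for X
      proof -
        have "continuous_on X F" by (rule continuous_on_subset[OF contF]) (use X(1) T1_sub in blast)
        moreover have "\<forall>b\<in>X. b - a \<noteq> 0" using X(2) by auto
        ultimately show ?thesis unfolding Fa_def by (intro continuous_on_divide continuous_on_diff continuous_on_id continuous_on_const)
      qed
      then show "continuous_on (closed_segment 0 p) Fa" "continuous_on (closed_segment 0 q) Fa" "continuous_on (closed_segment q p) Fa"
        using an hull_seg by auto
    qed
    have rev: "contour_integral (linepath p 0) Fa = - contour_integral (linepath 0 p) Fa"
      "contour_integral (linepath r 0) Ea = - contour_integral (linepath 0 r) Ea"
      "contour_integral (linepath q 0) Ea = - contour_integral (linepath 0 q) Ea"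
      using contour_integral_reverse_linepath[OF contFa(1)]
        contour_integral_reverse_linepath[OF continuous_on_subset[OF contEa hs(3)]]
        contour_integral_reverse_linepath[OF continuous_on_subset[OF contEa hs(5)]]
      by simp_all
    \<comment> \<open>On a ray the difference of the two integrands is b^N times the jump, divided
      by b - a; the denominator is bounded below by the distance \<open>dd\<close>.\<close>
    have ray: "norm (contour_integral (linepath 0 (of_real R * w)) Fa - contour_integral (linepath 0 (of_real R * w)) Ea) \<le> K / dd"
      if w: "w = u \<and> dd = d1 \<or> w = v \<and> dd = d2" for w dd
    proof -
      have cf: "continuous_on (closed_segment 0 (of_real R * w)) Fa" "continuous_on (closed_segment 0 (of_real R * w)) Ea"
        using w contFa(1,2) continuous_on_subset[OF contEa hs(1)] continuous_on_subset[OF contEa hs(5)]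
        by (auto simp: p_def q_def)
      define h where "h s = norm ((of_real s * cis \<phi>) ^ Suc M * stokes_jump lam (of_real s * cis \<phi>)) / dd" for s
      have ddp: "dd > 0" using w d by auto
      have "norm (contour_integral (linepath 0 (of_real R * w)) (\<lambda>b. Fa b - Ea b)) \<le> (LBINT s:{0<..}. h s)"
      proof (rule norm_contour_integral_ray_le[OF R0])
        show "norm w = 1" using w by auto
        show "continuous_on (closed_segment 0 (of_real R * w)) (\<lambda>b. Fa b - Ea b)" using cf by (intro continuous_intros)
        show "set_integrable lborel {0<..} h" unfolding h_def by (intro set_integrable_divide) (use ray_integrable in auto)
        fix s :: real assume s: "s > 0"
        have re: "Re (of_real s * w) > 0" "Im (of_real s * w) \<noteq> 0"
          using w s sin_\<phi> cos_\<phi> by (auto simp: u_def v_def)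
        have wc: "of_real s * w = of_real s * cis \<phi> \<or> of_real s * w = cnj (of_real s * cis \<phi>)"
          using w by (auto simp: u_def v_def cis_cnj)
        have im: "Im (of_real s * cis \<phi>) \<noteq> 0" using s sin_\<phi> by simp
        have "Fa (of_real s * w) - Ea (of_real s * w) = (of_real s * w) ^ Suc M * stokes_jump lam (of_real s * w) / (of_real s * w - a)"
          unfolding Fa_def Ea_def F_def E_def diff_divide_distrib[symmetric] left_remainder_jump[OF lam re] ..
        then have "norm (Fa (of_real s * w) - Ea (of_real s * w)) = norm (of_real s * w) ^ Suc M * norm (stokes_jump lam (of_real s * w)) / norm (of_real s * w - a)"
          by (simp only: norm_mult norm_divide norm_power)
        also have "norm (stokes_jump lam (of_real s * w)) = norm (stokes_jump lam (of_real s * cis \<phi>))"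
          using wc norm_stokes_jump_cnj[OF lam im] by (elim disjE) (simp_all only:)
        also have "norm (of_real s * w) = norm (of_real s * cis \<phi>)" using w by (auto simp: norm_mult)
        also have "norm (of_real s * cis \<phi>) ^ Suc M * norm (stokes_jump lam (of_real s * cis \<phi>)) / norm (of_real s * w - a) \<le> h s"
          unfolding h_def norm_mult norm_power using ea_nz(2)[OF w, of s] ddp
          by (intro divide_left_mono mult_nonneg_nonneg mult_pos_pos) auto
        finally show "norm (Fa (of_real s * w) - Ea (of_real s * w)) \<le> h s" .
      qed
      also have "(LBINT s:{0<..}. h s) = K / dd"
        unfolding h_def K_def by (rule set_integral_divide_zero)
      finally show ?thesis
        using cf by (subst contour_integral_diff[symmetric]) (auto intro: contour_integrable_continuous_linepath)
    qed
    have o1: "norm (contour_integral (linepath q p) Fa) \<le> (4 * C / \<kappa>\<^sup>2) / R"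
      unfolding Fa_def[abs_def]
    proof (rule outer)
      show "continuous_on (closed_segment q p) (\<lambda>b. F b / (b - a))" using contFa(3) by (simp add: Fa_def[abs_def])
      fix b assume b: "b \<in> closed_segment q p"
      have "\<kappa> * R \<le> cos \<phi> * R" using \<kappa>(2) R0 by (intro mult_right_mono) auto
      also have "\<dots> = Re b" using segqp[OF b] by simp
      finally show kb: "\<kappa> * R \<le> norm b" using complex_Re_le_cmod[of b] by simp
      have "Re b > 0" using segqp[OF b] R0 cos_\<phi> by simp
      from C1(2)[OF this] show "norm (F b) \<le> C / norm b"
        using C by (elim order_trans) (intro divide_right_mono, auto)
    qed (use npq in auto)
    have oE: "norm (contour_integral (linepath x y) Ea) \<le> (4 * C / \<kappa>\<^sup>2) / R"
      if seg: "closed_segment x y = closed_segment r (of_real R * w)" and w: "w = u \<or> w = v" 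
        and xy: "norm x = R" "norm y = R" and sub: "closed_segment x y \<subseteq> \<Omega>" for x y w
      unfolding Ea_def[abs_def]
    proof (rule outer)
      show "continuous_on (closed_segment x y) (\<lambda>b. E b / (b - a))"
        using continuous_on_subset[OF contEa sub] by (simp add: Ea_def[abs_def])
      fix b assume "b \<in> closed_segment x y"
      then obtain t where t: "0 \<le> t" "t \<le> 1" "b = (1 - t) *\<^sub>R r + t *\<^sub>R (of_real R * w)"
        unfolding seg by (auto simp: closed_segment_def)
      have w': "w = cis \<phi> \<or> w = cis (- \<phi>)" using w by (simp add: u_def v_def)
      have b: "b = of_real (t * R) * w - of_real ((1 - t) * R)"
        unfolding t(3) r_def by (simp add: scaleR_conv_of_real algebra_simps)
      have nn: "0 \<le> t * R" "0 \<le> (1 - t) * R" using t R0 by auto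
      have "\<kappa> * R \<le> sqrt ((1 - cos \<phi>) / 2) * R" using \<kappa>(3) R0 by (intro mult_right_mono) auto
      also have "\<dots> = sqrt ((1 - cos \<phi>) / 2) * (t * R + (1 - t) * R)" by (simp add: algebra_simps)
      also have "\<dots> \<le> norm b" unfolding b by (rule wedge_norm[OF w' nn])
      finally show kb: "\<kappa> * R \<le> norm b" .
      then have nb: "norm b \<ge> 1" using R\<kappa> by simp
      have "b = 0 \<or> \<phi> \<le> \<bar>Arg b\<bar>" by (rule wedge_Arg[OF w' nn b])
      then have "\<phi> \<le> \<bar>Arg b\<bar>" using nb by auto
      from C2(2)[OF this nb] show "norm (E b) \<le> C / norm b"
        using C by (elim order_trans) (intro divide_right_mono, auto)
    qed (use xy in auto)
    have o2: "norm (contour_integral (linepath p r) Ea) \<le> (4 * C / \<kappa>\<^sup>2) / R"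
      by (rule oE[of _ _ u]) (use npq hs in \<open>auto simp: p_def closed_segment_commute\<close>)
    have o3: "norm (contour_integral (linepath r q) Ea) \<le> (4 * C / \<kappa>\<^sup>2) / R"
      by (rule oE[of _ _ v]) (use npq hs in \<open>auto simp: q_def closed_segment_commute\<close>)
    have rp: "norm (contour_integral (linepath 0 p) Fa - contour_integral (linepath 0 p) Ea) \<le> K / d1"
      unfolding p_def by (rule ray) simp
    have rq: "norm (contour_integral (linepath 0 q) Fa - contour_integral (linepath 0 q) Ea) \<le> K / d2"
      unfolding q_def by (rule ray) simp
    \<comment> \<open>In the sum of the three identities the two passages along the negative real
      axis cancel, and those along each ray combine into a difference of \<open>Fa\<close> and
      \<open>Ea\<close>.\<close>
    have "2 * pi * \<i> * winding_number ?g a * F a =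
       (contour_integral (linepath 0 q) Fa - contour_integral (linepath 0 q) Ea)
       - (contour_integral (linepath 0 p) Fa - contour_integral (linepath 0 p) Ea)
       + contour_integral (linepath q p) Fa + contour_integral (linepath p r) Ea + contour_integral (linepath r q) Ea"
    proof -
      have "W = (x1 - y5) - (x3 - y1) + x2 + y2 + y4"
        if "x1 + x2 + - x3 = W" "y1 + y2 + - y3 = 0" "y3 + y4 + - y5 = 0" for W x1 x2 x3 y1 y2 y3 y4 y5 :: complex
      proof -
        have "(y1 + y2 + - y3) + (y3 + y4 + - y5) = 0" unfolding that(2,3) by simp
        then show ?thesis unfolding that(1)[symmetric] by (simp add: algebra_simps)
      qed
      from this[OF e1[unfolded rev] e2[unfolded rev] e3[unfolded rev]] show ?thesis .
    qed
    then have "2 * pi * norm (F a) = norm ((contour_integral (linepath 0 q) Fa - contour_integral (linepath 0 q) Ea)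
       - (contour_integral (linepath 0 p) Fa - contour_integral (linepath 0 p) Ea)
       + contour_integral (linepath q p) Fa + contour_integral (linepath p r) Ea + contour_integral (linepath r q) Ea)"
      using nW by (simp only:)
    also have "\<dots> \<le> K / d2 + K / d1 + (4 * C / \<kappa>\<^sup>2) / R + (4 * C / \<kappa>\<^sup>2) / R + (4 * C / \<kappa>\<^sup>2) / R"
      by (intro norm_triangle_mono order_trans[OF norm_triangle_ineq4 add_mono] rp rq o1 o2 o3)
    also have "\<dots> = (K / d1 + K / d2) + (12 * C / \<kappa>\<^sup>2) / R" by simp
    finally show ?thesis .
  qed
  have "((\<lambda>R. (K / d1 + K / d2) + (12 * C / \<kappa>\<^sup>2) / R) \<longlongrightarrow> (K / d1 + K / d2) + 0) at_top"
    by (intro tendsto_add tendsto_const tendsto_divide_0[OF tendsto_const] filterlim_at_top_imp_at_infinity filterlim_ident)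
  moreover have "eventually (\<lambda>R. 2 * pi * norm (F a) \<le> (K / d1 + K / d2) + (12 * C / \<kappa>\<^sup>2) / R) at_top"
    using eventually_gt_at_top[of R0] by eventually_elim (rule main)
  ultimately have "2 * pi * norm (F a) \<le> (K / d1 + K / d2) + 0"
    by (intro tendsto_lowerbound) auto
  then show ?thesis by (simp add: F_def d1_def d2_def)
qed

end

subsection \<open>The incomplete gamma function and the coefficients\<close>

text \<open>The definition integrates along the horizontal ray from \<open>z\<close>, the Laplace
  integral along the radial ray z e^t. Both are increments of one primitive on the right half-plane;
  points of the two rays with equal real part are joined by a vertical segment on which the
  integrand is exponentially small.\<close>

lemma upper_Gamma_eq_upper_Laplace:
  assumes z: "Re z > 0" and s: "Re s < 1"
  shows "upper_Gamma s z = z powr s * upper_Laplace (- s) z"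
proof -
  define g where "g u = u powr (s - 1) * exp (- u)" for u
  \<comment> \<open>Bounds |u^(s-1)| = |u|^(Re s - 1) exp(- Im s Arg u) on the half-plane Re u >= Re
    z: the first factor decreases in |u| because Re s < 1, and |Arg u| is at most pi.\<close>
  define C where "C = Re z powr (Re s - 1) * exp (pi * \<bar>Im s\<bar>)"
  have C0: "C \<ge> 0" by (simp add: C_def)
  have nR: "u \<notin> \<real>\<^sub>\<le>\<^sub>0" if "Re u > 0" for u using that by (auto simp: complex_nonpos_Reals_iff)
  have gC: "norm (g u) \<le> C * exp (- Re u)" if u: "Re u \<ge> Re z" for u
  proof -
    have u0: "u \<noteq> 0" using u z by auto
    have "norm u powr (Re s - 1) \<le> Re z powr (Re s - 1)"
      using s z u complex_Re_le_cmod[of u] by (intro powr_mono2') auto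
    moreover have "- Im s * Arg u \<le> pi * \<bar>Im s\<bar>"
    proof -
      have "- Im s * Arg u \<le> \<bar>- Im s * Arg u\<bar>" by simp
      also have "\<dots> \<le> \<bar>Im s\<bar> * pi"
        unfolding abs_mult using mpi_less_Arg[of u] Arg_le_pi[of u] by (intro mult_mono) auto
      finally show ?thesis by (simp add: mult.commute)
    qed
    ultimately have "norm (u powr (s - 1)) \<le> C"
      unfolding norm_powr_complex C_def by (intro mult_mono) auto
    then show ?thesis unfolding g_def norm_mult using C0 by (intro mult_mono) auto
  qed
  have "g holomorphic_on {u. Re u > 0}"
    unfolding g_def using nR by (intro holomorphic_intros) auto
  then obtain P where P: "\<And>u. u \<in> {u. Re u > 0} \<Longrightarrow> (P has_field_derivative g u) (at u within {u. Re u > 0})"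
    by (rule holomorphic_convex_primitive'[OF convex_halfspace_Re_gt open_halfspace_Re_gt]) (rule that)
  have P': "(P has_field_derivative g u) (at u)" if "Re u > 0" for u
    using P[of u] that by (simp add: at_within_open[OF _ open_halfspace_Re_gt])
  have 1: "((\<lambda>T. P (z + of_real T) - P (z + of_real 0)) \<longlongrightarrow> (LBINT t:{0<..}. g (z + of_real t))) at_top"
  proof (rule set_integral_FTC_limit)
    have cont: "isCont (\<lambda>t. g (z + of_real t)) t" if "t \<ge> 0" for t :: real
      unfolding g_def using that z nR[of "z + of_real t"] by (intro continuous_intros) auto
    then show "isCont (\<lambda>t. g (z + of_real t)) t" if "t \<ge> 0" for t :: real using that .
    show "((\<lambda>T. P (z + of_real T)) has_vector_derivative g (z + of_real t)) (at t)" if t: "t \<ge> 0" for t :: real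
    proof -
      have "((\<lambda>w. P (z + w)) has_field_derivative g (z + of_real t)) (at (of_real t))"
        using DERIV_shift[of P "g (z + of_real t)" "of_real t" z] P'[of "z + of_real t"] z t by (simp add: add.commute)
      then show ?thesis by (rule has_vector_derivative_real_field)
    qed
    show "set_integrable lborel {0<..} (\<lambda>t. g (z + of_real t))"
    proof (rule set_integrable_exp_bound[of 1])
      show "continuous_on {0<..} (\<lambda>t. g (z + of_real t))" using cont by (intro continuous_at_imp_continuous_on) auto
      show "norm (g (z + of_real t)) \<le> (C * exp (- Re z)) * exp (- (1 * t))" if "t > 0" for t
        using gC[of "z + of_real t"] that by (simp add: mult.assoc exp_add[symmetric] add.commute)
    qed simp
  qed
  have 2: "((\<lambda>T. P (z * exp (of_real T)) - P (z * exp (of_real 0))) \<longlongrightarrow> (LBINT t:{0<..}. z powr s * exp (- ((- s) * of_real t) - z * exp (of_real t)))) at_top"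
  proof (rule set_integral_FTC_limit)
    show "isCont (\<lambda>t. z powr s * exp (- ((- s) * of_real t) - z * exp (of_real t))) t" for t :: real
      by (intro continuous_intros)
    show "set_integrable lborel {0<..} (\<lambda>t. z powr s * exp (- ((- s) * of_real t) - z * exp (of_real t)))"
      by (intro set_integrable_mult_right upper_Laplace_integrable z)
    fix t :: real
    have e: "exp (of_real t :: complex) = of_real (exp t)" by (simp add: exp_of_real)
    have re: "Re (z * exp (of_real t)) > 0" unfolding e using z by simp
    have z0: "z \<noteq> 0" using z by auto
    have Ln: "Ln (z * exp (of_real t)) = Ln z + of_real t"
      unfolding e using z0 Ln_times_of_real[of "exp t" z] by (simp add: mult.commute add.commute Ln_of_real)
    have "g (z * exp (of_real t)) * (z * exp (of_real t)) = exp (s * (Ln z + of_real t)) * exp (- (z * exp (of_real t)))"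
    proof -
      have "(z * exp (of_real t)) powr (s - 1) * (z * exp (of_real t)) = (z * exp (of_real t)) powr s"
        using z0 by (simp add: powr_diff)
      also have "\<dots> = exp (s * (Ln z + of_real t))" using z0 by (simp add: powr_def Ln)
      finally show ?thesis by (simp add: g_def mult_ac)
    qed
    also have "\<dots> = z powr s * exp (- ((- s) * of_real t) - z * exp (of_real t))"
      using z0 by (simp add: powr_def exp_add[symmetric] exp_diff[symmetric] algebra_simps)
        (simp add: exp_diff exp_add exp_minus divide_inverse algebra_simps)?
    finally have v: "g (z * exp (of_real t)) * (z * exp (of_real t)) = z powr s * exp (- ((- s) * of_real t) - z * exp (of_real t))" .
    have "((\<lambda>w. z * exp w) has_field_derivative z * exp (of_real t)) (at (of_real t))"
      by (rule derivative_eq_intros refl)+ simp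
    from DERIV_chain2[OF P'[OF re] this, unfolded v]
    show "((\<lambda>T. P (z * exp (of_real T))) has_vector_derivative z powr s * exp (- ((- s) * of_real t) - z * exp (of_real t))) (at t)"
      by (rule has_vector_derivative_real_field)
  qed
  \<comment> \<open>The reparametrisation gives the radial point z (1 + T / Re z) the same real part
    as the horizontal point z + T.\<close>
  have "filterlim (\<lambda>T. ln (1 + T / Re z)) at_top at_top"
    using z by real_asymp
  from filterlim_compose[OF 2 this]
  have 3: "((\<lambda>T. P (z * exp (of_real (ln (1 + T / Re z)))) - P z) \<longlongrightarrow> z powr s * upper_Laplace (- s) z) at_top"
    by (simp add: upper_Laplace_def)
  \<comment> \<open>The vertical gap |Im z| T / Re z grows only linearly, against the factor
    exp(-(Re z + T)) of the integrand.\<close>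
  have "((\<lambda>T. (P (z + of_real T) - P z) - (P (z * exp (of_real (ln (1 + T / Re z)))) - P z)) \<longlongrightarrow> 0) at_top"
  proof (rule Lim_null_comparison)
    have "((\<lambda>T. c * exp (- (x + T)) * (y * T / x)) \<longlongrightarrow> 0) at_top" if "x > 0" for c x y :: real
      using that by real_asymp
    then show "((\<lambda>T. C * exp (- (Re z + T)) * (\<bar>Im z\<bar> * T / Re z)) \<longlongrightarrow> 0) at_top" using z .
    show "eventually (\<lambda>T. norm ((P (z + of_real T) - P z) - (P (z * exp (of_real (ln (1 + T / Re z)))) - P z)) \<le> C * exp (- (Re z + T)) * (\<bar>Im z\<bar> * T / Re z)) at_top"
      using eventually_gt_at_top[of 0]
    proof eventually_elim
      case (elim T)
      define k where "k = 1 + T / Re z"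
      have k: "k > 0" using elim z by (simp add: k_def add_pos_pos)
      define S where "S = {u. Re u = Re z + T}"
      have S: "z + of_real T \<in> S" "z * of_real k \<in> S"
        using z by (auto simp: S_def k_def field_simps)
      have "convex S" unfolding S_def
        by (rule convexI) (simp add: distrib_right[symmetric])
      have "norm (P (z + of_real T) - P (z * of_real k)) \<le> (C * exp (- (Re z + T))) * norm ((z + of_real T) - z * of_real k)"
      proof (rule field_differentiable_bound[OF \<open>convex S\<close> _ _ S(1,2)])
        fix u assume u: "u \<in> S"
        then show "(P has_field_derivative g u) (at u within S)"
          using P'[of u] z elim by (intro has_field_derivative_at_within[OF P']) (simp add: S_def)
        show "norm (g u) \<le> C * exp (- (Re z + T))" using gC[of u] u elim by (simp add: S_def)
      qed
      also have "(z + of_real T) - z * of_real k = - (\<i> * of_real (Im z * T / Re z))"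
        using z by (intro complex_eqI) (auto simp: k_def field_simps)
      also have "norm \<dots> = \<bar>Im z\<bar> * T / Re z" using z elim by (simp add: norm_mult norm_divide)
      finally show ?case using k by (simp add: exp_of_real k_def)
    qed
  qed
  from tendsto_add[OF this 3] have "((\<lambda>T. P (z + of_real T) - P z) \<longlongrightarrow> z powr s * upper_Laplace (- s) z) at_top"
    by simp
  moreover have "((\<lambda>T. P (z + of_real T) - P z) \<longlongrightarrow> upper_Gamma s z) at_top"
    using 1 by (simp add: upper_Gamma_def g_def)
  ultimately show ?thesis using tendsto_unique trivial_limit_at_top_linorder by blast
qed

section \<open>Lagrange inversion for the coefficients\<close>

lemma phase_0 [simp]: "phase lam 0 = 0" by (simp add: phase_def)

context
  fixes lam :: real
  assumes lam: "0 < lam" "lam * exp 1 < 1"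
begin

text \<open>A zero would need |e^t| = 1/lam, which exceeds e, while |e^t| is at most e on the unit
  disc. Circles of radius at most 1 about 0 thus avoid the poles of all amplitudes.\<close>

lemma one_plus_exp_nz_disc:
  assumes "norm t \<le> 1"
  shows "1 + of_real lam * exp t \<noteq> (0::complex)"
proof
  assume "1 + of_real lam * exp t = 0"
  then have "of_real lam * exp t = -1" by (simp add: eq_neg_iff_add_eq_0 add.commute)
  then have "norm (of_real lam * exp t) = 1" by simp
  moreover have "norm (of_real lam * exp t) \<le> lam * exp 1"
    using lam assms complex_Re_le_cmod[of t] by (simp add: norm_mult)
  ultimately show False using lam by simp
qed

lemma phase_zero_isolated:
  obtains r where "0 < r" "r \<le> 1" "\<And>t. norm t \<le> r \<Longrightarrow> t \<noteq> 0 \<Longrightarrow> phase lam t \<noteq> 0"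
proof -
  have "phase lam holomorphic_on UNIV" unfolding phase_def by (intro holomorphic_intros)
  moreover have "deriv (phase lam) 0 \<noteq> 0"
    using phase_has_field_derivative[of lam 0 UNIV] one_plus_exp_nz_disc[of 0] by (simp add: DERIV_imp_deriv)
  ultimately obtain d where d: "d > 0" "inj_on (phase lam) (ball 0 d)"
    using has_complex_derivative_locally_injective[of "phase lam" UNIV 0] by auto
  have "phase lam t \<noteq> 0" if "norm t \<le> min (d / 2) 1" "t \<noteq> 0" for t
  proof
    assume "phase lam t = 0"
    then have "phase lam t = phase lam 0" by simp
    then have "t = 0" by (rule inj_onD[OF d(2)]) (use that d(1) in auto)
    then show False using that by simp
  qed
  then show ?thesis using that[of "min (d / 2) 1"] d by auto
qed

text \<open>The denominator is the phase, which has a simple zero at 0 with derivative 1 + lam. The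
  prescribed value 1 is therefore the limit, and the singularity is removable.\<close>

lemma b_neg_base_holomorphic:
  assumes r: "0 < r" and nz: "\<And>t. norm t < r \<Longrightarrow> t \<noteq> 0 \<Longrightarrow> phase lam t \<noteq> 0"
  shows "b_neg_base lam holomorphic_on ball 0 r"
proof (rule no_isolated_singularity)
  have eq: "b_neg_base lam t = (of_real lam + 1) * t / phase lam t" if "t \<noteq> 0" for t
    using that by (simp add: b_neg_base_def phase_def algebra_simps)
  have "(\<lambda>t. (of_real lam + 1) * t / phase lam t) holomorphic_on ball 0 r - {0}"
    using nz unfolding phase_def by (intro holomorphic_intros) auto
  then show hol: "b_neg_base lam holomorphic_on ball 0 r - {0}"
    by (rule holomorphic_transform) (auto simp: eq)
  show "continuous_on (ball 0 r) (b_neg_base lam)"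
  proof (rule continuous_at_imp_continuous_on, rule ballI)
    fix t :: complex assume t: "t \<in> ball 0 r"
    show "isCont (b_neg_base lam) t"
    proof (cases "t = 0")
      case False
      have "open (ball 0 r - {0::complex})" by auto
      then show ?thesis
        using holomorphic_on_imp_continuous_on[OF hol] t False by (simp add: continuous_on_eq_continuous_at)
    next
      case True
      have D: "((\<lambda>t. phase lam t / t) \<longlongrightarrow> 1 + of_real lam) (at 0)"
        using phase_has_field_derivative[of lam 0 UNIV] by (simp add: has_field_derivative_iff)
      have l0: "1 + of_real lam \<noteq> (0::complex)" using one_plus_exp_nz_disc[of 0] by simp
      have "((\<lambda>t. (of_real lam + 1) / (phase lam t / t)) \<longlongrightarrow> (of_real lam + 1) / (1 + of_real lam)) (at 0)"
        using l0 by (intro tendsto_intros D)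
      then have "((\<lambda>t. (of_real lam + 1) / (phase lam t / t)) \<longlongrightarrow> 1) (at 0)"
        using l0 by (simp add: add.commute)
      then have "(b_neg_base lam \<longlongrightarrow> 1) (at 0)"
        by (rule Lim_transform_eventually) (auto simp: eventually_at_filter eq)
      then show ?thesis unfolding True by (simp add: isCont_def b_neg_base_def)
    qed
  qed
qed auto

text \<open>Lagrange inversion by repeated integration by parts on a small circle: each step trades one
  power of the phase in the denominator for one application of the amplitude recursion.\<close>

lemma contour_integral_amp_by_parts:
  assumes r: "0 < r" "r \<le> 1" and nz: "\<And>t. norm t \<le> r \<Longrightarrow> t \<noteq> 0 \<Longrightarrow> phase lam t \<noteq> 0" and m: "m > 0"
  shows "contour_integral (circlepath 0 r) (\<lambda>t. amp lam k t / phase lam t ^ Suc m)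
     = contour_integral (circlepath 0 r) (\<lambda>t. amp lam (Suc k) t / phase lam t ^ m) / of_nat m"
proof -
  define Q where "Q t = amp lam k t / (1 + of_real lam * exp t)" for t
  have circ: "norm t = r" "phase lam t \<noteq> 0" "1 + of_real lam * exp t \<noteq> 0" if "t \<in> path_image (circlepath 0 r)" for t
  proof -
    show n: "norm t = r" using that r by simp
    show "phase lam t \<noteq> 0" using nz[of t] n r by auto
    show "1 + of_real lam * exp t \<noteq> 0" using one_plus_exp_nz_disc n r by simp
  qed
  have amp_cont: "continuous_on (path_image (circlepath 0 r)) (amp lam j)" for j
    unfolding amp_def by (intro continuous_intros ballI circ(3)) 
  have ph_cont: "continuous_on (path_image (circlepath 0 r)) (phase lam)"
    unfolding phase_def by (intro continuous_intros)
  have int: "(\<lambda>t. amp lam j t / phase lam t ^ n) contour_integrable_on circlepath 0 r" for j n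
    using circ(2) by (intro contour_integrable_continuous_circlepath continuous_intros amp_cont ph_cont) auto
  have "((\<lambda>t. amp lam (Suc k) t / phase lam t ^ m - of_nat m * (amp lam k t / phase lam t ^ Suc m)) has_contour_integral 0) (circlepath 0 r)"
  proof (rule Cauchy_theorem_primitive[where f="\<lambda>t. Q t * inverse (phase lam t ^ m)" and S="path_image (circlepath 0 r)"])
    fix t assume t: "t \<in> path_image (circlepath 0 r)"
    note c = circ[OF t]
    have 1: "(Q has_field_derivative amp lam (Suc k) t) (at t within path_image (circlepath 0 r))"
      unfolding Q_def by (rule amp_recurrence[OF c(3)])
    have 2: "((\<lambda>t. inverse (phase lam t ^ m)) has_field_derivative
        - (inverse (phase lam t ^ m) * (of_nat m * (phase lam t ^ (m - 1) * (1 + of_real lam * exp t))) * inverse (phase lam t ^ m)))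
        (at t within path_image (circlepath 0 r))"
      by (rule DERIV_inverse') (use c in \<open>auto intro!: derivative_eq_intros phase_has_field_derivative simp: mult_ac\<close>)
    have "amp lam (Suc k) t * inverse (phase lam t ^ m) +
        - (inverse (phase lam t ^ m) * (of_nat m * (phase lam t ^ (m - 1) * (1 + of_real lam * exp t))) * inverse (phase lam t ^ m)) * Q t
       = amp lam (Suc k) t / phase lam t ^ m - of_nat m * (amp lam k t / phase lam t ^ Suc m)"
    proof -
      obtain j where j: "m = Suc j" using m by (cases m) auto
      have e: "P * iP = 1 \<Longrightarrow> Y * AY = A \<Longrightarrow> Pj * iPm = iP \<Longrightarrow>
          A' * iPm + - (iPm * (M * (Pj * Y)) * iPm) * AY = A' * iPm - M * (A * (iPm * iP))"
        for P iP Y AY A A' Pj iPm M :: complex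
        by algebra
      show ?thesis
        using e[of "phase lam t" "inverse (phase lam t)" "1 + of_real lam * exp t" "Q t" "amp lam k t" "phase lam t ^ j" "inverse (phase lam t ^ m)" "amp lam (Suc k) t" "of_nat m"] c
        unfolding Q_def j by (simp add: divide_inverse mult_ac)
    qed
    with DERIV_mult[OF 1 2]
    show "((\<lambda>t. Q t * inverse (phase lam t ^ m)) has_field_derivative
       amp lam (Suc k) t / phase lam t ^ m - of_nat m * (amp lam k t / phase lam t ^ Suc m)) (at t within path_image (circlepath 0 r))"
      by (simp add: mult_ac)
  qed auto
  from contour_integral_unique[OF this]
  have "contour_integral (circlepath 0 r) (\<lambda>t. amp lam (Suc k) t / phase lam t ^ m)
      - of_nat m * contour_integral (circlepath 0 r) (\<lambda>t. amp lam k t / phase lam t ^ Suc m) = 0"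
    by (simp only: contour_integral_diff[OF int contour_integrable_lmul[OF int]] contour_integral_lmul[OF int])
  then show ?thesis using m by (simp add: field_simps)
qed

text \<open>Cauchy's formula writes the n-th derivative as the contour integral of phase^(-(n+1)),
  up to constants. Integrating by parts n times reduces it to amp_n / phase, whose residue at 0 is
  amp_n(0) / (1 + lam); the factorials cancel.\<close>

lemma b_neg_eq_amp:
  "b_neg n lam = (of_real lam + 1) ^ (2 * n + 1) * (amp lam n 0 / (1 + of_real lam))"
proof -
  obtain r where r: "0 < r" "r \<le> 1" and nz: "\<And>t. norm t \<le> r \<Longrightarrow> t \<noteq> 0 \<Longrightarrow> phase lam t \<noteq> 0"
    using phase_zero_isolated by blast
  let ?C = "circlepath 0 (r/2)"
  define L where "L = (of_real lam + 1 :: complex)"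
  have L: "L \<noteq> 0" using one_plus_exp_nz_disc[of 0] by (simp add: L_def add.commute)
  have r2: "0 < r/2" "r/2 \<le> 1" and nz2: "\<And>t. norm t \<le> r/2 \<Longrightarrow> t \<noteq> 0 \<Longrightarrow> phase lam t \<noteq> 0"
    using r nz by auto
  have circ: "norm t = r/2" "t \<noteq> 0" if "t \<in> path_image ?C" for t
    using that r by auto
  have base: "b_neg_base lam holomorphic_on ball 0 r"
    by (rule b_neg_base_holomorphic[OF r(1)]) (use nz in auto)
  have eq: "b_neg_base lam t = L * t / phase lam t" if "t \<noteq> 0" for t
    using that by (simp add: b_neg_base_def phase_def algebra_simps L_def)
  have sub: "cball 0 (r/2) \<subseteq> ball (0::complex) r" using r by auto
  have "((\<lambda>u. b_neg_base lam u ^ (n + 1) / (u - 0) ^ Suc n) has_contour_integral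
      (2 * pi * \<i> / fact n) * (deriv ^^ n) (\<lambda>t. b_neg_base lam t ^ (n + 1)) 0) ?C"
  proof (rule Cauchy_has_contour_integral_higher_derivative_circlepath)
    have h: "(\<lambda>t. b_neg_base lam t ^ (n + 1)) holomorphic_on cball 0 (r/2)"
      using holomorphic_on_subset[OF base sub] by (intro holomorphic_intros)
    then show "continuous_on (cball 0 (r/2)) (\<lambda>t. b_neg_base lam t ^ (n + 1))"
      by (rule holomorphic_on_imp_continuous_on)
    show "(\<lambda>t. b_neg_base lam t ^ (n + 1)) holomorphic_on ball 0 (r/2)"
      using h by (rule holomorphic_on_subset) auto
  qed (use r in auto)
  from contour_integral_unique[OF this]
  have D: "(2 * pi * \<i> / fact n) * (deriv ^^ n) (\<lambda>t. b_neg_base lam t ^ (n + 1)) 0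
      = contour_integral ?C (\<lambda>u. b_neg_base lam u ^ (n + 1) / (u - 0) ^ Suc n)" by simp
  have "contour_integral ?C (\<lambda>u. b_neg_base lam u ^ (n + 1) / (u - 0) ^ Suc n)
      = contour_integral ?C (\<lambda>t. L ^ (n + 1) * (amp lam 0 t / phase lam t ^ Suc n))"
  proof (rule contour_integral_eq)
    fix u assume u: "u \<in> path_image ?C"
    show "b_neg_base lam u ^ (n + 1) / (u - 0) ^ Suc n = L ^ (n + 1) * (amp lam 0 u / phase lam u ^ Suc n)"
      using circ[OF u] nz2[of u] by (simp add: eq power_divide power_mult_distrib)
  qed
  also have "\<dots> = L ^ (n + 1) * contour_integral ?C (\<lambda>t. amp lam 0 t / phase lam t ^ Suc n)"
  proof (rule contour_integral_lmul)
    show "(\<lambda>t. amp lam 0 t / phase lam t ^ Suc n) contour_integrable_on ?C"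
    proof -
      have "continuous_on (path_image ?C) (phase lam)" unfolding phase_def by (intro continuous_intros)
      moreover have "\<forall>t\<in>path_image ?C. phase lam t ^ Suc n \<noteq> 0"
      proof
        fix t assume t: "t \<in> path_image ?C"
        have "phase lam t \<noteq> 0" by (rule nz2[OF eq_refl[OF circ(1)[OF t]] circ(2)[OF t]])
        then show "phase lam t ^ Suc n \<noteq> 0" by simp
      qed
      ultimately show ?thesis
        unfolding amp_0
        by (rule contour_integrable_continuous_circlepath[OF continuous_on_divide[OF continuous_on_const continuous_on_power]])
    qed
  qed
  also have "contour_integral ?C (\<lambda>t. amp lam 0 t / phase lam t ^ Suc n) = contour_integral ?C (\<lambda>t. amp lam n t / phase lam t ^ Suc 0) / fact n"
  proof -
    \<comment> \<open>The step with exponent m = n - k divides by m, so after k steps the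
      accumulated factor is (n - k)! / n!.\<close>
    have "k \<le> n \<Longrightarrow> contour_integral ?C (\<lambda>t. amp lam 0 t / phase lam t ^ Suc n) = contour_integral ?C (\<lambda>t. amp lam k t / phase lam t ^ Suc (n - k)) * (fact (n - k) / fact n)" for k
    proof (induction k)
      case (Suc k)
      define m where "m = n - k"
      have m: "m > 0" "n - Suc k = m - 1" "Suc (m - 1) = m" using Suc.prems by (auto simp: m_def)
      have "contour_integral ?C (\<lambda>t. amp lam k t / phase lam t ^ Suc m) = contour_integral ?C (\<lambda>t. amp lam (Suc k) t / phase lam t ^ m) / of_nat m"
        by (rule contour_integral_amp_by_parts[OF r2 nz2 m(1)])
      moreover have "fact m = of_nat m * (fact (m - 1) :: complex)" using fact_reduce[OF m(1)] .
      ultimately show ?case using Suc m(1) unfolding m(2) m(3) m_def[symmetric] by simp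
    qed simp
    from this[of n] show ?thesis by simp
  qed
  also have "contour_integral ?C (\<lambda>t. amp lam n t / phase lam t ^ Suc 0) = 2 * pi * \<i> * (amp lam n 0 / L)"
  proof -
    \<comment> \<open>The quotient amp / phase is written as a holomorphic function divided by u,
      with \<open>b_neg_base\<close> absorbing the simple zero of the phase.\<close>
    have "((\<lambda>u. (amp lam n u * (b_neg_base lam u / L)) / (u - 0)) has_contour_integral 2 * of_real pi * \<i> * (amp lam n 0 * (b_neg_base lam 0 / L))) ?C"
    proof (rule Cauchy_integral_circlepath_simple)
      have "amp lam n holomorphic_on cball 0 (r/2)"
        unfolding amp_def poly_altdef using r2 one_plus_exp_nz_disc by (intro holomorphic_intros) auto
      then show "(\<lambda>u. amp lam n u * (b_neg_base lam u / L)) holomorphic_on cball 0 (r/2)"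
        using holomorphic_on_subset[OF base sub] L by (intro holomorphic_intros) auto
    qed (use r in auto)
    from contour_integral_unique[OF this]
    have "contour_integral ?C (\<lambda>u. (amp lam n u * (b_neg_base lam u / L)) / (u - 0)) = 2 * of_real pi * \<i> * (amp lam n 0 / L)"
      by (simp add: b_neg_base_def)
    moreover have "contour_integral ?C (\<lambda>u. (amp lam n u * (b_neg_base lam u / L)) / (u - 0)) = contour_integral ?C (\<lambda>t. amp lam n t / phase lam t ^ Suc 0)"
      by (rule contour_integral_eq) (use circ(2) L in \<open>simp add: eq\<close>)
    ultimately show ?thesis by simp
  qed
  finally have "(2 * pi * \<i> / fact n) * (deriv ^^ n) (\<lambda>t. b_neg_base lam t ^ (n + 1)) 0
      = (2 * pi * \<i> / fact n) * (L ^ (n + 1) * (amp lam n 0 / L))"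
    unfolding D by simp
  then have "(deriv ^^ n) (\<lambda>t. b_neg_base lam t ^ (n + 1)) 0 = L ^ (n + 1) * (amp lam n 0 / L)"
    by (subst (asm) mult_cancel_left) simp
  then have "b_neg n lam = L ^ n * (L ^ (n + 1) * (amp lam n 0 / L))"
    by (simp add: b_neg_def L_def)
  then show ?thesis by (simp add: L_def add.commute mult_2 power_add)
qed

end

subsection \<open>The bound on the remainder\<close>

text \<open>Existence comes from the intermediate value theorem on [0, 1], where w e^w reaches e.
  For uniqueness, a positive value of v e^v forces v > 0, and there the function is strictly
  increasing.\<close>

lemma Lambert_W_positive:
  assumes x: "0 < x" "x \<le> exp 1"
  shows "Lambert_W x > 0" "Lambert_W x * exp (Lambert_W x) = x"
proof -
  have "\<exists>w\<ge>0. w \<le> 1 \<and> w * exp w = x"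
    by (rule IVT') (use x in \<open>auto intro!: continuous_intros\<close>)
  then obtain w where w0: "w \<ge> 0" and w: "w * exp w = x" by blast
  then have "w > 0" using x by (cases "w = 0") auto
  have "Lambert_W x = w"
    unfolding Lambert_W_def
  proof (rule the_equality)
    show "w \<ge> -1 \<and> w * exp w = x" using w w0 by simp
    fix v assume v: "v \<ge> -1 \<and> v * exp v = x"
    then have "v > 0" using x by (metis exp_gt_zero zero_less_mult_pos2)
    have mono: "s * exp s < t * exp t" if "0 < s" "s < t" for s t :: real
      using that by (intro mult_strict_mono) auto
    show "v = w"
      using mono[of v w] mono[of w v] v w \<open>w > 0\<close> \<open>v > 0\<close> by (cases v w rule: linorder_cases) auto
  qed
  then show "Lambert_W x > 0" "Lambert_W x * exp (Lambert_W x) = x" using w \<open>w > 0\<close> by auto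
qed

lemma less_Lambert_W_imp:
  assumes "0 < lam" "lam < Lambert_W x" "0 < x" "x \<le> exp 1"
  shows "lam * exp lam < x"
proof -
  have "lam * exp lam < Lambert_W x * exp (Lambert_W x)"
    using assms by (intro mult_strict_mono) auto
  then show ?thesis using Lambert_W_positive[OF assms(3,4)] by simp
qed

text \<open>The condition on the real part says that rotation by pi/4 carries \<open>c\<close> below
  the real axis, so sin(Arg c + pi/4) is negative.\<close>

lemma Arg_second_quadrant:
  assumes x: "Re c < - Im c" and y: "0 < Im c"
  shows "3 * pi / 4 < Arg c" "Arg c < pi"
proof -
  have A: "0 < Arg c" "Arg c < pi" using Arg_lt_pi[of c] y by auto
  show "Arg c < pi" by fact
  have c0: "norm c > 0" using y by auto
  have "Im (c * cis (pi / 4)) = (Re c + Im c) * (sqrt 2 / 2)"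
    by (simp add: cos_45 sin_45 algebra_simps)
  also have "\<dots> < 0" using x by (simp add: mult_neg_pos)
  finally have "norm c * sin (Arg c + pi / 4) < 0" unfolding Im_mult_cis .
  then have "sin (Arg c + pi / 4) < 0" using c0 by (simp add: mult_less_0_iff)
  then show "3 * pi / 4 < Arg c"
    using sin_ge_zero[of "Arg c + pi / 4"] A by linarith
qed

text \<open>With b = t cis(pi - omega) the point t cis(omega) is - cnj b, so the two gamma factors
  have equal modulus. The remaining exponents add up to -t ((lam + ln lam + 1) cos omega + pi sin
  omega), and the bracket is \<open>norm c\<close> because omega is the argument of c.\<close>

lemma norm_stokes_jump_ray:
  fixes lam t :: real
  defines "c \<equiv> of_real lam + of_real (ln lam) + 1 + of_real pi * \<i>"
  assumes lam: "lam > 0" and t: "t > 0"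
  shows "norm (stokes_jump lam (of_real t * cis (pi - Arg c)))
    = sqrt (2 * pi) * t powr (- 1 / 2) * exp (- t * norm c) * norm (Gamma_star (of_real t * cis (Arg c)))"
proof -
  define \<omega> where "\<omega> = Arg c"
  define b where "b = of_real t * cis (pi - \<omega>)"
  define w where "w = of_real t * cis \<omega>"
  have Imc: "Im c = pi" and Rec: "Re c = lam + ln lam + 1" by (simp_all add: c_def)
  have \<omega>: "0 < \<omega>" "\<omega> < pi" using Arg_lt_pi[of c] Imc unfolding \<omega>_def by auto
  have polar: "lam + ln lam + 1 = norm c * cos \<omega>" "pi = norm c * sin \<omega>"
    using Im_mult_cis[of c 0] rcis_cmod_Arg[of c] Imc Rec unfolding \<omega>_def
    by (metis Re_rcis, metis Im_rcis)
  have wb: "w = - cnj b" by (simp add: w_def b_def complex_eq_iff)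
  have "norm (Gamma w) = norm (Gamma (- b))"
    unfolding wb by (metis cnj_Gamma complex_cnj_minus complex_mod_cnj)
  have Argw: "Arg w = \<omega>" and Argb: "Arg b = pi - \<omega>"
    using t \<omega> by (simp_all add: w_def b_def Arg_times_of_real Arg_cis)
  have nw: "norm w = t" and nb: "norm b = t" using t by (simp_all add: w_def b_def norm_mult)
  have b0: "b \<noteq> 0" using nb t by auto
  have Re: "Re w = t * cos \<omega>" "Re b = - (t * cos \<omega>)" "Im w = t * sin \<omega>" "Im b = t * sin \<omega>"
    by (simp_all add: w_def b_def)
  have G: "norm (Gamma_star w) = norm (Gamma (- b)) / (sqrt (2 * pi) * (t powr (t * cos \<omega> - 1 / 2) * exp (- (t * sin \<omega>) * \<omega>)) * exp (- (t * cos \<omega>)))"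
    unfolding Gamma_star_def norm_divide norm_mult norm_powr_complex norm_exp_eq_Re nw Argw
    using \<open>norm (Gamma w) = norm (Gamma (- b))\<close> by (simp add: Re)
  have J: "norm (stokes_jump lam b) = norm (Gamma (- b)) * t powr (- (t * cos \<omega>)) * (lam * exp lam) powr (- (t * cos \<omega>)) * exp (- ((pi - \<omega>) * (t * sin \<omega>)))"
    unfolding norm_stokes_jump[OF lam b0] nb Argb Re ..
  define k where "k = t powr (t * cos \<omega> - 1 / 2) * exp (- (t * sin \<omega>) * \<omega>) * exp (- (t * cos \<omega>))"
  have k0: "k > 0" using t by (simp add: k_def)
  have "norm (Gamma_star w) = norm (Gamma (- b)) / (sqrt (2 * pi) * k)"
    unfolding G k_def by (simp only: mult.assoc)
  then have "norm (Gamma (- b)) = sqrt (2 * pi) * k * norm (Gamma_star w)"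
    using k0 by simp
  then have "norm (stokes_jump lam b) = sqrt (2 * pi) * norm (Gamma_star w) * (k * t powr (- (t * cos \<omega>)) * (lam * exp lam) powr (- (t * cos \<omega>)) * exp (- ((pi - \<omega>) * (t * sin \<omega>))))"
    unfolding J by simp
  also have "k * t powr (- (t * cos \<omega>)) * (lam * exp lam) powr (- (t * cos \<omega>)) * exp (- ((pi - \<omega>) * (t * sin \<omega>)))
     = (t powr (t * cos \<omega> - 1 / 2) * t powr (- (t * cos \<omega>))) * (exp (- (t * sin \<omega>) * \<omega>) * exp (- (t * cos \<omega>)) * (lam * exp lam) powr (- (t * cos \<omega>)) * exp (- ((pi - \<omega>) * (t * sin \<omega>))))"
    by (simp add: k_def)
  also have "t powr (t * cos \<omega> - 1 / 2) * t powr (- (t * cos \<omega>)) = t powr (- 1 / 2)"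
    by (simp add: powr_add[symmetric])
  also have "(lam * exp lam) powr (- (t * cos \<omega>)) = exp (- (t * cos \<omega>) * (lam + ln lam))"
    using lam by (simp add: powr_def ln_mult add.commute)
  also have "exp (- (t * sin \<omega>) * \<omega>) * exp (- (t * cos \<omega>)) * exp (- (t * cos \<omega>) * (lam + ln lam)) * exp (- ((pi - \<omega>) * (t * sin \<omega>)))
    = exp (- t * norm c)"
  proof -
    have "- (t * sin \<omega>) * \<omega> + - (t * cos \<omega>) + - (t * cos \<omega>) * (lam + ln lam) + - ((pi - \<omega>) * (t * sin \<omega>))
      = - t * ((lam + ln lam + 1) * cos \<omega> + pi * sin \<omega>)"
      by (simp add: algebra_simps)
    also have "(lam + ln lam + 1) * cos \<omega> + pi * sin \<omega> = norm c * ((sin \<omega>)\<^sup>2 + (cos \<omega>)\<^sup>2)"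
      by (subst polar(1), subst polar(2)) (simp only: power2_eq_square distrib_left mult_ac add.commute)
    also have "\<dots> = norm c" by simp
    finally show ?thesis unfolding exp_add[symmetric] by (simp only:)
  qed
  finally show ?thesis by (simp add: b_def w_def \<omega>_def mult_ac)
qed

text \<open>Because z + a = (1 + lam) a, the denominators (z + a)^(2n+1) cancel the powers of lam +
  1 in the coefficients, leaving the expansion obtained by parts.\<close>

lemma remainder_R_half_integral:
  assumes lam: "0 < lam" "lam * exp 1 < 1" and a: "Re a > 0"
  shows "a ^ N * remainder_R N a lam = half_integral lam 1 N a"
proof -
  define z where "z = of_real lam * a"
  define L where "L = (1 + of_real lam :: complex)"
  have L: "L \<noteq> 0" using one_plus_exp_nz_disc[OF lam, of 0] by (simp add: L_def)
  have z: "Re z > 0" "z \<noteq> 0" using a lam by (auto simp: z_def)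
  have a0: "a \<noteq> 0" using a by auto
  have za: "z + a = L * a" by (simp add: z_def L_def algebra_simps)
  have "half_integral lam 1 0 a = exp z * upper_Laplace a z"
    unfolding z_def by (rule half_integral_upper_Laplace[OF lam(1)])
  then have "upper_Gamma (- a) z / (z powr (- a) * exp (- z)) = half_integral lam 1 0 a"
    using upper_Gamma_eq_upper_Laplace[OF z(1), of "- a"] a z(2) by (simp add: exp_minus field_simps)
  moreover have "a ^ n * b_neg n lam / (z + a) ^ (2 * n + 1) = amp lam n 0 / (1 + of_real lam) / a ^ (n + 1)" for n
  proof -
    have "a ^ (2 * n + 1) = a ^ n * a ^ (n + 1)" by (simp add: mult_2 power_add)
    then show ?thesis
      unfolding b_neg_eq_amp[OF lam] za L_def[symmetric] add.commute[of "of_real lam" 1] power_mult_distrib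
      using L a0 by simp
  qed
  ultimately have "remainder_R N a lam = half_integral lam 1 0 a - (\<Sum>n<N. amp lam n 0 / (1 + of_real lam) / a ^ (n + 1))"
    unfolding remainder_R_def Let_def z_def by simp
  then show ?thesis using half_integral_expansion[OF lam(1), of 1 a N] a by simp
qed

theorem mainTheorem8:
  fixes lam \<theta> \<omega> :: real and a z :: complex and N :: nat
  assumes "0 < lam" and "lam < Lambert_W (exp (- pi - 1))"
    and "\<omega> = omega lam"
    and "a \<noteq> 0" and "N > 0"
    and "z = of_real lam * a" and "\<theta> = Arg a"
  shows "(3 * pi / 4 < \<omega> \<and> \<omega> < pi) \<and>
    (\<bar>\<theta>\<bar> < - \<omega> + pi \<longrightarrow>
      norm (remainder_R N a lam)
        \<le> norm (a ^ N / (z + a) ^ (2 * N + 1))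
          * (2 * (lam + 1) ^ (2 * N + 1) / sqrt (2 * pi))
          * (LBINT t:{0<..}. t powr (real N - 1 / 2) * exp (- t * norm (of_real lam + of_real (ln lam) + 1 + of_real pi * \<i>))
               * norm (Gamma_star (of_real t * exp (\<i> * of_real \<omega>))))
          * ((\<bar>csc (\<theta> - \<omega>)\<bar> + \<bar>csc (\<theta> + \<omega>)\<bar>) / 2))"
proof (intro conjI impI)
  define c where "c = of_real lam + of_real (ln lam) + 1 + of_real pi * \<i>"
  have \<omega>c: "\<omega> = Arg c" using assms(3) by (simp add: omega_def c_def)
  have "- pi - 1 \<le> 1" using pi_gt_zero by linarith
  then have "exp (- pi - 1) \<le> exp (1::real)" by (simp only: exp_le_cancel_iff)
  then have lamW: "lam * exp lam < exp (- pi - 1)"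
    by (intro less_Lambert_W_imp assms(1,2)) auto
  \<comment> \<open>In logarithms the threshold exp(-pi - 1) reads Re c < -pi = - Im c, which places
    omega between 3 pi / 4 and pi.\<close>
  have "ln (lam * exp lam) < ln (exp (- pi - 1))"
    using lamW assms(1) by (subst ln_less_cancel_iff) auto
  then have small: "lam + ln lam + 1 < - pi" using assms(1) by (simp add: ln_mult)
  have "3 * pi / 4 < Arg c \<and> Arg c < pi"
    using Arg_second_quadrant[of c] small by (simp add: c_def)
  then show \<omega>: "3 * pi / 4 < \<omega>" "\<omega> < pi" by (simp_all add: \<omega>c)
  assume \<theta>: "\<bar>\<theta>\<bar> < - \<omega> + pi"
  \<comment> \<open>With this half-opening the contour rays are those on which the jump is explicit,
    and the hypothesis on \<theta> says that \<open>a\<close> lies strictly between them.\<close>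
  define \<phi> where "\<phi> = pi - \<omega>"
  have \<phi>: "0 < \<phi>" "\<phi> < pi / 2" using \<omega> by (auto simp: \<phi>_def)
  interpret stokes_sector lam \<phi>
    by standard (use assms(1) lamW \<phi> in auto)
  have lam1: "lam * exp 1 < 1"
  proof -
    have "lam * 1 \<le> lam * exp lam" using assms(1) by (intro mult_left_mono) auto
    then have "lam < exp (- pi - 1)" using lamW by simp
    then have "lam * exp 1 < exp (- pi - 1) * exp 1" by (intro mult_strict_right_mono) auto
    also have "\<dots> = exp (- pi)" by (simp add: exp_add[symmetric])
    also have "\<dots> < 1" by simp
    finally show ?thesis .
  qed
  have Rea: "Re a > 0"
  proof -
    have "\<bar>Im (Ln a)\<bar> < pi / 2"
      using \<theta> \<phi> assms(4,7) by (simp add: Arg_eq_Im_Ln \<phi>_def)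
    then show ?thesis using Re_Ln_pos_lt[OF assms(4)] by simp
  qed
  define I where "I = (LBINT t:{0<..}. t powr (real N - 1 / 2) * exp (- t * norm c) * norm (Gamma_star (of_real t * exp (\<i> * of_real \<omega>))))"
  obtain M where M: "N = Suc M" using assms(5) by (cases N) auto
  define s1 s2 where "s1 = sin (\<phi> - \<theta>)" and "s2 = sin (\<phi> + \<theta>)"
  have s: "s1 > 0" "s2 > 0" using \<theta> \<phi> unfolding s1_def s2_def \<phi>_def by (auto intro!: sin_gt_zero)
  have csc1: "\<bar>csc (\<theta> + \<omega>)\<bar> = 1 / s1" 
  proof -
    have "sin (\<theta> + \<omega>) = s1" unfolding s1_def \<phi>_def using sin_pi_minus[of "\<theta> + \<omega>"] by (simp add: algebra_simps)
    then show ?thesis using s by (simp add: csc_def)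
  qed
  have csc2: "\<bar>csc (\<theta> - \<omega>)\<bar> = 1 / s2"
  proof -
    have "sin (\<theta> - \<omega>) = - s2" unfolding s2_def \<phi>_def using sin_pi_minus[of "\<omega> - \<theta>"] sin_minus[of "\<omega> - \<theta>"] by (simp add: algebra_simps)
    then show ?thesis using s by (simp add: csc_def)
  qed
  have K: "(LBINT t:{0<..}. norm ((of_real t * cis \<phi>) ^ Suc M * stokes_jump lam (of_real t * cis \<phi>))) = sqrt (2 * pi) * I"
  proof -
    have "norm ((of_real t * cis \<phi>) ^ Suc M * stokes_jump lam (of_real t * cis \<phi>))
        = sqrt (2 * pi) * (t powr (real N - 1 / 2) * exp (- t * norm c) * norm (Gamma_star (of_real t * exp (\<i> * of_real \<omega>))))"
      if t: "t > 0" for t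
    proof -
      have "norm (stokes_jump lam (of_real t * cis \<phi>)) = sqrt (2 * pi) * t powr (- 1 / 2) * exp (- t * norm c) * norm (Gamma_star (of_real t * cis \<omega>))"
        using norm_stokes_jump_ray[OF assms(1) t] unfolding \<phi>_def \<omega>c c_def .
      moreover have "norm ((of_real t * cis \<phi>) ^ Suc M) = t powr real N"
        using t by (simp only: norm_power norm_mult norm_of_real norm_cis powr_realpow M) simp
      moreover have "t powr (real N - 1 / 2) = t powr real N * t powr (- 1 / 2)"
        by (simp add: powr_add[symmetric])
      ultimately show ?thesis by (simp only: norm_mult cis_conv_exp mult_ac)
    qed
    then have "(LBINT t:{0<..}. norm ((of_real t * cis \<phi>) ^ Suc M * stokes_jump lam (of_real t * cis \<phi>)))
       = (LBINT t:{0<..}. sqrt (2 * pi) * (t powr (real N - 1 / 2) * exp (- t * norm c) * norm (Gamma_star (of_real t * exp (\<i> * of_real \<omega>)))))"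
      by (intro set_lebesgue_integral_cong) auto
    then show ?thesis unfolding I_def by simp
  qed
  have na: "norm a > 0" using assms(4) by simp
  have "2 * pi * norm (half_integral lam 1 (Suc M) a) \<le> sqrt (2 * pi) * I / (norm a * s1) + sqrt (2 * pi) * I / (norm a * s2)"
  proof -
    have "\<bar>Arg a\<bar> < \<phi>" using \<theta> by (simp add: \<phi>_def assms(7))
    from half_integral_Stokes_bound[OF assms(4) this, of M]
    show ?thesis unfolding K s1_def s2_def assms(7) .
  qed
  also have "half_integral lam 1 (Suc M) a = a ^ N * remainder_R N a lam"
    using remainder_R_half_integral[OF assms(1) lam1 Rea, of N] M by simp
  finally have "2 * pi * (norm a ^ N * norm (remainder_R N a lam)) \<le> sqrt (2 * pi) * (I * (1 / s1 + 1 / s2) / norm a)"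
    using na s by (simp add: norm_mult norm_power field_simps)
  \<comment> \<open>One factor sqrt(2 pi) cancels against the one that \<open>K\<close> contributes;
    the other becomes the denominator in the bound.\<close>
  moreover have "2 * pi = sqrt (2 * pi) * sqrt (2 * pi)" by simp
  ultimately have "sqrt (2 * pi) * (sqrt (2 * pi) * (norm a ^ N * norm (remainder_R N a lam))) \<le> sqrt (2 * pi) * (I * (1 / s1 + 1 / s2) / norm a)"
    by (metis mult.assoc)
  then have "sqrt (2 * pi) * (norm a ^ N * norm (remainder_R N a lam)) \<le> I * (1 / s1 + 1 / s2) / norm a"
    by (subst (asm) mult_le_cancel_left_pos) auto
  then have R: "norm (remainder_R N a lam) \<le> I * (1 / s1 + 1 / s2) / norm a / (norm a ^ N * sqrt (2 * pi))"
    using na by (simp add: field_simps)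
  have nza: "norm (z + a) = (lam + 1) * norm a"
  proof -
    have "z + a = of_real (lam + 1) * a" using assms(6) by (simp add: algebra_simps)
    then show ?thesis using assms(1) by (simp only: norm_mult norm_of_real)
  qed
  have "norm (a ^ N / (z + a) ^ (2 * N + 1)) = norm a ^ N / ((lam + 1) ^ (2 * N + 1) * (norm a ^ N * (norm a ^ N * norm a)))"
    unfolding norm_divide norm_power nza by (simp add: power_mult_distrib power_add mult_2)
  also have "\<dots> = 1 / ((lam + 1) ^ (2 * N + 1) * (norm a ^ N * norm a))"
    using na by simp
  finally have Z: "norm (a ^ N / (z + a) ^ (2 * N + 1)) = 1 / ((lam + 1) ^ (2 * N + 1) * (norm a ^ N * norm a))" .
  have alg: "I * (1 / s1 + 1 / s2) / n / (A * q) = 1 / (P * (A * n)) * (2 * P / q) * I * ((1 / s2 + 1 / s1) / 2)"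
    if "P > 0" "A > 0" "n > 0" "q > 0" for P A n q :: real
    using that s by (simp add: field_simps)
  have "I * (1 / s1 + 1 / s2) / norm a / (norm a ^ N * sqrt (2 * pi))
     = 1 / ((lam + 1) ^ (2 * N + 1) * (norm a ^ N * norm a)) * (2 * (lam + 1) ^ (2 * N + 1) / sqrt (2 * pi)) * I * ((1 / s2 + 1 / s1) / 2)"
    by (rule alg) (use na assms(1) in auto)
  then show "norm (remainder_R N a lam)
        \<le> norm (a ^ N / (z + a) ^ (2 * N + 1))
          * (2 * (lam + 1) ^ (2 * N + 1) / sqrt (2 * pi))
          * (LBINT t:{0<..}. t powr (real N - 1 / 2) * exp (- t * norm (of_real lam + of_real (ln lam) + 1 + of_real pi * \<i>))
               * norm (Gamma_star (of_real t * exp (\<i> * of_real \<omega>))))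
          * ((\<bar>csc (\<theta> - \<omega>)\<bar> + \<bar>csc (\<theta> + \<omega>)\<bar>) / 2)"
    using R unfolding Z csc1 csc2 I_def c_def by simp
qed

end
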